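(* For each positive integer $d$, there is a constant $C=C_d>0$ such that the following holds. Let $0<p<1$, sample a $p$-random subset $A \subseteq \mathbb{Z}_{\geq 0}^d$, and set $S:=\langle A \rangle$. Then with high probability (as $p \to 0$), we have $$|S \cap \mathcal{R}_d(p,C^{-1} p^{-1}(\log p^{-1})^{d+1})|=o\big(|\mathcal{R}_d(p,C^{-1} p^{-1}(\log p^{-1})^{d+1})|\big)$$ and $$\mathbb{Z}_{\geq 0}^d \setminus \mathcal{R}_d(p,C p^{-1}(\log p^{-1})^{d+1}) \subseteq S,$$ and in particular the gap set has size $$|\mathbb{Z}_{\geq 0}^d \setminus S| \asymp_d p^{-1}(\log p^{-1})^{2d}.$$
   Context: A $p$-random subset of a set $X$ is a random subset in which each element of $X$ is included independently with probability $p$. For $A \subseteq \mathbb{Z}_{\geq 0}^d$, $\langle A \rangle:=\{a_1+\cdots+a_k: k \in \mathbb{Z}_{\geq 0},\ a_1,\ldots,a_k \in A\}$ (repeated summands allowed; the empty sum $0$ is included). For $Z>0$, $$\mathcal{R}_d(p,Z):=\{(x_1, \ldots, x_d) \in \mathbb{Z}_{\geq 0}^d: (x_1+\log p^{-1}) \cdots (x_d+\log p^{-1})\leq Z\}.$$ Logarithms are natural. An event (depending on $p$) occurs with high probability if its probability tends to $1$ as $p \to 0$. The first conclusion means: there is a function $\delta(p)\to 0$ as $p\to 0$ such that with high probability the left-hand side is at most $\delta(p)$ times the size of the indicated region. The notation $f \asymp_d g$ means $c\,g \leq f \leq c' g$ for constants $c,c'>0$ depending only on $d$; in the last conclusion,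 such constants exist so that the two inequalities hold with high probability. *)

theory Defs
  imports "HOL-Probability.Probability" "HOL-Library.Function_Algebras"
begin

text \<open>
  A point of \<open>\<int>\<^sub>\<ge>\<^sub>0\<^sup>d\<close> is a function \<open>nat \<Rightarrow> nat\<close> whose coordinates are the values at indices below
  \<open>d\<close>, padded with zeros, so that the dimension can be quantified over. Padding with \<open>0\<close> rather than
  \<open>undefined\<close> keeps the set closed under the pointwise addition of \<open>Function_Algebras\<close>.
\<close>

definition nat_vecs :: "nat \<Rightarrow> (nat \<Rightarrow> nat) set" where
  "nat_vecs d = {x. \<forall>i\<ge>d. x i = 0}"

definition semigroup_gen :: "'a::monoid_add set \<Rightarrow> 'a set" where
  "semigroup_gen A = {sum_list as | as. set as \<subseteq> A}"

definition hyp_region :: "nat \<Rightarrow> real \<Rightarrow> real \<Rightarrow> (nat \<Rightarrow> nat) set" where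
  "hyp_region d p Z = {x \<in> nat_vecs d. (\<Prod>i<d. (real (x i) + ln (1 / p))) \<le> Z}"

text \<open>
  The \<open>p\<close>-random subset of \<open>X\<close> is \<open>{x \<in> X. \<omega> x}\<close> for a family \<open>\<omega>\<close> of independent Bernoulli
  variables indexed by \<open>X\<close>. As \<^const>\<open>measure\<close> is \<open>0\<close> on non-measurable sets, a limit \<open>1\<close> in
  \<open>whp_random_subset\<close> includes measurability of the event for all small \<open>p\<close>.
\<close>

definition bernoulli_product :: "'a set \<Rightarrow> real \<Rightarrow> ('a \<Rightarrow> bool) measure" where
  "bernoulli_product X p = (\<Pi>\<^sub>M x\<in>X. measure_pmf (bernoulli_pmf p))"

definition prob_random_subset :: "'a set \<Rightarrow> real \<Rightarrow> ('a set \<Rightarrow> bool) \<Rightarrow> real" where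
  "prob_random_subset X p P =
     measure (bernoulli_product X p) {\<omega> \<in> space (bernoulli_product X p). P {x \<in> X. \<omega> x}}"

definition whp_random_subset :: "'a set \<Rightarrow> (real \<Rightarrow> 'a set \<Rightarrow> bool) \<Rightarrow> bool" where
  "whp_random_subset X P \<longleftrightarrow> ((\<lambda>p. prob_random_subset X p (P p)) \<longlongrightarrow> 1) (at_right 0)"

end

theory Submission
  imports Defs "HOL-Real_Asymp.Real_Asymp"
begin

text \<open>
  Write \<open>L = ln (1 / p)\<close>, so that \<open>1 / p = exp L\<close>, and \<open>Z\<close> for a constant multiple of
  \<open>(1 / p) L ^ (d + 1)\<close>. The threshold comes from a count: if \<open>\<Prod>i<d. (x i + L)\<close> has size \<open>C (1 / p) L ^ (d + 1)\<close>,
  then the box below \<open>x / L\<close> contains about \<open>C L\<close> elements of \<open>A\<close>, so sums of order \<open>L\<close> many of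
  them take \<open>exp (const L)\<close> values, and whether this beats the \<open>exp (O(L))\<close> possible values is decided by \<open>C\<close>.

  \<^bold>\<open>Sparsity.\<close> The inner region is covered by polylogarithmically many dyadic boxes \<open>x i \<le> 2 ^ k i * L\<close>.
  In one box, with \<open>s i = 1 / (4 d 2 ^ k i)\<close> and \<open>u a = exp (- s \<cdot> a)\<close>, expanding the generating function shows that the number of
  generated elements is at most \<open>exp (L / 4) * (\<Prod>a\<in>A - {0}. 1 / (1 - u a))\<close>
  (\<open>sum_exp_semigroup_gen_le\<close>). The expectation of this product is too large: small elements of \<open>A\<close> are
  unlikely but enter with high multiplicity, and in dimension one the harmonic sum
  \<open>\<Sum>a. u a / (1 - u a)\<close> in its exponent has an extra logarithmic factor.
  The square root of the product is harmless, as \<open>1 / sqrt (s a)\<close> is summable near the origin; its expectation is at most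
  \<open>exp (O(L / C))\<close>, and Markov's inequality makes a box with more than \<open>exp (L / 2)\<close> generated elements
  polynomially unlikely (\<open>subset_prob_box_dense\<close>). The region itself has more than \<open>1 / p = exp L\<close> points.

  \<^bold>\<open>Covering.\<close> A vector far outside the region is the sum of its two halves, so only vectors with
  coordinates at most \<open>1 / p ^ 2\<close> matter (\<open>generated_beyond_shell\<close>), and a union bound over these needs failure probabilities
  that are large powers of \<open>p\<close>. One element of \<open>A\<close> that agrees with \<open>x\<close> in all coordinates of size \<open>O(L)\<close>
  removes those coordinates and leaves a problem of the same kind on the set \<open>J\<close> of large coordinates.
  There, let \<open>w = x / (9 c)\<close> with \<open>c\<close> a multiple of \<open>L\<close>, and pick \<open>v i \<in> A\<close> close to \<open>w i\<close> times
  the \<open>i\<close>-th unit vector. The lattice generated by the \<open>v i\<close> has the fundamental cell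
  \<open>{\<Sum>i. \<theta> i * v i | 0 \<le> \<theta> i < 1}\<close>, which is a finite group under addition modulo the lattice, and \<open>A\<close> induces a
  \<open>p\<close>-random subset of it with at least \<open>c\<close> expected elements. Subset sums of at most \<open>3 c\<close> of these elements
  fill more than half of the cell, except with probability at most \<open>2 exp (- c / 7)\<close> times its size (\<open>subset_prob_no_short_cover\<close>); two sums of this
  kind then meet every class. So \<open>x\<close> is congruent to a sum \<open>s\<close> of at most \<open>6 c\<close> elements of the cell. All
  coordinates of \<open>s\<close> in the basis \<open>v\<close> are at most \<open>6 c\<close>, all those of \<open>x\<close> are at least \<open>6 c\<close>
  by diagonal dominance, and therefore \<open>x - s\<close> is a combination of the \<open>v i\<close> with natural coefficients (\<open>mem_semigroup_gen\<close>).
  The dependence of the cell on the random set is dealt with by a union bound over all possible \<open>v\<close>.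

  \<^bold>\<open>Size.\<close> Slicing the region along its last coordinate gives \<open>Z * (\<Sum>n. 1 / (n + L)) ^ (d - 1)\<close> points
  up to constants, which has order \<open>Z L ^ (d - 1)\<close>, that is \<open>(1 / p) L ^ (2 d)\<close>. The gap set lies between the
  inner region without its few generated points and the outer region.
\<close>

section \<open>Random subsets of a finite set\<close>

definition subset_weight :: "real \<Rightarrow> 'a set \<Rightarrow> 'a set \<Rightarrow> real" where
  "subset_weight p F T = p ^ card T * (1 - p) ^ card (F - T)"

text \<open>
  The probability of \<open>P\<close> for a \<open>p\<close>-random subset of a finite set, as a finite sum. All events to be estimated
  depend on finitely many vectors, so measure theory enters only in the comparison with \<open>prob_random_subset\<close> below.
\<close>

definition subset_prob :: "real \<Rightarrow> 'a set \<Rightarrow> ('a set \<Rightarrow> bool) \<Rightarrow> real" where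
  "subset_prob p F P = (\<Sum>T | T \<subseteq> F \<and> P T. subset_weight p F T)"

lemma subset_weight_nonneg: "0 \<le> p \<Longrightarrow> p \<le> 1 \<Longrightarrow> 0 \<le> subset_weight p F T"
  by (simp add: subset_weight_def)

text \<open>
  The expectation of a product over the random set factorizes by independence. Exponential moments and avoidance
  probabilities are special cases.
\<close>

lemma sum_subset_weight_prod:
  fixes g :: "'a \<Rightarrow> real"
  assumes "finite F"
  shows "(\<Sum>T\<in>Pow F. subset_weight p F T * (\<Prod>a\<in>T. g a)) = (\<Prod>a\<in>F. 1 - p + p * g a)"
proof -
  have "(\<Prod>a\<in>F. 1 - p + p * g a) = (\<Prod>a\<in>F. p * g a + (1 - p))"
    by (simp add: add.commute)
  also have "\<dots> = (\<Sum>T\<in>Pow F. (\<Prod>a\<in>T. p * g a) * (\<Prod>a\<in>F - T. 1 - p))"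
    using assms by (rule prod_add)
  also have "\<dots> = (\<Sum>T\<in>Pow F. subset_weight p F T * (\<Prod>a\<in>T. g a))"
    by (intro sum.cong) (auto simp: subset_weight_def prod.distrib)
  finally show ?thesis ..
qed

lemma sum_subset_weight: "finite F \<Longrightarrow> (\<Sum>T\<in>Pow F. subset_weight p F T) = 1"
  using sum_subset_weight_prod[of F p "\<lambda>_. 1"] by simp

text \<open>
  Markov's inequality, in the form in which \<open>h\<close> dominates the indicator of \<open>P\<close>.
\<close>

lemma subset_prob_le_expectation:
  assumes F: "finite F" and p: "0 \<le> p" "p \<le> 1"
    and "\<And>T. T \<subseteq> F \<Longrightarrow> P T \<Longrightarrow> 1 \<le> h T" "\<And>T. T \<subseteq> F \<Longrightarrow> 0 \<le> h T"
  shows "subset_prob p F P \<le> (\<Sum>T\<in>Pow F. subset_weight p F T * h T)"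
proof -
  have "subset_prob p F P \<le> (\<Sum>T | T \<subseteq> F \<and> P T. subset_weight p F T * h T)"
    unfolding subset_prob_def
  proof (intro sum_mono)
    fix T assume "T \<in> {T. T \<subseteq> F \<and> P T}"
    then have "1 \<le> h T" using assms(4) by auto
    then show "subset_weight p F T \<le> subset_weight p F T * h T"
      using mult_left_mono[OF _ subset_weight_nonneg[OF p], of 1 "h T" F T] by simp
  qed
  also have "\<dots> \<le> (\<Sum>T\<in>Pow F. subset_weight p F T * h T)"
    using F assms(5) subset_weight_nonneg[OF p] by (intro sum_mono2 mult_nonneg_nonneg) auto
  finally show ?thesis .
qed

lemma one_minus_power_le_exp:
  fixes p :: real
  assumes "0 \<le> p" "p \<le> 1"
  shows "(1 - p) ^ n \<le> exp (- (p * real n))"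
proof -
  have "(1 - p) ^ n \<le> exp (- p) ^ n"
    using assms exp_ge_add_one_self[of "- p"] by (intro power_mono) auto
  then show ?thesis by (simp add: exp_of_nat_mult[symmetric] mult.commute)
qed

lemma subset_prob_avoid:
  assumes F: "finite F" and p: "0 \<le> p" "p \<le> 1" and V: "V \<subseteq> F"
  shows "subset_prob p F (\<lambda>T. T \<inter> V = {}) \<le> exp (- (p * real (card V)))"
proof -
  have fV: "finite V" using F V finite_subset by blast
  let ?g = "\<lambda>a. if a \<in> V then 0 else (1::real)"
  have "subset_prob p F (\<lambda>T. T \<inter> V = {}) \<le> (\<Sum>T\<in>Pow F. subset_weight p F T * (\<Prod>a\<in>T. ?g a))"
  proof (rule subset_prob_le_expectation[OF F p])
    fix T assume "T \<inter> V = {}"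
    then have "(\<Prod>a\<in>T. ?g a) = (\<Prod>a\<in>T. 1)" by (intro prod.cong) auto
    then show "1 \<le> (\<Prod>a\<in>T. ?g a)" by simp
  qed (auto intro: prod_nonneg)
  also have "\<dots> = (\<Prod>a\<in>F. 1 - p + p * ?g a)" by (rule sum_subset_weight_prod[OF F])
  also have "\<dots> = (\<Prod>a\<in>F. if a \<in> V then 1 - p else 1)" by (intro prod.cong) auto
  also have "\<dots> = (\<Prod>a\<in>V. 1 - p)"
    using F V by (subst prod.inter_restrict[symmetric]) (auto simp: Int_absorb1)
  also have "\<dots> \<le> exp (- (p * real (card V)))"
    using one_minus_power_le_exp[OF p] by simp
  finally show ?thesis .
qed

lemma subset_prob_disj:
  assumes "finite F" "0 \<le> p" "p \<le> 1"
  shows "subset_prob p F (\<lambda>T. P T \<or> Q T) \<le> subset_prob p F P + subset_prob p F Q"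
proof -
  have eq: "{T. T \<subseteq> F \<and> (P T \<or> Q T)} = {T. T \<subseteq> F \<and> P T} \<union> {T. T \<subseteq> F \<and> Q T}" by auto
  have "0 \<le> sum (subset_weight p F) ({T. T \<subseteq> F \<and> P T} \<inter> {T. T \<subseteq> F \<and> Q T})"
    using assms by (intro sum_nonneg subset_weight_nonneg)
  then show ?thesis
    using sum_Un[of "{T. T \<subseteq> F \<and> P T}" "{T. T \<subseteq> F \<and> Q T}" "subset_weight p F"] assms(1)
    unfolding subset_prob_def eq by simp
qed

lemma subset_prob_mono:
  assumes "finite F" "0 \<le> p" "p \<le> 1" "\<And>A. A \<subseteq> F \<Longrightarrow> P A \<Longrightarrow> Q A"
  shows "subset_prob p F P \<le> subset_prob p F Q"
  unfolding subset_prob_def using assms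
  by (intro sum_mono2) (auto intro: subset_weight_nonneg)

lemma subset_prob_bex:
  assumes "finite F" "0 \<le> p" "p \<le> 1" "finite I"
  shows "subset_prob p F (\<lambda>A. \<exists>i\<in>I. Q i A) \<le> (\<Sum>i\<in>I. subset_prob p F (Q i))"
  using assms(4)
proof (induction I rule: finite_induct)
  case empty
  then show ?case by (simp add: subset_prob_def)
next
  case (insert k I)
  have "subset_prob p F (\<lambda>A. \<exists>i\<in>insert k I. Q i A) = subset_prob p F (\<lambda>A. Q k A \<or> (\<exists>i\<in>I. Q i A))"
    by simp
  also have "\<dots> \<le> subset_prob p F (Q k) + subset_prob p F (\<lambda>A. \<exists>i\<in>I. Q i A)"
    using assms by (intro subset_prob_disj)
  finally show ?case using insert by simp
qed

text \<open>
  Keeping each element of a \<open>p\<close>-random set with probability \<open>r\<close> yields a \<open>p * r\<close>-random set.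
\<close>

lemma sum_subset_weight_thinned:
  assumes F: "finite F"
  shows "(\<Sum>A\<in>Pow F. subset_weight p F A * (\<Sum>T\<in>Pow A. subset_weight r A T * \<phi> T))
       = (\<Sum>T\<in>Pow F. subset_weight (p * r) F T * \<phi> T)"
proof -
  have "(\<Sum>A\<in>Pow F. subset_weight p F A * (\<Sum>T\<in>Pow A. subset_weight r A T * \<phi> T))
      = (\<Sum>A\<in>Pow F. \<Sum>T\<in>Pow F. if T \<subseteq> A then subset_weight p F A * subset_weight r A T * \<phi> T else 0)"
  proof (intro sum.cong refl)
    fix A assume A: "A \<in> Pow F"
    have "(\<Sum>T\<in>Pow A. subset_weight p F A * subset_weight r A T * \<phi> T)
       = (\<Sum>T\<in>Pow F \<inter> Pow A. subset_weight p F A * subset_weight r A T * \<phi> T)"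
      using A by (intro sum.cong) auto
    also have "\<dots> = (\<Sum>T\<in>Pow F. if T \<in> Pow A then subset_weight p F A * subset_weight r A T * \<phi> T else 0)"
      using F by (intro sum.inter_restrict) auto
    finally show "subset_weight p F A * (\<Sum>T\<in>Pow A. subset_weight r A T * \<phi> T)
       = (\<Sum>T\<in>Pow F. if T \<subseteq> A then subset_weight p F A * subset_weight r A T * \<phi> T else 0)"
      by (simp add: sum_distrib_left mult.assoc)
  qed
  also have "\<dots> = (\<Sum>T\<in>Pow F. \<Sum>A\<in>Pow F. if T \<subseteq> A then subset_weight p F A * subset_weight r A T * \<phi> T else 0)"
    by (rule sum.swap)
  also have "\<dots> = (\<Sum>T\<in>Pow F. subset_weight (p * r) F T * \<phi> T)"
  proof (intro sum.cong refl)
    fix T assume T: "T \<in> Pow F"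
    have fT: "finite T" "finite (F - T)" using T F finite_subset by auto
    have "(\<Sum>A\<in>Pow F. if T \<subseteq> A then subset_weight p F A * subset_weight r A T * \<phi> T else 0)
        = (\<Sum>A\<in>{A\<in>Pow F. T \<subseteq> A}. subset_weight p F A * subset_weight r A T * \<phi> T)"
      using F by (subst sum.inter_filter) auto
    also have "\<dots> = (\<Sum>U\<in>Pow (F - T). subset_weight p F (T \<union> U) * subset_weight r (T \<union> U) T * \<phi> T)"
      using T by (intro sum.reindex_bij_witness[of _ "\<lambda>U. T \<union> U" "\<lambda>A. A - T"]) (auto simp: Un_absorb1)
    also have "\<dots> = (\<Sum>U\<in>Pow (F - T). (p * r) ^ card T * \<phi> T *
        ((\<Prod>a\<in>U. p * (1 - r)) * (\<Prod>a\<in>F - T - U. 1 - p)))"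
    proof (intro sum.cong refl)
      fix U assume U: "U \<in> Pow (F - T)"
      have fU: "finite U" using U fT finite_subset by auto
      have "card (T \<union> U) = card T + card U" using fT fU U by (intro card_Un_disjoint) auto
      moreover have "F - (T \<union> U) = F - T - U" "T \<union> U - T = U" using U by auto
      ultimately show "subset_weight p F (T \<union> U) * subset_weight r (T \<union> U) T * \<phi> T =
        (p * r) ^ card T * \<phi> T * ((\<Prod>a\<in>U. p * (1 - r)) * (\<Prod>a\<in>F - T - U. 1 - p))"
        by (simp add: subset_weight_def power_add power_mult_distrib)
    qed
    also have "\<dots> = (p * r) ^ card T * \<phi> T * (\<Prod>a\<in>F - T. p * (1 - r) + (1 - p))"
      by (simp only: prod_add[OF fT(2)] sum_distrib_left)
    also have "\<dots> = subset_weight (p * r) F T * \<phi> T"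
      by (simp add: subset_weight_def algebra_simps)
    finally show "(\<Sum>A\<in>Pow F. if T \<subseteq> A then subset_weight p F A * subset_weight r A T * \<phi> T else 0)
      = subset_weight (p * r) F T * \<phi> T" .
  qed
  finally show ?thesis .
qed

text \<open>
  If all subsets of \<open>A\<close> have property \<open>Q\<close>, then so does the thinned subset. This reduces the density of a random set to
  a value at which its size is under control.
\<close>

lemma subset_prob_thinned:
  assumes F: "finite F" and p: "0 \<le> p" "p \<le> 1" and r: "0 \<le> r" "r \<le> 1"
  shows "subset_prob p F (\<lambda>A. \<forall>T\<subseteq>A. Q T) \<le> subset_prob (p * r) F Q"
proof -
  let ?h = "\<lambda>A. \<Sum>T\<in>Pow A. subset_weight r A T * of_bool (Q T)"
  have "subset_prob p F (\<lambda>A. \<forall>T\<subseteq>A. Q T) \<le> (\<Sum>A\<in>Pow F. subset_weight p F A * ?h A)"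
  proof (rule subset_prob_le_expectation[OF F p])
    fix A assume "A \<subseteq> F" "\<forall>T\<subseteq>A. Q T"
    then have "?h A = (\<Sum>T\<in>Pow A. subset_weight r A T)" by (intro sum.cong) auto
    also have "\<dots> = 1" using \<open>A \<subseteq> F\<close> F finite_subset by (intro sum_subset_weight) auto
    finally show "1 \<le> ?h A" by simp
  qed (auto intro!: sum_nonneg subset_weight_nonneg r)
  also have "\<dots> = (\<Sum>T\<in>Pow F. subset_weight (p * r) F T * of_bool (Q T))"
    by (rule sum_subset_weight_thinned[OF F])
  also have "\<dots> = (\<Sum>T\<in>Pow F. if Q T then subset_weight (p * r) F T else 0)"
    by (intro sum.cong) auto
  also have "\<dots> = subset_prob (p * r) F Q"
    unfolding subset_prob_def using F by (subst sum.inter_filter[symmetric]) auto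
  finally show ?thesis .
qed

text \<open>
  Markov's inequality for \<open>2 ^ card T\<close>, whose expectation is at most \<open>exp (p * card F)\<close>.
\<close>

lemma subset_prob_card_gt:
  assumes p: "0 \<le> p" "p \<le> 1" and F: "finite F" and c: "c \<ge> p * real (card F)"
  shows "subset_prob p F (\<lambda>T. real (card T) > 3 * c) \<le> exp (- c)"
proof -
  have e: "exp (2::real) \<le> 2 ^ 3"
  proof -
    have "exp (2::real) = exp 1 * exp 1" by (simp add: exp_add[symmetric])
    also have "\<dots> \<le> 2.75 * 2.75" using e_less_272 by (intro mult_mono) auto
    finally show ?thesis by simp
  qed
  have c0: "0 \<le> c" using c p by (meson mult_nonneg_nonneg of_nat_0_le_iff order_trans)
  have "subset_prob p F (\<lambda>T. real (card T) > 3 * c) \<le> (\<Sum>T\<in>Pow F. subset_weight p F T * (exp (- (2 * c)) * (\<Prod>a\<in>T. 2)))"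
  proof (rule subset_prob_le_expectation[OF F p])
    fix T assume "real (card T) > 3 * c"
    have "exp (2 * c) = exp 2 powr c" by (simp add: powr_def)
    also have "\<dots> \<le> (2 ^ 3) powr c" using e c0 by (intro powr_mono2) auto
    also have "\<dots> = 2 powr (3 * c)" by (simp add: powr_powr[symmetric] powr_numeral)
    also have "\<dots> \<le> 2 powr (real (card T))" using \<open>real (card T) > 3 * c\<close> by (intro powr_mono) auto
    also have "\<dots> = 2 ^ card T" by (simp add: powr_realpow)
    finally have "exp (2 * c) \<le> 2 ^ card T" .
    then show "1 \<le> exp (- (2 * c)) * (\<Prod>a\<in>T. 2)"
      by (simp add: exp_minus field_simps)
  qed auto
  also have "\<dots> = exp (- (2 * c)) * (\<Sum>T\<in>Pow F. subset_weight p F T * (\<Prod>a\<in>T. 2))"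
    by (simp add: sum_distrib_left mult_ac)
  also have "\<dots> = exp (- (2 * c)) * (1 + p) ^ card F"
    by (subst sum_subset_weight_prod[OF F]) (simp add: algebra_simps)
  also have "\<dots> \<le> exp (- (2 * c)) * exp c"
  proof (intro mult_left_mono)
    have "(1 + p) ^ card F \<le> exp p ^ card F" using p by (intro power_mono) auto
    also have "\<dots> = exp (p * card F)" by (simp add: exp_of_nat_mult[symmetric] mult.commute)
    also have "\<dots> \<le> exp c" using c by simp
    finally show "(1 + p) ^ card F \<le> exp c" .
  qed auto
  also have "\<dots> = exp (- c)" by (simp add: exp_add[symmetric])
  finally show ?thesis .
qed

text \<open>
  The event whose measure defines \<open>prob_random_subset\<close>; it has a name of its own because its measurability is needed, too.
\<close>

definition subset_event :: "'a set \<Rightarrow> real \<Rightarrow> ('a set \<Rightarrow> bool) \<Rightarrow> ('a \<Rightarrow> bool) set" where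
  "subset_event X p P = {\<omega> \<in> space (bernoulli_product X p). P {x \<in> X. \<omega> x}}"

lemma prob_random_subset_eq: "prob_random_subset X p P = measure (bernoulli_product X p) (subset_event X p P)"
  by (simp add: prob_random_subset_def subset_event_def)

lemma prob_space_bernoulli_product: "prob_space (bernoulli_product X p)"
  unfolding bernoulli_product_def by (intro prob_space_PiM prob_space_measure_pmf)

text \<open>
  Fixing the intersection with a finite set \<open>F\<close> describes a cylinder of the product measure.
\<close>

lemma subset_event_exact:
  assumes p: "0 \<le> p" "p \<le> 1" and F: "finite F" "F \<subseteq> X" and T: "T \<subseteq> F"
  shows "subset_event X p (\<lambda>A. A \<inter> F = T) \<in> sets (bernoulli_product X p)"
    and "prob_random_subset X p (\<lambda>A. A \<inter> F = T) = subset_weight p F T"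
proof -
  let ?M = "\<lambda>x::'a. measure_pmf (bernoulli_pmf p)"
  interpret product_prob_space ?M X ..
  let ?B = "\<lambda>x. {x \<in> T}"
  have eq: "subset_event X p (\<lambda>A. A \<inter> F = T) = prod_emb X ?M F (Pi\<^sub>E F ?B)"
    using F T
    by (auto simp: subset_event_def bernoulli_product_def prod_emb_def space_PiM PiE_def Pi_def extensional_def)
  show "subset_event X p (\<lambda>A. A \<inter> F = T) \<in> sets (bernoulli_product X p)"
    unfolding eq bernoulli_product_def using F by (intro sets_PiM_I) auto
  have fT: "finite T" using F T finite_subset by auto
  have "prob_random_subset X p (\<lambda>A. A \<inter> F = T) = measure (Pi\<^sub>M X ?M) (prod_emb X ?M F (Pi\<^sub>E F ?B))"
    unfolding prob_random_subset_eq eq by (simp add: bernoulli_product_def)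
  also have "\<dots> = (\<Prod>x\<in>F. measure (?M x) (?B x))"
    using F by (intro measure_PiM_emb) auto
  also have "\<dots> = (\<Prod>x\<in>F. if x \<in> T then p else 1 - p)"
    using p by (intro prod.cong) (auto simp: measure_pmf_single)
  also have "\<dots> = subset_weight p F T"
    using F T fT by (simp add: prod.If_cases subset_weight_def Int_absorb1 Diff_eq)
  finally show "prob_random_subset X p (\<lambda>A. A \<inter> F = T) = subset_weight p F T" .
qed

lemma
  assumes p: "0 \<le> p" "p \<le> 1" and F: "finite F" "F \<subseteq> X"
  shows subset_event_finite: "subset_event X p (\<lambda>A. P (A \<inter> F)) \<in> sets (bernoulli_product X p)"
    and prob_random_subset_finite: "prob_random_subset X p (\<lambda>A. P (A \<inter> F)) = subset_prob p F P"
proof -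
  interpret prob_space "bernoulli_product X p" by (rule prob_space_bernoulli_product)
  let ?I = "{T. T \<subseteq> F \<and> P T}"
  define E where "E T = subset_event X p (\<lambda>A. A \<inter> F = T)" for T
  have fI: "finite ?I" using F by simp
  have E: "E T \<in> sets (bernoulli_product X p)" "prob (E T) = subset_weight p F T" if "T \<in> ?I" for T
    using subset_event_exact[OF p F, of T] that by (simp_all add: E_def prob_random_subset_eq)
  have eq: "subset_event X p (\<lambda>A. P (A \<inter> F)) = (\<Union>T\<in>?I. E T)"
    by (auto simp: subset_event_def E_def)
  have disj: "disjoint_family_on E ?I"
    by (auto simp: disjoint_family_on_def E_def subset_event_def)
  show "subset_event X p (\<lambda>A. P (A \<inter> F)) \<in> sets (bernoulli_product X p)"
    unfolding eq using fI E(1) by (rule sets.finite_UN)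
  have "prob (subset_event X p (\<lambda>A. P (A \<inter> F))) = (\<Sum>T\<in>?I. prob (E T))"
    unfolding eq using fI E(1) disj by (intro finite_measure_finite_Union) blast+
  also have "\<dots> = subset_prob p F P"
    unfolding subset_prob_def using E(2) by (intro sum.cong refl)
  finally show "prob_random_subset X p (\<lambda>A. P (A \<inter> F)) = subset_prob p F P"
    unfolding prob_random_subset_eq .
qed

lemma subset_prob_restrict:
  assumes F: "finite F" and p: "0 \<le> p" "p \<le> 1" and D: "D \<subseteq> F"
  shows "subset_prob p F (\<lambda>A. P (A \<inter> D)) = subset_prob p D P"
proof -
  have fD: "finite D" using D F by (rule finite_subset)
  have "A \<inter> F \<inter> D = A \<inter> D" for A using D by blast
  then have "subset_prob p F (\<lambda>A. P (A \<inter> D)) = prob_random_subset F p (\<lambda>A. P (A \<inter> D))"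
    using prob_random_subset_finite[OF p F order_refl, of "\<lambda>A. P (A \<inter> D)"] by simp
  also have "\<dots> = subset_prob p D P" by (rule prob_random_subset_finite[OF p fD D])
  finally show ?thesis .
qed

section \<open>Generated semigroups and boxes of vectors\<close>

lemma semigroup_gen_zero: "0 \<in> semigroup_gen A"
  unfolding semigroup_gen_def by (intro CollectI exI[of _ "[]"]) auto

lemma semigroup_gen_incl: "a \<in> A \<Longrightarrow> a \<in> semigroup_gen A"
  unfolding semigroup_gen_def by (intro CollectI exI[of _ "[a]"]) auto

lemma semigroup_gen_add:
  assumes "x \<in> semigroup_gen A" "y \<in> semigroup_gen A"
  shows "x + y \<in> semigroup_gen A"
proof -
  obtain as bs where "x = sum_list as" "set as \<subseteq> A" "y = sum_list bs" "set bs \<subseteq> A"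
    using assms by (auto simp: semigroup_gen_def)
  then show ?thesis unfolding semigroup_gen_def by (intro CollectI exI[of _ "as @ bs"]) auto
qed

lemma semigroup_gen_combination:
  fixes v :: "nat \<Rightarrow> nat \<Rightarrow> nat"
  assumes "finite J" "\<And>i. i \<in> J \<Longrightarrow> v i \<in> A" "s \<in> semigroup_gen A"
  shows "(\<lambda>j. s j + (\<Sum>i\<in>J. c i * v i j)) \<in> semigroup_gen A"
  using assms(1,2)
proof (induction J rule: finite_induct)
  case empty
  then show ?case using assms(3) by simp
next
  case (insert k J)
  have mult: "(\<lambda>j. n * v k j) \<in> semigroup_gen A" for n
  proof (induction n)
    case 0
    then show ?case using semigroup_gen_zero[of A] by (simp add: func_zero)
  next
    case (Suc n)
    have "v k + (\<lambda>j. n * v k j) \<in> semigroup_gen A"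
      using Suc semigroup_gen_incl[OF insert.prems] by (intro semigroup_gen_add) auto
    then show ?case by (simp add: plus_fun_def)
  qed
  have "(\<lambda>j. s j + (\<Sum>i\<in>J. c i * v i j)) + (\<lambda>j. c k * v k j) \<in> semigroup_gen A"
    using insert mult by (intro semigroup_gen_add) auto
  then show ?case using insert by (simp add: plus_fun_def algebra_simps)
qed

lemma semigroup_gen_apply:
  fixes A :: "(nat \<Rightarrow> nat) set"
  shows "x \<in> semigroup_gen A \<longleftrightarrow> (\<exists>as. set as \<subseteq> A \<and> (\<forall>i. x i = sum_list (map (\<lambda>a. a i) as)))"
proof -
  have "sum_list as i = sum_list (map (\<lambda>a. a i) as)" for as :: "(nat \<Rightarrow> nat) list" and i
    by (induction as) auto
  then show ?thesis by (auto simp: semigroup_gen_def fun_eq_iff)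
qed

text \<open>
  All coordinates are nonnegative, so only elements of \<open>A\<close> below \<open>x\<close> can occur in a representation of \<open>x\<close>. This is
  why membership of \<open>x\<close> depends on finitely many elements of \<open>A\<close>.
\<close>

lemma semigroup_gen_local:
  fixes A :: "(nat \<Rightarrow> nat) set"
  assumes "\<And>a. (\<And>i. a i \<le> x i) \<Longrightarrow> a \<in> A \<Longrightarrow> a \<in> F"
  shows "x \<in> semigroup_gen A \<longleftrightarrow> x \<in> semigroup_gen (A \<inter> F)"
proof
  assume "x \<in> semigroup_gen A"
  then obtain as where as: "set as \<subseteq> A" "\<And>i. x i = sum_list (map (\<lambda>a. a i) as)"
    by (auto simp: semigroup_gen_apply)
  have "a \<in> F" if "a \<in> set as" for a
    using that as assms[of a] by (force intro: member_le_sum_list)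
  then show "x \<in> semigroup_gen (A \<inter> F)" using as by (auto simp: semigroup_gen_apply)
qed (auto simp: semigroup_gen_def)

lemma finite_nat_interval: "finite {n::nat. lo \<le> real n \<and> real n \<le> hi}"
  by (rule finite_subset[of _ "{..nat \<lfloor>hi\<rfloor>}"]) (auto simp: le_nat_floor)

lemma card_nat_interval:
  fixes lo hi :: real
  assumes "0 \<le> lo"
  shows "hi - lo - 1 \<le> real (card {n::nat. lo \<le> real n \<and> real n \<le> hi})"
proof -
  show "hi - lo - 1 \<le> real (card {n::nat. lo \<le> real n \<and> real n \<le> hi})"
  proof (cases "lo \<le> hi")
    case True
    have "{nat \<lceil>lo\<rceil>..nat \<lfloor>hi\<rfloor>} \<subseteq> {n::nat. lo \<le> real n \<and> real n \<le> hi}"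
      using True assms by (auto simp: nat_le_iff le_nat_iff) linarith+
    then have "card {nat \<lceil>lo\<rceil>..nat \<lfloor>hi\<rfloor>} \<le> card {n::nat. lo \<le> real n \<and> real n \<le> hi}"
      using finite_nat_interval by (rule card_mono[rotated])
    moreover have "hi - lo - 1 \<le> real (Suc (nat \<lfloor>hi\<rfloor>) - nat \<lceil>lo\<rceil>)"
      using True assms by linarith
    ultimately show ?thesis by simp
  qed auto
qed

text \<open>
  The coordinates in \<open>J\<close> range over intervals and the others are prescribed by \<open>u\<close>. Prescribed coordinates are zero for boxes in a
  coordinate subspace, and those of a given vector when its small coordinates are to be matched exactly.
\<close>

definition vec_box :: "nat set \<Rightarrow> (nat \<Rightarrow> real) \<Rightarrow> (nat \<Rightarrow> real) \<Rightarrow> (nat \<Rightarrow> nat) \<Rightarrow> (nat \<Rightarrow> nat) set" where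
  "vec_box J lo hi u = {a. \<forall>j. if j \<in> J then lo j \<le> real (a j) \<and> real (a j) \<le> hi j else a j = u j}"

abbreviation corner_box :: "nat set \<Rightarrow> (nat \<Rightarrow> real) \<Rightarrow> (nat \<Rightarrow> nat) set" where
  "corner_box J hi \<equiv> vec_box J (\<lambda>_. 0) hi (\<lambda>_. 0)"

lemma vec_box_eq_image:
  "vec_box J lo hi u = (\<lambda>g j. if j \<in> J then g j else u j) ` (\<Pi>\<^sub>E j\<in>J. {n::nat. lo j \<le> real n \<and> real n \<le> hi j})"
  (is "_ = ?h ` ?P")
proof (intro equalityI subsetI)
  fix a assume a: "a \<in> vec_box J lo hi u"
  have "a = ?h (restrict a J)"
    by (rule ext) (use a in \<open>auto simp: vec_box_def split: if_splits\<close>)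
  moreover have "restrict a J \<in> ?P" using a by (auto simp: vec_box_def split: if_splits)
  ultimately show "a \<in> ?h ` ?P" by blast
qed (auto simp: vec_box_def PiE_iff)

lemma card_vec_box:
  "finite J \<Longrightarrow> card (vec_box J lo hi u) = (\<Prod>j\<in>J. card {n::nat. lo j \<le> real n \<and> real n \<le> hi j})"
proof -
  assume J: "finite J"
  have "inj_on (\<lambda>g j. if j \<in> J then g j else u j) (\<Pi>\<^sub>E j\<in>J. {n::nat. lo j \<le> real n \<and> real n \<le> hi j})"
    by (intro inj_onI PiE_ext) (auto simp: fun_eq_iff split: if_splits)
  then show ?thesis unfolding vec_box_eq_image using J by (simp add: card_image card_PiE)
qed

lemma finite_vec_box:
  assumes "finite J" shows "finite (vec_box J lo hi u)"
  unfolding vec_box_eq_image using assms finite_nat_interval by (intro finite_imageI finite_PiE)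

lemma card_vec_box_ge:
  assumes "finite J" "\<And>j. j \<in> J \<Longrightarrow> 0 \<le> lo j" "\<And>j. j \<in> J \<Longrightarrow> 0 \<le> m j" "\<And>j. j \<in> J \<Longrightarrow> m j + 1 \<le> hi j - lo j"
  shows "(\<Prod>j\<in>J. m j) \<le> real (card (vec_box J lo hi u))"
  unfolding card_vec_box[OF assms(1)] of_nat_prod
proof (intro prod_mono conjI)
  fix j assume j: "j \<in> J"
  show "m j \<le> real (card {n::nat. lo j \<le> real n \<and> real n \<le> hi j})"
    using card_nat_interval[of "lo j" "hi j"] assms(2,4)[OF j] by linarith
qed (use assms in auto)

lemma card_vec_box_le:
  assumes "finite J" "0 \<le> N"
  shows "real (card (vec_box J (\<lambda>_. 0) (\<lambda>_. N) u)) \<le> (N + 1) ^ card J"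
proof -
  have "real (card {n::nat. 0 \<le> real n \<and> real n \<le> N}) \<le> N + 1"
  proof -
    have "card {n::nat. 0 \<le> real n \<and> real n \<le> N} \<le> card {..nat \<lfloor>N\<rfloor>}"
      by (intro card_mono) (auto simp: le_nat_floor)
    then have "real (card {n::nat. 0 \<le> real n \<and> real n \<le> N}) \<le> real (nat \<lfloor>N\<rfloor>) + 1" by simp
    then show ?thesis using assms by linarith
  qed
  then show ?thesis
    unfolding card_vec_box[OF assms(1)] of_nat_prod by (simp add: power_mono)
qed

lemma nat_vecs_index: "a \<in> nat_vecs d \<Longrightarrow> a i \<noteq> 0 \<Longrightarrow> i < d"
  unfolding nat_vecs_def by (metis (mono_tags, lifting) mem_Collect_eq not_less)

lemma vec_box_subset_nat_vecs: "vec_box {..<d} lo hi (\<lambda>_. 0) \<subseteq> nat_vecs d"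
proof
  fix a assume a: "a \<in> vec_box {..<d} lo hi (\<lambda>_. 0)"
  have "a i = 0" if "d \<le> i" for i
    using a that by (auto simp: vec_box_def dest!: spec[of _ i])
  then show "a \<in> nat_vecs d" by (simp add: nat_vecs_def)
qed

section \<open>Subset sums in a finite quasigroup\<close>

text \<open>
  In the application, \<open>H\<close> is the fundamental cell of a lattice and \<open>f\<close> is addition of vectors followed by reduction into
  the cell. The counting rests on the injectivity of translations.
\<close>

locale comm_quasigroup =
  fixes H :: "'a set" and f :: "'a \<Rightarrow> 'a \<Rightarrow> 'a" and z :: 'a
  assumes finite_H: "finite H" and z_in: "z \<in> H"
    and closed: "\<And>x y. x \<in> H \<Longrightarrow> y \<in> H \<Longrightarrow> f x y \<in> H"
    and commute: "\<And>x y. x \<in> H \<Longrightarrow> y \<in> H \<Longrightarrow> f x y = f y x"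
    and cancel: "\<And>x y y'. x \<in> H \<Longrightarrow> y \<in> H \<Longrightarrow> y' \<in> H \<Longrightarrow> f x y = f x y' \<Longrightarrow> y = y'"
begin

primrec subset_sums :: "'a list \<Rightarrow> 'a set" where
  "subset_sums [] = {z}"
| "subset_sums (a # l) = subset_sums l \<union> (\<lambda>x. f x a) ` subset_sums l"

definition small :: "'a list \<Rightarrow> bool" where
  "small l \<longleftrightarrow> 2 * card (subset_sums l) \<le> card H"

lemma subset_sums_subset: "set l \<subseteq> H \<Longrightarrow> subset_sums l \<subseteq> H"
  by (induction l) (auto simp: z_in closed)

lemma finite_subset_sums [simp]: "finite (subset_sums l)"
  by (induction l) auto

lemma subset_sums_pos: "0 < card (subset_sums l)"
proof -
  have "subset_sums l \<noteq> {}" by (induction l) auto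
  then show ?thesis by (simp add: card_gt_0_iff)
qed

lemma card_H_pos: "0 < card H"
  using finite_H z_in card_gt_0_iff by blast

lemma bij_f: assumes "x \<in> H" shows "bij_betw (f x) H H"
proof -
  have inj: "inj_on (f x) H" using cancel assms by (auto simp: inj_on_def)
  moreover have "f x ` H \<subseteq> H" using closed assms by auto
  ultimately show ?thesis
    using finite_H by (simp add: bij_betw_def endo_inj_surj)
qed

text \<open>
  Double counting: each pair of elements of \<open>X\<close> differs by exactly one \<open>a\<close>.
\<close>

lemma sum_overlap:
  assumes "X \<subseteq> H"
  shows "(\<Sum>a\<in>H. card (X \<inter> (\<lambda>x. f x a) ` X)) = card X * card X"
proof -
  have fX: "finite X" using assms finite_H finite_subset by auto
  have inj: "inj_on (\<lambda>x. f x a) X" if "a \<in> H" for a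
    using that assms cancel[of a] commute by (auto simp: inj_on_def) (metis subsetD)
  have "(\<Sum>a\<in>H. card (X \<inter> (\<lambda>x. f x a) ` X)) = (\<Sum>a\<in>H. card {x\<in>X. f x a \<in> X})"
  proof (intro sum.cong refl)
    fix a assume a: "a \<in> H"
    have "X \<inter> (\<lambda>x. f x a) ` X = (\<lambda>x. f x a) ` {x\<in>X. f x a \<in> X}" by auto
    moreover have "inj_on (\<lambda>x. f x a) {x\<in>X. f x a \<in> X}" using inj[OF a] by (rule inj_on_subset) auto
    ultimately show "card (X \<inter> (\<lambda>x. f x a) ` X) = card {x\<in>X. f x a \<in> X}"
      by (simp add: card_image)
  qed
  also have "\<dots> = (\<Sum>a\<in>H. \<Sum>x\<in>X. of_bool (f x a \<in> X))"
    using fX by (intro sum.cong refl) (simp add: sum.If_cases of_bool_def Int_def)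
  also have "\<dots> = (\<Sum>x\<in>X. \<Sum>a\<in>H. of_bool (f x a \<in> X))" by (rule sum.swap)
  also have "\<dots> = (\<Sum>x\<in>X. card X)"
  proof (intro sum.cong refl)
    fix x assume x: "x \<in> X"
    have "(\<Sum>a\<in>H. of_bool (f x a \<in> X)) = (\<Sum>b\<in>H. of_bool (b \<in> X) :: nat)"
      using bij_f[of x] x assms by (intro sum.reindex_bij_betw[where h = "f x"]) auto
    also have "\<dots> = card (H \<inter> X)"
      using finite_H by (simp add: sum.If_cases of_bool_def Int_def)
    finally show "(\<Sum>a\<in>H. of_bool (f x a \<in> X)) = card X" using assms by (simp add: Int_absorb1)
  qed
  finally show ?thesis by simp
qed

text \<open>
  If \<open>X\<close> fills at most half of \<open>H\<close>, a random translate of \<open>X\<close> meets \<open>X\<close> in \<open>card X\<close> squared over \<open>card H\<close> points on average, at most half of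
  \<open>card X\<close>, so adjoining one random element multiplies the reciprocal of the number of subset sums by at most \<open>3 / 4\<close> on average.
  A reciprocal that decreases geometrically on average makes few subset sums exponentially unlikely.
\<close>

lemma sum_inverse_card_extend:
  assumes X: "X \<subseteq> H" "2 * card X \<le> card H" "0 < card X"
  shows "(\<Sum>a\<in>H. 1 / real (card (X \<union> (\<lambda>x. f x a) ` X))) \<le> 3 / 4 * real (card H) * (1 / real (card X))"
proof -
  have fX: "finite X" using X finite_H finite_subset by auto
  have inj: "inj_on (\<lambda>x. f x a) X" if "a \<in> H" for a
    using that X cancel[of a] commute by (auto simp: inj_on_def) (metis subsetD)
  let ?t = "\<lambda>a. real (card (X \<inter> (\<lambda>x. f x a) ` X))"
  let ?X = "real (card X)"
  have "(\<Sum>a\<in>H. 1 / real (card (X \<union> (\<lambda>x. f x a) ` X))) \<le> (\<Sum>a\<in>H. (1 + ?t a / ?X) / (2 * ?X))"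
  proof (intro sum_mono)
    fix a assume a: "a \<in> H"
    have "card X + card ((\<lambda>x. f x a) ` X) = card (X \<union> (\<lambda>x. f x a) ` X) + card (X \<inter> (\<lambda>x. f x a) ` X)"
      using fX by (intro card_Un_Int) auto
    then have c: "real (card (X \<union> (\<lambda>x. f x a) ` X)) = 2 * ?X - ?t a"
      using card_image[OF inj[OF a]] by linarith
    have t: "0 \<le> ?t a" "?t a \<le> ?X" using fX by (auto intro: card_mono)
    have "2 * ?X * ?X \<le> (2 * ?X - ?t a) * (?X + ?t a)"
      using mult_nonneg_nonneg[of "?t a" "?X - ?t a"] t by (simp add: algebra_simps)
    then show "1 / real (card (X \<union> (\<lambda>x. f x a) ` X)) \<le> (1 + ?t a / ?X) / (2 * ?X)"
      unfolding c using X(3) t by (simp add: divide_simps) (simp add: algebra_simps)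
  qed
  also have "\<dots> = (real (card H) + (\<Sum>a\<in>H. ?t a) / ?X) / (2 * ?X)"
    by (simp add: sum_divide_distrib[symmetric] sum.distrib)
  also have "(\<Sum>a\<in>H. ?t a) = ?X * ?X"
    using sum_overlap[OF X(1)] by (metis of_nat_mult of_nat_sum)
  also have "(real (card H) + ?X * ?X / ?X) / (2 * ?X) \<le> (real (card H) + real (card H) / 2) / (2 * ?X)"
    using X by (intro divide_right_mono add_left_mono) auto
  also have "\<dots> = 3 / 4 * real (card H) * (1 / ?X)" by (simp add: field_simps)
  finally show ?thesis .
qed

definition small_lists :: "nat \<Rightarrow> 'a list set" where
  "small_lists m = {l. set l \<subseteq> H \<and> length l = m \<and> small l}"

lemma finite_small_lists [simp]: "finite (small_lists m)"
  unfolding small_lists_def by (rule finite_subset[OF _ finite_lists_length_eq[OF finite_H, of m]]) auto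

text \<open>
  The subset sums of a tail are among those of the whole list, so a list with few subset sums arises from a shorter
  such list, and the bound for one adjoined element can be iterated.
\<close>

lemma sum_inverse_small_lists:
  "(\<Sum>l\<in>small_lists m. 1 / real (card (subset_sums l))) \<le> (3 / 4 * real (card H)) ^ m"
proof (induction m)
  case 0
  have "small_lists 0 \<subseteq> {[]}" by (auto simp: small_lists_def)
  then have "(\<Sum>l\<in>small_lists 0. 1 / real (card (subset_sums l))) \<le> (\<Sum>l\<in>{[]}. 1 / real (card (subset_sums l)))"
    by (intro sum_mono2) auto
  then show ?case by simp
next
  case (Suc m)
  have sub: "small_lists (Suc m) \<subseteq> (\<lambda>(a, l). a # l) ` (H \<times> small_lists m)"
  proof
    fix l' assume l': "l' \<in> small_lists (Suc m)"
    then obtain a l where l: "l' = a # l" by (cases l') (auto simp: small_lists_def)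
    have "card (subset_sums l) \<le> card (subset_sums l')" unfolding l by (intro card_mono) auto
    then have "(a, l) \<in> H \<times> small_lists m" using l' l by (auto simp: small_lists_def small_def)
    then show "l' \<in> (\<lambda>(a, l). a # l) ` (H \<times> small_lists m)" unfolding l by force
  qed
  have "(\<Sum>l\<in>small_lists (Suc m). 1 / real (card (subset_sums l)))
      \<le> (\<Sum>l\<in>(\<lambda>(a, l). a # l) ` (H \<times> small_lists m). 1 / real (card (subset_sums l)))"
    using sub finite_H by (intro sum_mono2) auto
  also have "\<dots> = (\<Sum>(a, l)\<in>H \<times> small_lists m. 1 / real (card (subset_sums (a # l))))"
    by (subst sum.reindex) (auto simp: inj_on_def case_prod_unfold)
  also have "\<dots> = (\<Sum>l\<in>small_lists m. \<Sum>a\<in>H. 1 / real (card (subset_sums (a # l))))"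
    by (subst sum.swap) (simp add: sum.cartesian_product)
  also have "\<dots> \<le> (\<Sum>l\<in>small_lists m. 3 / 4 * real (card H) * (1 / real (card (subset_sums l))))"
  proof (intro sum_mono)
    fix l assume l: "l \<in> small_lists m"
    then show "(\<Sum>a\<in>H. 1 / real (card (subset_sums (a # l)))) \<le> 3 / 4 * real (card H) * (1 / real (card (subset_sums l)))"
      using sum_inverse_card_extend[of "subset_sums l"] subset_sums_subset[of l] subset_sums_pos[of l]
      by (auto simp: small_lists_def small_def)
  qed
  also have "\<dots> \<le> 3 / 4 * real (card H) * (3 / 4 * real (card H)) ^ m"
    unfolding sum_distrib_left[symmetric] using Suc by (intro mult_left_mono) auto
  finally show ?case by simp
qed

lemma card_small_lists: "real (card (small_lists m)) \<le> real (card H) * (3 / 4 * real (card H)) ^ m"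
proof -
  have "real (card (small_lists m)) = (\<Sum>l\<in>small_lists m. 1)" by simp
  also have "\<dots> \<le> (\<Sum>l\<in>small_lists m. real (card H) * (1 / real (card (subset_sums l))))"
  proof (intro sum_mono)
    fix l assume "l \<in> small_lists m"
    then have "card (subset_sums l) \<le> card H"
      using subset_sums_subset finite_H by (auto simp: small_lists_def intro: card_mono)
    then show "1 \<le> real (card H) * (1 / real (card (subset_sums l)))" using subset_sums_pos[of l] by simp
  qed
  also have "\<dots> = real (card H) * (\<Sum>l\<in>small_lists m. 1 / real (card (subset_sums l)))"
    by (simp add: sum_distrib_left)
  also have "\<dots> \<le> real (card H) * (3 / 4 * real (card H)) ^ m"
    using sum_inverse_small_lists by (intro mult_left_mono) auto
  finally show ?thesis .
qed

text \<open>
  The subset sums depend on the order of the list; a set is poor if every enumeration has few of them.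
\<close>

definition poor :: "'a set \<Rightarrow> bool" where
  "poor T \<longleftrightarrow> (\<forall>l. set l = T \<and> distinct l \<longrightarrow> small l)"

text \<open>
  Each poor set of size \<open>m\<close> accounts for \<open>fact m\<close> lists, all of them small.
\<close>

lemma card_poor_sets:
  "fact m * real (card {T. T \<subseteq> H \<and> card T = m \<and> poor T}) \<le> real (card H) * (3 / 4 * real (card H)) ^ m"
proof -
  let ?P = "{T. T \<subseteq> H \<and> card T = m \<and> poor T}"
  have fP: "finite ?P" using finite_H by auto
  have fT: "finite T" if "T \<in> ?P" for T
    using that finite_subset[OF _ finite_H] by blast
  have perms: "{l. set l = T \<and> distinct l} = permutations_of_set T" for T :: "'a set"
    by (simp add: permutations_of_set_def)
  have "fact m * card ?P = (\<Sum>T\<in>?P. fact (card T))"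
    by simp
  also have "\<dots> = (\<Sum>T\<in>?P. card {l. set l = T \<and> distinct l})"
    unfolding perms using fT by (intro sum.cong refl) (simp only: card_permutations_of_set)
  also have "\<dots> = card (\<Union>T\<in>?P. {l. set l = T \<and> distinct l})"
  proof (rule card_UN_disjoint[symmetric])
    show "\<forall>T\<in>?P. finite {l. set l = T \<and> distinct l}"
      unfolding perms by simp
  qed (use fP in auto)
  also have "\<dots> \<le> card (small_lists m)"
    by (rule card_mono[OF finite_small_lists]) (auto simp: small_lists_def poor_def distinct_card)
  finally have "fact m * card ?P \<le> card (small_lists m)" .
  then have "fact m * real (card ?P) \<le> real (card (small_lists m))"
    by (metis of_nat_fact of_nat_le_iff of_nat_mult)
  also have "\<dots> \<le> real (card H) * (3 / 4 * real (card H)) ^ m" by (rule card_small_lists)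
  finally show ?thesis .
qed

text \<open>
  Weighting the bound for each size \<open>m\<close> by \<open>p ^ m * (1 - p) ^ (n - m)\<close> produces an exponential series with argument
  close to \<open>3 / 4\<close> of \<open>p n\<close>, against the factor \<open>exp (- p n)\<close>.
\<close>

lemma subset_prob_poor:
  assumes p: "0 \<le> p" "p \<le> 1 / 8"
  shows "subset_prob p H poor \<le> real (card H) * exp (- (p * real (card H)) / 7)"
proof -
  let ?n = "card H"
  let ?x = "6 / 7 * (p * real ?n)"
  let ?P = "{T. T \<subseteq> H \<and> poor T}"
  have fP: "finite ?P" using finite_H by auto
  have "subset_prob p H poor = (\<Sum>m\<le>?n. \<Sum>T\<in>{T\<in>?P. card T = m}. subset_weight p H T)"
    unfolding subset_prob_def using fP finite_H
    by (intro sum.group[symmetric]) (auto intro: card_mono)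
  also have "\<dots> \<le> (\<Sum>m\<le>?n. real ?n * exp (- (p * real ?n)) * (?x ^ m / fact m))"
  proof (intro sum_mono)
    fix m assume m: "m \<in> {..?n}"
    let ?Q = "{T. T \<subseteq> H \<and> card T = m \<and> poor T}"
    have eq: "{T\<in>?P. card T = m} = ?Q" by auto
    have w: "subset_weight p H T = p ^ m * (1 - p) ^ (?n - m)" if "T \<in> ?Q" for T
      using that finite_H finite_subset[of T H] by (auto simp: subset_weight_def card_Diff_subset)
    have q: "(1 - p) ^ (?n - m) \<le> exp (- (p * real ?n)) * (8 / 7) ^ m"
    proof -
      have "(1 - p) ^ (?n - m) * (7 / 8) ^ m \<le> (1 - p) ^ (?n - m) * (1 - p) ^ m"
        using p by (intro mult_left_mono power_mono) auto
      also have "\<dots> = (1 - p) ^ ?n" using m by (simp add: power_add[symmetric])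
      also have "\<dots> \<le> exp (- (p * real ?n))" using p by (intro one_minus_power_le_exp) auto
      finally show ?thesis by (simp add: power_divide field_simps)
    qed
    have "(\<Sum>T\<in>{T\<in>?P. card T = m}. subset_weight p H T) = real (card ?Q) * (p ^ m * (1 - p) ^ (?n - m))"
      unfolding eq using w by simp
    also have "\<dots> \<le> (real ?n * (3 / 4 * real ?n) ^ m / fact m) * (p ^ m * (exp (- (p * real ?n)) * (8 / 7) ^ m))"
      using card_poor_sets[of m] q p
      by (intro mult_mono mult_left_mono) (auto simp: field_simps)
    also have "\<dots> = real ?n * exp (- (p * real ?n)) * (?x ^ m / fact m)"
    proof -
      have "?x ^ m = (3 / 4 * real ?n) ^ m * p ^ m * (8 / 7) ^ m"
        unfolding power_mult_distrib[symmetric] by simp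
      then show ?thesis by simp
    qed
    finally show "(\<Sum>T\<in>{T\<in>?P. card T = m}. subset_weight p H T)
      \<le> real ?n * exp (- (p * real ?n)) * (?x ^ m / fact m)" .
  qed
  also have "\<dots> = real ?n * exp (- (p * real ?n)) * (\<Sum>m\<le>?n. ?x ^ m / fact m)"
    by (simp add: sum_distrib_left)
  also have "\<dots> \<le> real ?n * exp (- (p * real ?n)) * exp ?x"
  proof (intro mult_left_mono)
    have "summable (\<lambda>m. ?x ^ m / fact m)" using summable_exp[of ?x] by (simp add: field_simps)
    then have "(\<Sum>m\<in>{..?n}. ?x ^ m / fact m) \<le> (\<Sum>m. ?x ^ m / fact m)"
      using p by (intro sum_le_suminf) auto
    then show "(\<Sum>m\<le>?n. ?x ^ m / fact m) \<le> exp ?x" by (simp add: exp_def field_simps)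
  qed auto
  also have "\<dots> = real ?n * exp (- (p * real ?n) / 7)"
    by (simp add: exp_add[symmetric])
  finally show ?thesis .
qed

text \<open>
  The random set may have far more than \<open>3 * c\<close> elements. Thinning it until its expected size is \<open>c\<close> gives a subset that is at
  the same time rich in sums and short.
\<close>

lemma subset_prob_no_short_cover:
  assumes p: "0 < p" "p \<le> 1 / 8" and c: "0 \<le> c" "c \<le> p * real (card H)"
  shows "subset_prob p H (\<lambda>A. \<not> (\<exists>l. set l \<subseteq> A \<and> real (length l) \<le> 3 * c \<and> card H < 2 * card (subset_sums l)))
     \<le> 2 * real (card H) * exp (- c / 7)"
proof -
  let ?n = "card H"
  let ?Q = "\<lambda>T. poor T \<or> real (card T) > 3 * c"
  \<comment> \<open>the thinning probability that makes the expected size equal to \<open>c\<close>\<close>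
  define r where "r = c / (p * real ?n)"
  have r: "0 \<le> r" "r \<le> 1" using p c card_H_pos by (auto simp: r_def divide_simps)
  have pr: "p * r * real ?n = c" using p card_H_pos by (simp add: r_def)
  have pr01: "0 \<le> p * r" "p * r \<le> 1 / 8" using p r mult_mono[of p "1/8" r 1] by auto
  have p01: "0 \<le> p" "p \<le> 1" using p by auto
  have "subset_prob p H (\<lambda>A. \<not> (\<exists>l. set l \<subseteq> A \<and> real (length l) \<le> 3 * c \<and> ?n < 2 * card (subset_sums l)))
      \<le> subset_prob p H (\<lambda>A. \<forall>T\<subseteq>A. ?Q T)"
  proof (rule subset_prob_mono[OF finite_H p01], intro allI impI, rule ccontr)
    fix A T assume A: "A \<subseteq> H" "\<not> (\<exists>l. set l \<subseteq> A \<and> real (length l) \<le> 3 * c \<and> ?n < 2 * card (subset_sums l))"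
      and T: "T \<subseteq> A" "\<not> ?Q T"
    then obtain l where l: "distinct l" "set l = T" "\<not> small l" by (auto simp: poor_def)
    then have "length l = card T" by (metis distinct_card)
    then have "set l \<subseteq> A \<and> real (length l) \<le> 3 * c \<and> ?n < 2 * card (subset_sums l)"
      using l T by (auto simp: small_def)
    then show False using A(2) by blast
  qed
  also have "\<dots> \<le> subset_prob (p * r) H ?Q"
    using p r by (intro subset_prob_thinned finite_H) auto
  also have "\<dots> \<le> subset_prob (p * r) H poor + subset_prob (p * r) H (\<lambda>T. real (card T) > 3 * c)"
    using pr01 finite_H by (intro subset_prob_disj) auto
  also have "\<dots> \<le> real ?n * exp (- (p * r * real ?n) / 7) + exp (- c)"
    using pr01 pr finite_H by (intro add_mono subset_prob_poor subset_prob_card_gt) auto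
  also have "\<dots> \<le> real ?n * exp (- c / 7) + real ?n * exp (- c / 7)"
  proof (intro add_mono)
    have "exp (- c) \<le> 1 * exp (- c / 7)" using c by simp
    also have "\<dots> \<le> real ?n * exp (- c / 7)" using card_H_pos by (intro mult_right_mono) auto
    finally show "exp (- c) \<le> real ?n * exp (- c / 7)" .
  qed (simp add: pr)
  finally show ?thesis by simp
qed

text \<open>
  Pigeonhole: a set with more than half of the elements meets the set of the complements to \<open>h\<close> of its own elements.
\<close>

lemma subset_sums_plus_subset_sums:
  assumes "set l \<subseteq> H" "card H < 2 * card (subset_sums l)" "h \<in> H"
  obtains x y where "x \<in> subset_sums l" "y \<in> subset_sums l" "f x y = h"
proof -
  let ?X = "subset_sums l"
  define g where "g x = (THE y. y \<in> H \<and> f x y = h)" for x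
  have X: "?X \<subseteq> H" using assms subset_sums_subset by auto
  have g: "g x \<in> H \<and> f x (g x) = h" if "x \<in> H" for x
    unfolding g_def
  proof (rule theI')
    have "h \<in> f x ` H" using bij_f[OF that] assms(3) by (auto simp: bij_betw_def)
    then show "\<exists>!y. y \<in> H \<and> f x y = h" using cancel[OF that] by blast
  qed
  have inj: "inj_on g ?X"
  proof (rule inj_onI)
    fix x y assume "x \<in> ?X" "y \<in> ?X" "g x = g y"
    then show "x = y" using g[of x] g[of y] X cancel[of "g x" x y] commute by (metis subsetD)
  qed
  have "\<not> ?X \<inter> g ` ?X = {}"
  proof
    assume "?X \<inter> g ` ?X = {}"
    then have "card (?X \<union> g ` ?X) = 2 * card ?X" using inj by (simp add: card_Un_disjoint card_image)
    moreover have "card (?X \<union> g ` ?X) \<le> card H" using X g finite_H by (intro card_mono) auto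
    ultimately show False using assms(2) by simp
  qed
  then obtain x where "x \<in> ?X" "g x \<in> ?X" by blast
  then show ?thesis using that[of x "g x"] g X by auto
qed

end

section \<open>The lattice of a nearly diagonal matrix\<close>

lemma geometric_increments_convergent:
  fixes a :: "nat \<Rightarrow> real"
  assumes "\<And>n. \<bar>a (Suc n) - a n\<bar> \<le> B * (1 / 4) ^ n"
  shows "convergent a"
proof -
  have g: "summable (\<lambda>n. B * (1 / 4) ^ n)"
    by (intro summable_mult summable_geometric) simp
  have "summable (\<lambda>n. a (Suc n) - a n)"
    by (rule summable_comparison_test'[OF g, where N = 0]) (use assms in simp)
  then have "convergent (\<lambda>n. \<Sum>i<n. a (Suc i) - a i)"
    unfolding summable_iff_convergent .
  then have "convergent (\<lambda>n. a n - a 0)"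
    unfolding sum_lessThan_telescope .
  then have "convergent (\<lambda>n. (a n - a 0) + a 0)"
    by (intro convergent_add convergent_const)
  then show ?thesis by simp
qed

text \<open>
  The rows \<open>v i\<close> are lattice vectors supported on \<open>J\<close>; after dividing column \<open>j\<close> by \<open>w j\<close> the matrix differs
  from the identity by entries of size at most \<open>\<epsilon>\<close>.
\<close>

locale near_diagonal =
  fixes J :: "nat set" and v :: "nat \<Rightarrow> nat \<Rightarrow> nat" and w :: "nat \<Rightarrow> real" and \<epsilon> :: real
  assumes finite_J: "finite J" and w_pos: "\<And>j. j \<in> J \<Longrightarrow> 0 < w j"
    and eps: "0 \<le> \<epsilon>" "real (card J) * \<epsilon> \<le> 1 / 4"
    and diag: "\<And>i. i \<in> J \<Longrightarrow> w i \<le> real (v i i)" "\<And>i. i \<in> J \<Longrightarrow> real (v i i) \<le> (1 + \<epsilon>) * w i"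
    and off_diag: "\<And>i j. i \<in> J \<Longrightarrow> j \<in> J \<Longrightarrow> i \<noteq> j \<Longrightarrow> real (v i j) \<le> \<epsilon> * w j"
    and supp: "\<And>i j. i \<in> J \<Longrightarrow> j \<notin> J \<Longrightarrow> v i j = 0"
begin

definition pert :: "nat \<Rightarrow> nat \<Rightarrow> real" where
  "pert i j = real (v i j) - (if i = j then w j else 0)"

lemma pert_bound:
  assumes "i \<in> J" "j \<in> J"
  shows "\<bar>pert i j\<bar> \<le> \<epsilon> * w j"
proof (cases "i = j")
  case True
  have "(1 + \<epsilon>) * w i = w i + \<epsilon> * w i" by (simp add: distrib_right)
  then show ?thesis using diag[OF assms(1)] True by (simp add: pert_def)
next
  case False
  then show ?thesis using off_diag[OF assms False] by (simp add: pert_def)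
qed

lemma sum_pert:
  assumes "j \<in> J"
  shows "(\<Sum>i\<in>J. t i * real (v i j)) = t j * w j + (\<Sum>i\<in>J. t i * pert i j)"
proof -
  have "(\<Sum>i\<in>J. t i * real (v i j)) = (\<Sum>i\<in>J. (if i = j then t j * w j else 0) + t i * pert i j)"
    by (intro sum.cong) (auto simp: pert_def algebra_simps)
  also have "\<dots> = t j * w j + (\<Sum>i\<in>J. t i * pert i j)"
    using assms finite_J by (simp add: sum.distrib)
  finally show ?thesis .
qed

lemma sum_pert_bound:
  assumes "j \<in> J" "\<And>i. i \<in> J \<Longrightarrow> \<bar>t i\<bar> \<le> m" "0 \<le> m"
  shows "\<bar>\<Sum>i\<in>J. t i * pert i j\<bar> \<le> m / 4 * w j"
proof -
  have "\<bar>\<Sum>i\<in>J. t i * pert i j\<bar> \<le> (\<Sum>i\<in>J. m * (\<epsilon> * w j))"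
    using assms pert_bound by (intro order_trans[OF sum_abs] sum_mono) (auto simp: abs_mult intro: mult_mono)
  also have "\<dots> = (real (card J) * \<epsilon>) * (m * w j)" by simp
  also have "\<dots> \<le> 1 / 4 * (m * w j)"
    using eps assms w_pos[of j] by (intro mult_right_mono) auto
  finally show ?thesis by simp
qed

text \<open>
  Diagonal dominance: with \<open>m\<close> the largest \<open>\<bar>t i\<bar>\<close>, the perturbation contributes at most \<open>m / 4\<close>, so
  \<open>m \<le> B + m / 4\<close> and the error is at most \<open>m / 4 \<le> B / 3\<close>. The case \<open>B = 0\<close> gives uniqueness of the coordinates.
\<close>

lemma coord_bound:
  assumes z: "\<And>j. j \<in> J \<Longrightarrow> (\<Sum>i\<in>J. t i * real (v i j)) = z j" and B: "\<And>j. j \<in> J \<Longrightarrow> \<bar>z j\<bar> \<le> B * w j"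
    and j: "j \<in> J"
  shows "\<bar>t j - z j / w j\<bar> \<le> B / 3"
proof -
  define m where "m = Max ((\<lambda>i. \<bar>t i\<bar>) ` J)"
  have m: "\<bar>t i\<bar> \<le> m" if "i \<in> J" for i
    unfolding m_def using that finite_J by (intro Max_ge) auto
  have m0: "0 \<le> m" using m[OF j] by linarith
  have d: "\<bar>t k - z k / w k\<bar> \<le> m / 4" if k: "k \<in> J" for k
  proof -
    have "t k * w k - z k = - (\<Sum>i\<in>J. t i * pert i k)" using z[OF k] sum_pert[OF k, of t] by linarith
    then have "\<bar>t k * w k - z k\<bar> \<le> m / 4 * w k" using sum_pert_bound[OF k m m0] by simp
    moreover have "t k - z k / w k = (t k * w k - z k) / w k" using w_pos[OF k] by (simp add: field_simps)
    ultimately show ?thesis using w_pos[OF k] by (simp add: abs_divide divide_le_eq)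
  qed
  obtain k where k: "k \<in> J" "m = \<bar>t k\<bar>"
  proof -
    have "m \<in> (\<lambda>i. \<bar>t i\<bar>) ` J" unfolding m_def using finite_J j by (intro Max_in) auto
    then show ?thesis using that by auto
  qed
  have "\<bar>z k / w k\<bar> \<le> B" using B[OF k(1)] w_pos[OF k(1)] by (simp add: abs_divide divide_le_eq)
  then have "m \<le> B + m / 4" using d[OF k(1)] k(2) by linarith
  then show ?thesis using d[OF j] by linarith
qed

text \<open>
  The Jacobi iteration converges because the perturbation contracts by a factor \<open>1 / 4\<close> in the maximum norm.
\<close>

lemma coord_exists: "\<exists>t. \<forall>j\<in>J. (\<Sum>i\<in>J. t i * real (v i j)) = z j"
proof -
  define step where "step t j = (z j - (\<Sum>i\<in>J. t i * pert i j)) / w j" for t :: "nat \<Rightarrow> real" and j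
  have step_diff: "step t j - step t' j = - (\<Sum>i\<in>J. (t i - t' i) * pert i j) / w j" for t j t'
  proof -
    have "(\<Sum>i\<in>J. (t i - t' i) * pert i j) = (\<Sum>i\<in>J. t i * pert i j) - (\<Sum>i\<in>J. t' i * pert i j)"
      by (simp add: left_diff_distrib sum_subtractf)
    then show ?thesis unfolding step_def by (simp add: diff_divide_distrib)
  qed
  define a where "a n = (step ^^ n) (\<lambda>_. 0)" for n
  have a_Suc: "a (Suc n) = step (a n)" for n by (simp add: a_def)
  define B where "B = (\<Sum>j\<in>J. \<bar>a (Suc 0) j - a 0 j\<bar>)"
  have B: "0 \<le> B" unfolding B_def by (intro sum_nonneg) auto
  have contr: "\<forall>j\<in>J. \<bar>a (Suc n) j - a n j\<bar> \<le> B * (1 / 4) ^ n" for n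
  proof (induction n)
    case 0
    then show ?case unfolding B_def using finite_J by (auto intro: member_le_sum)
  next
    case (Suc n)
    show ?case
    proof
      fix j assume j: "j \<in> J"
      have "a (Suc (Suc n)) j - a (Suc n) j = - (\<Sum>i\<in>J. (a (Suc n) i - a n i) * pert i j) / w j"
        using step_diff[of "a (Suc n)" j "a n"] by (simp only: a_Suc)
      also have "\<bar>\<dots>\<bar> \<le> (B * (1 / 4) ^ n / 4 * w j) / w j"
      proof -
        have "\<bar>\<Sum>i\<in>J. (a (Suc n) i - a n i) * pert i j\<bar> \<le> B * (1 / 4) ^ n / 4 * w j"
          using Suc B by (intro sum_pert_bound[OF j]) auto
        then show ?thesis
          using w_pos[OF j] by (simp only: abs_divide abs_minus_cancel abs_of_pos divide_right_mono less_imp_le)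
      qed
      finally show "\<bar>a (Suc (Suc n)) j - a (Suc n) j\<bar> \<le> B * (1 / 4) ^ Suc n"
        using w_pos[OF j] by simp
    qed
  qed
  define t where "t j = lim (\<lambda>n. a n j)" for j
  have lim: "(\<lambda>n. a n j) \<longlonglongrightarrow> t j" if "j \<in> J" for j
    unfolding t_def using contr that
    by (intro convergent_LIMSEQ_iff[THEN iffD1] geometric_increments_convergent) auto
  have "t j = step t j" if j: "j \<in> J" for j
  proof (rule LIMSEQ_unique)
    show "(\<lambda>n. a (Suc n) j) \<longlonglongrightarrow> t j" using lim[OF j] by (rule LIMSEQ_Suc)
    show "(\<lambda>n. a (Suc n) j) \<longlonglongrightarrow> step t j"
      unfolding a_Suc step_def using lim w_pos[OF j] by (intro tendsto_intros) auto
  qed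
  note fixed = this
  have "(\<Sum>i\<in>J. t i * real (v i j)) = z j" if j: "j \<in> J" for j
  proof -
    have "t j * w j = z j - (\<Sum>i\<in>J. t i * pert i j)"
      using fixed[OF j] w_pos[OF j] by (simp add: step_def eq_divide_eq)
    then show ?thesis by (simp add: sum_pert[OF j])
  qed
  then show ?thesis by blast
qed

definition coord :: "(nat \<Rightarrow> real) \<Rightarrow> nat \<Rightarrow> real" where
  "coord z = (SOME t. \<forall>j\<in>J. (\<Sum>i\<in>J. t i * real (v i j)) = z j)"

lemma sum_coord: "j \<in> J \<Longrightarrow> (\<Sum>i\<in>J. coord z i * real (v i j)) = z j"
  unfolding coord_def using someI_ex[OF coord_exists[of z]] by blast

lemma coord_unique:
  assumes "\<And>j. j \<in> J \<Longrightarrow> (\<Sum>i\<in>J. t i * real (v i j)) = z j" "i \<in> J"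
  shows "coord z i = t i"
proof -
  have "\<bar>(coord z i - t i) - (\<lambda>_. 0) i / w i\<bar> \<le> 0 / 3"
    using assms by (intro coord_bound) (simp_all add: left_diff_distrib sum_subtractf sum_coord)
  then show ?thesis by simp
qed

definition ncoord :: "(nat \<Rightarrow> nat) \<Rightarrow> nat \<Rightarrow> real" where
  "ncoord x = coord (\<lambda>j. real (x j))"

lemma sum_ncoord: "j \<in> J \<Longrightarrow> (\<Sum>i\<in>J. ncoord x i * real (v i j)) = real (x j)"
  by (simp add: ncoord_def sum_coord)

lemma ncoord_unique:
  "(\<And>j. j \<in> J \<Longrightarrow> (\<Sum>i\<in>J. t i * real (v i j)) = real (x j)) \<Longrightarrow> i \<in> J \<Longrightarrow> ncoord x i = t i"
  unfolding ncoord_def by (rule coord_unique)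

lemma ncoord_add: "i \<in> J \<Longrightarrow> ncoord (x + y) i = ncoord x i + ncoord y i"
  by (rule ncoord_unique) (auto simp: distrib_right sum.distrib sum_ncoord)

lemma ncoord_zero: "i \<in> J \<Longrightarrow> ncoord 0 i = 0"
  by (rule ncoord_unique[of "\<lambda>_. 0"]) auto

lemma ncoord_inj:
  assumes "\<And>i. i \<in> J \<Longrightarrow> ncoord x i = ncoord y i" "\<And>j. j \<notin> J \<Longrightarrow> x j = y j"
  shows "x = y"
proof
  fix j
  show "x j = y j"
  proof (cases "j \<in> J")
    case True
    have "real (x j) = (\<Sum>i\<in>J. ncoord x i * real (v i j))" using True by (simp add: sum_ncoord)
    also have "\<dots> = (\<Sum>i\<in>J. ncoord y i * real (v i j))" using assms by (intro sum.cong) auto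
    also have "\<dots> = real (y j)" using True by (rule sum_ncoord)
    finally show ?thesis by simp
  qed (use assms in auto)
qed

text \<open>
  The vectors of the half-open fundamental parallelepiped: one representative of each class modulo the lattice.
\<close>

definition cell :: "(nat \<Rightarrow> nat) set" where
  "cell = {x. (\<forall>j. j \<notin> J \<longrightarrow> x j = 0) \<and> (\<forall>i\<in>J. 0 \<le> ncoord x i \<and> ncoord x i < 1)}"

text \<open>
  Subtracting the integer parts of all coordinates. The difference is nonnegative although single subtracted terms may
  exceed the entry, since it is the combination of the rows with the fractional parts as coefficients.
\<close>

definition reduce :: "(nat \<Rightarrow> nat) \<Rightarrow> nat \<Rightarrow> nat" where
  "reduce x j = (if j \<in> J then nat (int (x j) - (\<Sum>i\<in>J. \<lfloor>ncoord x i\<rfloor> * int (v i j))) else 0)"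

lemma real_reduce:
  assumes "j \<in> J"
  shows "real (reduce x j) = (\<Sum>i\<in>J. frac (ncoord x i) * real (v i j))"
proof -
  have "real_of_int (int (x j) - (\<Sum>i\<in>J. \<lfloor>ncoord x i\<rfloor> * int (v i j)))
      = (\<Sum>i\<in>J. ncoord x i * real (v i j)) - (\<Sum>i\<in>J. real_of_int \<lfloor>ncoord x i\<rfloor> * real (v i j))"
    using assms by (simp add: sum_ncoord)
  also have "\<dots> = (\<Sum>i\<in>J. frac (ncoord x i) * real (v i j))"
    by (simp add: sum_subtractf[symmetric] frac_def left_diff_distrib)
  finally have eq: "real_of_int (int (x j) - (\<Sum>i\<in>J. \<lfloor>ncoord x i\<rfloor> * int (v i j)))
      = (\<Sum>i\<in>J. frac (ncoord x i) * real (v i j))" .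
  have "0 \<le> (\<Sum>i\<in>J. frac (ncoord x i) * real (v i j))" by (intro sum_nonneg) auto
  then have "0 \<le> int (x j) - (\<Sum>i\<in>J. \<lfloor>ncoord x i\<rfloor> * int (v i j))"
    unfolding eq[symmetric] by linarith
  then show ?thesis unfolding eq[symmetric] reduce_def using assms by (simp add: of_nat_nat)
qed

lemma ncoord_reduce: "i \<in> J \<Longrightarrow> ncoord (reduce x) i = frac (ncoord x i)"
  by (rule ncoord_unique) (simp_all add: real_reduce)

lemma reduce_in_cell: "reduce x \<in> cell"
  by (simp add: cell_def ncoord_reduce frac_lt_1) (simp add: reduce_def)

lemma cell_subset_box:
  "cell \<subseteq> corner_box J (\<lambda>j. 2 * w j)"
proof
  fix x assume x: "x \<in> cell"
  have "real (x j) \<le> 2 * w j" if j: "j \<in> J" for j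
  proof -
    have "real (x j) = (\<Sum>i\<in>J. ncoord x i * real (v i j))" using j by (simp add: sum_ncoord)
    also have "\<dots> = ncoord x j * w j + (\<Sum>i\<in>J. ncoord x i * pert i j)" by (rule sum_pert[OF j])
    also have "\<dots> \<le> 1 * w j + 1 / 4 * w j"
      using x j w_pos[OF j] sum_pert_bound[OF j, of "ncoord x" 1]
      by (intro add_mono mult_right_mono) (auto simp: cell_def abs_le_iff less_imp_le)
    finally show ?thesis using w_pos[OF j] by linarith
  qed
  then show "x \<in> corner_box J (\<lambda>j. 2 * w j)" using x by (auto simp: vec_box_def cell_def)
qed

text \<open>
  A vector with all \<open>x j / w j\<close> in \<open>[2/5, 7/10]\<close> has coordinates within \<open>7/30\<close> of these quotients, hence in
  \<open>[0, 1)\<close>. This bounds the number of classes from below.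
\<close>

lemma box_subset_cell:
  "vec_box J (\<lambda>j. 2 / 5 * w j) (\<lambda>j. 7 / 10 * w j) (\<lambda>_. 0) \<subseteq> cell"
proof
  fix x assume x: "x \<in> vec_box J (\<lambda>j. 2 / 5 * w j) (\<lambda>j. 7 / 10 * w j) (\<lambda>_. 0)"
  have "0 \<le> ncoord x i \<and> ncoord x i < 1" if i: "i \<in> J" for i
  proof -
    have xb: "2 / 5 * w j \<le> real (x j)" "real (x j) \<le> 7 / 10 * w j" if "j \<in> J" for j
      using x that by (auto simp: vec_box_def split: if_splits)
    have "\<bar>ncoord x i - real (x i) / w i\<bar> \<le> (7 / 10) / 3"
      using i xb by (intro coord_bound[where z = "\<lambda>j. real (x j)"]) (auto simp: sum_ncoord)
    moreover have "2 / 5 \<le> real (x i) / w i" "real (x i) / w i \<le> 7 / 10"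
      using xb[OF i] w_pos[OF i] by (auto simp: field_simps)
    ultimately show ?thesis by linarith
  qed
  then show "x \<in> cell" using x by (auto simp: cell_def vec_box_def split: if_splits)
qed

sublocale comm_quasigroup cell "\<lambda>x y. reduce (x + y)" 0
proof
  show "finite cell" using finite_subset[OF cell_subset_box] finite_vec_box[OF finite_J] by blast
  show "0 \<in> cell"
    by (simp add: cell_def ncoord_zero)
  show "reduce (x + y) \<in> cell" for x y by (rule reduce_in_cell)
  show "reduce (x + y) = reduce (y + x)" for x y by (simp add: add.commute)
  show "y = y'" if x: "x \<in> cell" "y \<in> cell" "y' \<in> cell" "reduce (x + y) = reduce (x + y')" for x y y'
  proof (rule ncoord_inj)
    fix i assume i: "i \<in> J"
    have "frac (ncoord x i + ncoord y i) = frac (ncoord x i + ncoord y' i)"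
      using ncoord_reduce[OF i, of "x + y"] ncoord_reduce[OF i, of "x + y'"] x(4) i by (simp add: ncoord_add)
    then have "ncoord y i - ncoord y' i = real_of_int (\<lfloor>ncoord x i + ncoord y i\<rfloor> - \<lfloor>ncoord x i + ncoord y' i\<rfloor>)"
      by (simp add: frac_def)
    then obtain k :: int where "ncoord y i - ncoord y' i = real_of_int k" by blast
    moreover have "\<bar>ncoord y i - ncoord y' i\<bar> < 1" using x i by (auto simp: cell_def abs_less_iff) fastforce+
    ultimately have "\<bar>real_of_int k\<bar> < 1" "ncoord y i - ncoord y' i = real_of_int k" by simp_all
    then show "ncoord y i = ncoord y' i" by (cases "k = 0") linarith+
  qed (use x in \<open>auto simp: cell_def\<close>)
qed

text \<open>
  Each subset sum in the cell is congruent to an honest sum of elements of \<open>A\<close>, and each summand adds at most one to each coordinate.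
\<close>

lemma subset_sums_lift:
  assumes "y \<in> subset_sums l" "set l \<subseteq> A \<inter> cell"
  shows "\<exists>s\<in>semigroup_gen A. (\<forall>j. j \<notin> J \<longrightarrow> s j = 0) \<and>
    (\<forall>i\<in>J. ncoord s i \<le> real (length l) \<and> ncoord s i - ncoord y i \<in> \<int>)"
  using assms
proof (induction l arbitrary: y)
  case Nil
  have "y = 0" using Nil(1) unfolding subset_sums.simps by blast
  have "ncoord y i = 0" if "i \<in> J" for i
    unfolding \<open>y = 0\<close> using that by (rule ncoord_zero)
  moreover have "y \<in> semigroup_gen A"
    unfolding \<open>y = 0\<close> by (rule semigroup_gen_zero)
  moreover have "y j = 0" if "j \<notin> J" for j
    unfolding \<open>y = 0\<close> by (rule zero_fun_apply)
  ultimately show ?case by (intro bexI[of _ y]) simp_all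
next
  case (Cons a l)
  show ?case
  proof (cases "y \<in> subset_sums l")
    case True
    then obtain s where "s \<in> semigroup_gen A" "\<forall>j. j \<notin> J \<longrightarrow> s j = 0"
      "\<forall>i\<in>J. ncoord s i \<le> real (length l) \<and> ncoord s i - ncoord y i \<in> \<int>"
      using Cons by fastforce
    then show ?thesis by (intro bexI[of _ s]) (auto simp: add_increasing)
  next
    case False
    then obtain x where x: "x \<in> subset_sums l" "y = reduce (x + a)"
      using Cons.prems(1) unfolding subset_sums.simps by blast
    then obtain s where s: "s \<in> semigroup_gen A" "\<forall>j. j \<notin> J \<longrightarrow> s j = 0"
      "\<forall>i\<in>J. ncoord s i \<le> real (length l) \<and> ncoord s i - ncoord x i \<in> \<int>"
      using Cons by fastforce
    have a: "a \<in> A" "a \<in> cell" using Cons by auto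
    have "ncoord (s + a) i \<le> real (length (a # l)) \<and> ncoord (s + a) i - ncoord y i \<in> \<int>" if i: "i \<in> J" for i
    proof -
      have "ncoord (s + a) i - ncoord y i = (ncoord s i - ncoord x i) + real_of_int \<lfloor>ncoord x i + ncoord a i\<rfloor>"
        using i ncoord_reduce[OF i, of "x + a"] by (simp add: x(2) ncoord_add frac_def)
      moreover have "(ncoord s i - ncoord x i) + real_of_int \<lfloor>ncoord x i + ncoord a i\<rfloor> \<in> \<int>"
        using s(3) i by (intro Ints_add) auto
      moreover have "ncoord (s + a) i \<le> real (length l) + 1"
      proof -
        have "ncoord s i \<le> real (length l)" "ncoord a i < 1" using i s(3) a(2) by (auto simp: cell_def)
        then show ?thesis using i by (simp add: ncoord_add)
      qed
      ultimately show ?thesis by simp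
    qed
    moreover have "s + a \<in> semigroup_gen A"
      using s(1) semigroup_gen_incl[OF a(1)] by (rule semigroup_gen_add)
    moreover have "\<forall>j. j \<notin> J \<longrightarrow> (s + a) j = 0"
      using s(2) a(2) by (simp add: cell_def)
    ultimately show ?thesis by blast
  qed
qed

text \<open>
  The vector is congruent to a sum of two lifted subset sums; what remains has integer coordinates, and these are nonnegative
  by the hypothesis on \<open>x\<close>.
\<close>

lemma mem_semigroup_gen:
  assumes l: "set l \<subseteq> A \<inter> cell" "card cell < 2 * card (subset_sums l)"
    and v: "\<And>i. i \<in> J \<Longrightarrow> v i \<in> A"
    and x: "\<And>j. j \<notin> J \<Longrightarrow> x j = 0" "\<And>i. i \<in> J \<Longrightarrow> 2 * real (length l) \<le> ncoord x i"
  shows "x \<in> semigroup_gen A"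
proof -
  obtain y1 y2 where y: "y1 \<in> subset_sums l" "y2 \<in> subset_sums l" "reduce (y1 + y2) = reduce x"
    using subset_sums_plus_subset_sums[of l "reduce x"] l reduce_in_cell[of x] by (metis le_infE)
  obtain s1 where s1: "s1 \<in> semigroup_gen A" "\<forall>j. j \<notin> J \<longrightarrow> s1 j = 0"
    "\<forall>i\<in>J. ncoord s1 i \<le> real (length l) \<and> ncoord s1 i - ncoord y1 i \<in> \<int>"
    using subset_sums_lift[OF y(1) l(1)] by blast
  obtain s2 where s2: "s2 \<in> semigroup_gen A" "\<forall>j. j \<notin> J \<longrightarrow> s2 j = 0"
    "\<forall>i\<in>J. ncoord s2 i \<le> real (length l) \<and> ncoord s2 i - ncoord y2 i \<in> \<int>"
    using subset_sums_lift[OF y(2) l(1)] by blast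
  define s where "s = s1 + s2"
  have s: "s \<in> semigroup_gen A" unfolding s_def using s1(1) s2(1) by (rule semigroup_gen_add)
  have "\<exists>c. ncoord x i - ncoord s i = real c" if i: "i \<in> J" for i
  proof -
    have "frac (ncoord x i) = frac (ncoord y1 i + ncoord y2 i)"
      using ncoord_reduce[OF i, of x] ncoord_reduce[OF i, of "y1 + y2"] y(3) i by (simp add: ncoord_add)
    then have "ncoord x i - ncoord s i = real_of_int (\<lfloor>ncoord x i\<rfloor> - \<lfloor>ncoord y1 i + ncoord y2 i\<rfloor>)
        - (ncoord s1 i - ncoord y1 i) - (ncoord s2 i - ncoord y2 i)"
      using i by (simp add: s_def ncoord_add frac_def)
    also have "\<dots> \<in> \<int>"
      by (rule Ints_diff[OF Ints_diff]) (use s1(3) s2(3) i in auto)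
    finally have "ncoord x i - ncoord s i \<in> \<int>" .
    moreover have "0 \<le> ncoord x i - ncoord s i"
      using i s1(3) s2(3) x(2)[OF i] by (auto simp: s_def ncoord_add dest!: bspec[OF _ i])
    ultimately show ?thesis by (metis Ints_cases of_int_0_le_iff zero_le_imp_eq_int of_int_of_nat_eq)
  qed
  then obtain c where c: "\<And>i. i \<in> J \<Longrightarrow> ncoord x i - ncoord s i = real (c i)" by metis
  have "x = (\<lambda>j. s j + (\<Sum>i\<in>J. c i * v i j))"
  proof
    fix j
    show "x j = s j + (\<Sum>i\<in>J. c i * v i j)"
    proof (cases "j \<in> J")
      case True
      have "real (x j) - real (s j) = (\<Sum>i\<in>J. (ncoord x i - ncoord s i) * real (v i j))"
        using True by (simp add: left_diff_distrib sum_subtractf sum_ncoord)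
      also have "\<dots> = (\<Sum>i\<in>J. real (c i * v i j))" using c by (intro sum.cong) auto
      finally have "real (x j) = real (s j + (\<Sum>i\<in>J. c i * v i j))" by simp
      then show ?thesis by (simp only: of_nat_eq_iff)
    next
      case False
      then show ?thesis using x(1) s1(2) s2(2) supp by (simp add: s_def)
    qed
  qed
  also have "\<dots> \<in> semigroup_gen A" using finite_J v s by (rule semigroup_gen_combination)
  finally show ?thesis .
qed

end

section \<open>Covering everything beyond the hyperbolic region\<close>

context near_diagonal
begin

definition rich :: "real \<Rightarrow> (nat \<Rightarrow> nat) set \<Rightarrow> bool" where
  "rich q A \<longleftrightarrow> (\<exists>l. set l \<subseteq> A \<inter> cell \<and> real (length l) \<le> q \<and> card cell < 2 * card (subset_sums l))"

lemma subset_prob_not_rich: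
  assumes F: "finite F" "cell \<subseteq> F" and p: "0 < p" "p \<le> 1 / 8" and c: "0 \<le> c" "c \<le> p * real (card cell)"
  shows "subset_prob p F (\<lambda>A. \<not> rich (3 * c) A) \<le> 2 * real (card cell) * exp (- c / 7)"
proof -
  have "subset_prob p F (\<lambda>A. \<not> rich (3 * c) A)
      = subset_prob p cell (\<lambda>A. \<not> (\<exists>l. set l \<subseteq> A \<and> real (length l) \<le> 3 * c \<and> card cell < 2 * card (subset_sums l)))"
    unfolding rich_def using F p by (subst subset_prob_restrict[symmetric, where F = F]) auto
  also have "\<dots> \<le> 2 * real (card cell) * exp (- c / 7)"
    using p c by (rule subset_prob_no_short_cover)
  finally show ?thesis .
qed

text \<open>
  If \<open>x\<close> is the multiple \<open>9 * c\<close> of \<open>w\<close>, its coordinates are within \<open>3 * c\<close> of \<open>9 * c\<close>, so at least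
  \<open>6 * c\<close>: twice the length of the list that fills half of the cell.
\<close>

lemma rich_mem_semigroup_gen:
  assumes "rich (3 * c) A" and "\<And>i. i \<in> J \<Longrightarrow> v i \<in> A" and x: "\<And>j. j \<notin> J \<Longrightarrow> x j = 0"
    and xw: "\<And>j. j \<in> J \<Longrightarrow> real (x j) = 9 * c * w j" and c: "0 \<le> c"
  shows "x \<in> semigroup_gen A"
proof -
  obtain l where l: "set l \<subseteq> A \<inter> cell" "real (length l) \<le> 3 * c" "card cell < 2 * card (subset_sums l)"
    using assms(1) by (auto simp: rich_def)
  show ?thesis
  proof (rule mem_semigroup_gen[OF l(1,3) assms(2) x])
    fix i assume i: "i \<in> J"
    have "\<bar>ncoord x i - real (x i) / w i\<bar> \<le> (9 * c) / 3"
    proof (rule coord_bound[OF _ _ i])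
      fix j assume j: "j \<in> J"
      then show "(\<Sum>i\<in>J. ncoord x i * real (v i j)) = real (x j)" by (rule sum_ncoord)
      show "\<bar>real (x j)\<bar> \<le> 9 * c * w j" using xw[OF j] by simp
    qed
    moreover have "real (x i) / w i = 9 * c" using xw[OF i] w_pos[OF i] by simp
    ultimately show "2 * real (length l) \<le> ncoord x i" using l(2) by linarith
  qed
qed

end

lemma exp_neg_mult_ln:
  assumes "0 < p"
  shows "exp (- (real n * ln (1 / p))) = p ^ n"
  using assms by (simp add: ln_div exp_of_nat_mult)

text \<open>
  The bases are built from \<open>w = x / (9 B L)\<close>, whose entries in \<open>J\<close> are at least \<open>10 * d\<close>, so the boxes for the
  \<open>v i\<close> and the cell have numbers of points comparable to their volumes. The last hypothesis says that these boxes contain enough elements of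
  \<open>A\<close> on average. The first summand bounds the probability that some \<open>v i\<close> does not exist; the second one is a union
  bound over all possible \<open>v\<close>.
\<close>

lemma subset_prob_large_not_generated:
  fixes d B :: nat and p :: real and x :: "nat \<Rightarrow> nat"
  defines "L \<equiv> ln (1 / p)" and "N \<equiv> 1 / p ^ 2"
  defines "F \<equiv> corner_box {..<d} (\<lambda>_. N)"
  assumes d: "d \<ge> 1" and B: "B \<ge> 1" and p: "0 < p" "p \<le> 1 / 8" and L: "L \<ge> 1"
    and J: "J \<subseteq> {..<d}" and x0: "\<And>j. j \<notin> J \<Longrightarrow> x j = 0"
    and xN: "\<And>j. j \<in> J \<Longrightarrow> real (x j) \<le> N"
    and xL: "\<And>j. j \<in> J \<Longrightarrow> 90 * real d * real B * L \<le> real (x j)"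
    and xprod: "real B * L \<le> p * (\<Prod>j\<in>J. real (x j) / (72 * real d * real B * L))"
  shows "subset_prob p F (\<lambda>A. x \<notin> semigroup_gen A)
     \<le> real d * p ^ B + ((N + 1) ^ d) ^ d * (2 * (N + 1) ^ d * exp (- (real B * L) / 7))"
proof -
  have fJ: "finite J" and cJ: "card J \<le> d"
    using J finite_subset card_mono[OF _ J] by auto
  define c where "c = real B * L"
  define w where "w j = real (x j) / (9 * c)" for j
  define \<epsilon> where "\<epsilon> = 1 / (4 * real d)"
  have c1: "1 \<le> c" unfolding c_def using B L mult_mono[of 1 "real B" 1 L] by simp
  have d1: "1 \<le> real d" using d by simp
  have wd: "10 * real d \<le> w j" if "j \<in> J" for j
    using xL[OF that] c1 by (simp add: w_def c_def field_simps)
  have xw: "real (x j) = 9 * c * w j" for j using c1 by (simp add: w_def)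
  have wN: "2 * w j \<le> N" if "j \<in> J" for j
  proof -
    have "2 * w j \<le> 9 * c * w j" using wd[OF that] c1 d1 by (intro mult_right_mono) auto
    then show ?thesis using xN[OF that] xw[of j] by simp
  qed
  have N0: "0 \<le> N" using p by (simp add: N_def)
  have fF: "finite F" unfolding F_def by (rule finite_vec_box) simp
  have p1: "0 \<le> p" "p \<le> 1" using p by auto
  have boxN: "vec_box J lo hi (\<lambda>_. 0) \<subseteq> corner_box J (\<lambda>_. N)"
    if "\<And>j. j \<in> J \<Longrightarrow> hi j \<le> 2 * w j" for lo hi
    unfolding vec_box_def using order_trans[OF that wN] by (auto intro: order_trans split: if_splits)
  have boxF: "corner_box J (\<lambda>_. N) \<subseteq> F"
    using J N0 by (fastforce simp: vec_box_def F_def split: if_splits)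
  have cardN: "real (card V) \<le> (N + 1) ^ d" if "V \<subseteq> corner_box J (\<lambda>_. N)" for V
  proof -
    have "real (card V) \<le> real (card (corner_box J (\<lambda>_. N)))"
      using that finite_vec_box[OF fJ] by (intro of_nat_mono card_mono)
    also have "\<dots> \<le> (N + 1) ^ card J" using fJ N0 by (rule card_vec_box_le)
    also have "\<dots> \<le> (N + 1) ^ d" using cJ N0 by (intro power_increasing) auto
    finally show ?thesis .
  qed
  have large: "c \<le> p * real (card (vec_box J lo hi (\<lambda>_. 0)))"
    if "\<And>j. j \<in> J \<Longrightarrow> 0 \<le> lo j" "\<And>j. j \<in> J \<Longrightarrow> lo j + w j / (4 * real d) \<le> hi j" for lo hi
  proof -
    have "(\<Prod>j\<in>J. w j / (8 * real d)) \<le> real (card (vec_box J lo hi (\<lambda>_. 0)))"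
    proof (rule card_vec_box_ge[OF fJ that(1)])
      fix j assume j: "j \<in> J"
      show "0 \<le> w j / (8 * real d)" using wd[OF j] d1 by simp
      have "w j / (8 * real d) + 1 \<le> w j / (4 * real d)" using wd[OF j] d1 by (simp add: field_simps)
      then show "w j / (8 * real d) + 1 \<le> hi j - lo j" using that(2)[OF j] by linarith
    qed
    moreover have "(\<Prod>j\<in>J. w j / (8 * real d)) = (\<Prod>j\<in>J. real (x j) / (72 * real d * real B * L))"
      by (intro prod.cong) (auto simp: w_def c_def mult_ac)
    ultimately show ?thesis
      using xprod mult_left_mono[OF _ p1(1)] unfolding c_def by (metis order_trans)
  qed
  \<comment> \<open>the candidates for \<open>v i\<close>: near \<open>w i\<close> in coordinate \<open>i\<close>, near \<open>0\<close> in the others\<close>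
  define V where "V i = vec_box J (\<lambda>j. if j = i then w j else 0)
    (\<lambda>j. if j = i then (1 + \<epsilon>) * w j else \<epsilon> * w j) (\<lambda>_. 0)" for i
  have eps: "0 \<le> \<epsilon>" "\<epsilon> \<le> 1" using d1 by (simp_all add: \<epsilon>_def)
  have w0: "0 < w j" if "j \<in> J" for j using wd[OF that] d1 by linarith
  have VN: "V i \<subseteq> corner_box J (\<lambda>_. N)" for i
  proof -
    have "(1 + \<epsilon>) * w j \<le> 2 * w j" "\<epsilon> * w j \<le> 2 * w j" if "j \<in> J" for j
      using eps w0[OF that] by (auto intro!: mult_right_mono)
    then show ?thesis unfolding V_def by (intro boxN) auto
  qed
  have cV: "c \<le> p * real (card (V i))" if "i \<in> J" for i
    unfolding V_def using w0 by (intro large) (auto simp: \<epsilon>_def algebra_simps less_imp_le)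
  have nd: "near_diagonal J v w \<epsilon>" if v: "v \<in> Pi\<^sub>E J V" for v
  proof
    have vi: "v i \<in> V i" if "i \<in> J" for i using v that by auto
    show "real (card J) * \<epsilon> \<le> 1 / 4" using cJ d1 by (simp add: \<epsilon>_def field_simps)
    fix i assume i: "i \<in> J"
    show "w i \<le> real (v i i)" "real (v i i) \<le> (1 + \<epsilon>) * w i"
      using vi[OF i] i by (auto simp: V_def vec_box_def dest!: spec[of _ i])
    fix j
    show "j \<notin> J \<Longrightarrow> v i j = 0" using vi[OF i] by (auto simp: V_def vec_box_def dest!: spec[of _ j])
    show "j \<in> J \<Longrightarrow> i \<noteq> j \<Longrightarrow> real (v i j) \<le> \<epsilon> * w j"
      using vi[OF i] by (auto simp: V_def vec_box_def dest!: spec[of _ j])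
  qed (use fJ w0 eps in auto)
  let ?Q1 = "\<lambda>i A. A \<inter> V i = {}"
  let ?Q2 = "\<lambda>v A. \<not> near_diagonal.rich J v (3 * c) A"
  have fV: "finite (V i)" for i using VN finite_vec_box[OF fJ] finite_subset by blast
  have fPiE: "finite (Pi\<^sub>E J V)" using fJ fV by (intro finite_PiE)
  have "subset_prob p F (\<lambda>A. x \<notin> semigroup_gen A)
      \<le> subset_prob p F (\<lambda>A. (\<exists>i\<in>J. ?Q1 i A) \<or> (\<exists>v\<in>Pi\<^sub>E J V. ?Q2 v A))"
  proof (rule subset_prob_mono[OF fF p1], rule ccontr)
    fix A assume x: "x \<notin> semigroup_gen A" and neg: "\<not> ((\<exists>i\<in>J. ?Q1 i A) \<or> (\<exists>v\<in>Pi\<^sub>E J V. ?Q2 v A))"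
    then have "\<forall>i\<in>J. \<exists>a. a \<in> A \<and> a \<in> V i" by blast
    then obtain v0 where v0: "\<And>i. i \<in> J \<Longrightarrow> v0 i \<in> A \<and> v0 i \<in> V i" by metis
    define v where "v = restrict v0 J"
    have v: "v \<in> Pi\<^sub>E J V" "\<And>i. i \<in> J \<Longrightarrow> v i \<in> A" using v0 by (auto simp: v_def)
    have "near_diagonal.rich J v (3 * c) A" using neg v(1) by blast
    then have "x \<in> semigroup_gen A"
      using v(2) x0 xw c1 by (intro near_diagonal.rich_mem_semigroup_gen[OF nd[OF v(1)]]) auto
    then show False using x by blast
  qed
  also have "\<dots> \<le> subset_prob p F (\<lambda>A. \<exists>i\<in>J. ?Q1 i A) + subset_prob p F (\<lambda>A. \<exists>v\<in>Pi\<^sub>E J V. ?Q2 v A)"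
    using fF p1 by (rule subset_prob_disj)
  also have "\<dots> \<le> (\<Sum>i\<in>J. subset_prob p F (?Q1 i)) + (\<Sum>v\<in>Pi\<^sub>E J V. subset_prob p F (?Q2 v))"
    using fF p1 fJ fPiE by (intro add_mono subset_prob_bex)
  also have "\<dots> \<le> (\<Sum>i\<in>J. p ^ B) + (\<Sum>v\<in>Pi\<^sub>E J V. 2 * (N + 1) ^ d * exp (- c / 7))"
  proof (intro add_mono sum_mono)
    fix i assume i: "i \<in> J"
    have "subset_prob p F (?Q1 i) \<le> exp (- (p * real (card (V i))))"
      using VN boxF by (intro subset_prob_avoid[OF fF p1]) blast
    also have "\<dots> \<le> exp (- c)" using cV[OF i] by simp
    also have "\<dots> = p ^ B" using exp_neg_mult_ln[OF p(1), of B] by (simp add: c_def L_def)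
    finally show "subset_prob p F (?Q1 i) \<le> p ^ B" .
  next
    fix v assume v: "v \<in> Pi\<^sub>E J V"
    interpret near_diagonal J v w \<epsilon> by (rule nd[OF v])
    have sub: "cell \<subseteq> corner_box J (\<lambda>_. N)"
      using cell_subset_box boxN[of "\<lambda>j. 2 * w j" "\<lambda>_. 0"] by blast
    have "c \<le> p * real (card (vec_box J (\<lambda>j. 2 / 5 * w j) (\<lambda>j. 7 / 10 * w j) (\<lambda>_. 0)))"
    proof (rule large)
      fix j assume j: "j \<in> J"
      show "0 \<le> 2 / 5 * w j" using w0[OF j] by simp
      have "w j / (4 * real d) \<le> w j / 4" using d1 w0[OF j] by (intro divide_left_mono) auto
      then show "2 / 5 * w j + w j / (4 * real d) \<le> 7 / 10 * w j" using w0[OF j] by linarith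
    qed
    also have "\<dots> \<le> p * real (card cell)"
      using p box_subset_cell finite_H by (intro mult_left_mono of_nat_mono card_mono) auto
    finally have "c \<le> p * real (card cell)" .
    then have "subset_prob p F (?Q2 v) \<le> 2 * real (card cell) * exp (- c / 7)"
      using sub boxF p c1 by (intro subset_prob_not_rich[OF fF]) auto
    also have "\<dots> \<le> 2 * (N + 1) ^ d * exp (- c / 7)"
      using cardN[OF sub] by (intro mult_right_mono mult_left_mono) auto
    finally show "subset_prob p F (?Q2 v) \<le> 2 * (N + 1) ^ d * exp (- c / 7)" .
  qed
  also have "\<dots> = real (card J) * p ^ B + real (card (Pi\<^sub>E J V)) * (2 * (N + 1) ^ d * exp (- c / 7))"
    by simp
  also have "\<dots> \<le> real d * p ^ B + ((N + 1) ^ d) ^ d * (2 * (N + 1) ^ d * exp (- c / 7))"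
  proof (intro add_mono mult_right_mono)
    have "real (card (Pi\<^sub>E J V)) = (\<Prod>i\<in>J. real (card (V i)))" using fJ by (simp add: card_PiE)
    also have "\<dots> \<le> (\<Prod>i\<in>J. (N + 1) ^ d)" using cardN[OF VN] by (intro prod_mono) auto
    also have "\<dots> = ((N + 1) ^ d) ^ card J" by simp
    also have "\<dots> \<le> ((N + 1) ^ d) ^ d" using cJ N0 by (intro power_increasing one_le_power) auto
    finally show "real (card (Pi\<^sub>E J V)) \<le> ((N + 1) ^ d) ^ d" .
  qed (use cJ p N0 in auto)
  finally show ?thesis by (simp add: c_def)
qed

text \<open>
  The coordinates of \<open>x\<close> below \<open>180 d B L\<close> are matched by one element \<open>a\<close> of \<open>A\<close>, which is at most \<open>x / 2\<close> in the
  other coordinates; then \<open>x - a\<close> is supported on large coordinates. Each small coordinate contributes only a bounded multiple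
  of \<open>L\<close> to the product, so the lower bound on the product survives in the smaller dimension with one factor \<open>L\<close> fewer per
  coordinate. The value of \<open>B\<close> makes all failure probabilities beat the
  numbers of vectors \<open>x\<close>, of sets \<open>J\<close> and of bases \<open>v\<close>.
\<close>

lemma subset_prob_shell_not_generated:
  fixes d m B :: nat and p C :: real
  defines "m \<equiv> 3 * d * d + 6 * d + 2" and "B \<equiv> 7 * (3 * d * d + 6 * d + 2)"
  defines "L \<equiv> ln (1 / p)" and "N \<equiv> 1 / p ^ 2"
  defines "F \<equiv> corner_box {..<d} (\<lambda>_. N)"
  assumes d: "d \<ge> 1" and p: "0 < p" "p \<le> 1 / 8" and L: "L \<ge> 1"
    and C: "real B * (360 * real d * real B) ^ d \<le> C"
  shows "subset_prob p F (\<lambda>A. \<exists>x\<in>F. C * (1 / p) * L ^ (d + 1) \<le> (\<Prod>i<d. real (x i) + L) \<and> x \<notin> semigroup_gen A)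
     \<le> 2 ^ d * (real d + 3) * p ^ 2"
proof -
  have B1: "1 \<le> real B" by (simp add: B_def)
  have d1: "1 \<le> real d" using d by simp
  have dB: "1 \<le> real d * real B" using mult_mono[of 1 "real d" 1 "real B"] B1 d1 by simp
  have p1: "0 \<le> p" "p \<le> 1" using p by auto
  have N0: "0 \<le> N" using p by (simp add: N_def)
  have fF: "finite F" unfolding F_def by (rule finite_vec_box) simp
  have N1: "N + 1 \<le> 1 / p ^ 3"
  proof -
    have "p + p ^ 3 \<le> 1 / 8 + (1 / 8) ^ 3" using p by (intro add_mono power_mono) auto
    then have "p + p ^ 3 \<le> 1" by (simp add: power3_eq_cube)
    then have "(p + p ^ 3) / p ^ 3 \<le> 1 / p ^ 3" using p by (intro divide_right_mono) auto
    moreover have "(p + p ^ 3) / p ^ 3 = N + 1"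
      using p by (simp add: N_def add_divide_distrib power3_eq_cube power2_eq_square)
    ultimately show ?thesis by simp
  qed
  have Npow: "(N + 1) ^ k \<le> 1 / p ^ (3 * k)" for k
    using power_mono[OF N1, of k] N0 by (simp add: power_divide power_mult)
  have cF: "real (card F) \<le> 1 / p ^ (3 * d)"
    using card_vec_box_le[of "{..<d}" N "\<lambda>_. 0"] N0 Npow[of d] by (simp add: F_def)
  define X where "X = {x \<in> F. C * (1 / p) * L ^ (d + 1) \<le> (\<Prod>i<d. real (x i) + L)}"
  define J where "J x = {i. i < d \<and> 180 * real d * real B * L \<le> real (x i)}" for x :: "nat \<Rightarrow> nat"
  define V where "V x = vec_box (J x) (\<lambda>_. 0) (\<lambda>j. real (x j) / 2) x" for x
  define Y where "Y I = {y \<in> F. (\<forall>j. j \<notin> I \<longrightarrow> y j = 0) \<and> (\<forall>j\<in>I. 90 * real d * real B * L \<le> real (y j))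
     \<and> real B * L \<le> p * (\<Prod>j\<in>I. real (y j) / (72 * real d * real B * L))}" for I
  have prodx: "real B * L \<le> p * (\<Prod>j\<in>J x. real (x j) / (144 * real d * real B * L))" if x: "x \<in> X" for x
  proof -
    \<comment> \<open>compare factor by factor: a large coordinate with its own share of the product, a small one with a constant\<close>
    let ?g = "\<lambda>i. if i \<in> J x then real (x i) / (144 * real d * real B * L) else 1"
    let ?M = "360 * real d * real B"
    have "(\<Prod>i<d. (real (x i) + L) / L) \<le> (\<Prod>i<d. ?M * ?g i)"
    proof (intro prod_mono conjI)
      fix i assume i: "i \<in> {..<d}"
      show "0 \<le> (real (x i) + L) / L" using L by simp
      show "(real (x i) + L) / L \<le> ?M * ?g i"
      proof (cases "i \<in> J x")
        case True
        have "1 * L \<le> 180 * (real d * real B) * L" using dB L by (intro mult_right_mono) auto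
        then have "L \<le> real (x i)" using True by (simp add: J_def mult_ac)
        then have "(real (x i) + L) / L \<le> 5 / 2 * real (x i) / L" using L by (intro divide_right_mono) auto
        also have "\<dots> = ?M * ?g i" using True d B1 L by (simp add: field_simps)
        finally show ?thesis .
      next
        case False
        then have "real (x i) \<le> 180 * real d * real B * L" using i by (simp add: J_def)
        moreover have "1 * L \<le> 180 * (real d * real B) * L" using dB L by (intro mult_right_mono) auto
        ultimately have "real (x i) + L \<le> ?M * L" by (simp add: mult_ac)
        then show ?thesis using False L by (simp add: divide_le_eq)
      qed
    qed
    also have "\<dots> = ?M ^ d * (\<Prod>i<d. ?g i)" by (simp add: prod.distrib)
    also have "(\<Prod>i<d. ?g i) = (\<Prod>j\<in>J x. real (x j) / (144 * real d * real B * L))"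
      by (subst prod.inter_restrict[symmetric]) (auto simp: J_def intro!: prod.cong)
    finally have 1: "(\<Prod>i<d. (real (x i) + L) / L) \<le> ?M ^ d * (\<Prod>j\<in>J x. real (x j) / (144 * real d * real B * L))" .
    have "C * (1 / p) * L = C * (1 / p) * L ^ (d + 1) / L ^ d" using L by simp
    also have "\<dots> \<le> (\<Prod>i<d. real (x i) + L) / L ^ d"
      using x L by (intro divide_right_mono) (auto simp: X_def)
    also have "\<dots> = (\<Prod>i<d. (real (x i) + L) / L)" by (simp add: prod_dividef)
    also note 1
    finally have "C * L \<le> ?M ^ d * (p * (\<Prod>j\<in>J x. real (x j) / (144 * real d * real B * L)))"
      using p by (simp add: field_simps)
    moreover have "real B * ?M ^ d * L \<le> C * L" using C L by (intro mult_right_mono) auto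
    ultimately have "?M ^ d * (real B * L) \<le> ?M ^ d * (p * (\<Prod>j\<in>J x. real (x j) / (144 * real d * real B * L)))"
      by (simp add: mult_ac)
    moreover have "0 < ?M ^ d" using d1 B1 by (intro zero_less_power) auto
    ultimately show ?thesis by (simp only: mult_le_cancel_left_pos)
  qed
  have fX: "finite X" "card X \<le> card F" and fY: "finite (Y I)" "card (Y I) \<le> card F" for I
    using fF by (auto simp: X_def Y_def intro: card_mono)
  have xF: "x j \<le> N" "j < d" if "x \<in> F" "x j \<noteq> 0" for x j
    using that by (auto simp: F_def vec_box_def split: if_splits dest: spec[of _ j])
  have F0: "x j = 0" if "x \<in> F" "\<not> j < d" for x j
    using that by (auto simp: F_def vec_box_def split: if_splits dest: spec[of _ j])
  have FI: "y \<in> F" if "x \<in> F" "\<And>j. y j \<le> x j" for x y :: "nat \<Rightarrow> nat"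
  proof -
    have "real (y j) \<le> N" for j
      using that(2)[of j] xF(1)[OF that(1), of j] N0 by (cases "x j = 0") auto
    moreover have "y j = 0" if "\<not> j < d" for j
      using F0[OF \<open>x \<in> F\<close> that] \<open>\<And>j. y j \<le> x j\<close>[of j] by simp
    ultimately show ?thesis by (auto simp: F_def vec_box_def)
  qed
  have VF: "V x \<subseteq> F" if "x \<in> F" for x
  proof
    fix a assume a: "a \<in> V x"
    have "a j \<le> x j" for j using a by (cases "j \<in> J x") (auto simp: V_def vec_box_def dest!: spec[of _ j])
    then show "a \<in> F" by (rule FI[OF that])
  qed
  have "subset_prob p F (\<lambda>A. \<exists>x\<in>F. C * (1 / p) * L ^ (d + 1) \<le> (\<Prod>i<d. real (x i) + L) \<and> x \<notin> semigroup_gen A)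
    \<le> subset_prob p F (\<lambda>A. (\<exists>x\<in>X. A \<inter> V x = {}) \<or> (\<exists>I\<in>Pow {..<d}. \<exists>y\<in>Y I. y \<notin> semigroup_gen A))"
  proof (rule subset_prob_mono[OF fF p1], rule ccontr)
    fix A assume "\<exists>x\<in>F. C * (1 / p) * L ^ (d + 1) \<le> (\<Prod>i<d. real (x i) + L) \<and> x \<notin> semigroup_gen A"
      and neg: "\<not> ((\<exists>x\<in>X. A \<inter> V x = {}) \<or> (\<exists>I\<in>Pow {..<d}. \<exists>y\<in>Y I. y \<notin> semigroup_gen A))"
    then obtain x where x: "x \<in> X" "x \<notin> semigroup_gen A" unfolding X_def by blast
    have neg1: "A \<inter> V x \<noteq> {}" using neg x(1) by blast
    have neg2: "y \<in> semigroup_gen A" if "I \<in> Pow {..<d}" "y \<in> Y I" for I y using neg that by blast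
    obtain a where a: "a \<in> A" "a \<in> V x" using neg1 by blast
    define y where "y j = x j - a j" for j
    have aJ: "real (a j) \<le> real (x j) / 2" if "j \<in> J x" for j
      using a(2) that by (auto simp: V_def vec_box_def dest!: spec[of _ j])
    have aI: "a j = x j" if "j \<notin> J x" for j
      using a(2) that by (auto simp: V_def vec_box_def dest!: spec[of _ j])
    have le: "a j \<le> x j" for j using aJ[of j] aI[of j] by (cases "j \<in> J x") auto
    have yJ: "real (x j) / 2 \<le> real (y j)" if "j \<in> J x" for j
      using aJ[OF that] le[of j] by (simp add: y_def of_nat_diff)
    have "y \<in> Y (J x)"
      unfolding Y_def
    proof (intro CollectI conjI allI impI ballI)
      have "x \<in> F" using x(1) unfolding X_def by blast
      then show "y \<in> F" by (rule FI) (simp add: y_def)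
      show "y j = 0" if "j \<notin> J x" for j using aI[OF that] by (simp add: y_def)
      show "90 * real d * real B * L \<le> real (y j)" if "j \<in> J x" for j
        using yJ[OF that] that by (simp add: J_def)
      have "(\<Prod>j\<in>J x. real (x j) / (144 * real d * real B * L)) \<le> (\<Prod>j\<in>J x. real (y j) / (72 * real d * real B * L))"
      proof (intro prod_mono conjI)
        fix j assume j: "j \<in> J x"
        have "real (x j) / (144 * real d * real B * L) = (real (x j) / 2) / (72 * real d * real B * L)" by simp
        also have "\<dots> \<le> real (y j) / (72 * real d * real B * L)"
          using yJ[OF j] L by (intro divide_right_mono) auto
        finally show "real (x j) / (144 * real d * real B * L) \<le> real (y j) / (72 * real d * real B * L)" .
      qed (use L in auto)
      then show "real B * L \<le> p * (\<Prod>j\<in>J x. real (y j) / (72 * real d * real B * L))"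
        using prodx[OF x(1)] mult_left_mono[OF _ p1(1)] order_trans by blast
    qed
    moreover have "J x \<in> Pow {..<d}" by (auto simp: J_def)
    ultimately have "y \<in> semigroup_gen A" by (rule neg2[rotated])
    then have "y + a \<in> semigroup_gen A" using semigroup_gen_incl[OF a(1)] by (rule semigroup_gen_add)
    moreover have "y + a = x"
    proof
      show "(y + a) j = x j" for j using le[of j] by (simp add: y_def)
    qed
    ultimately show False using x(2) by (simp only:)
  qed
  also have "\<dots> \<le> subset_prob p F (\<lambda>A. \<exists>x\<in>X. A \<inter> V x = {})
     + subset_prob p F (\<lambda>A. \<exists>I\<in>Pow {..<d}. \<exists>y\<in>Y I. y \<notin> semigroup_gen A)"
    using fF p1 by (rule subset_prob_disj)
  also have "\<dots> \<le> (\<Sum>x\<in>X. subset_prob p F (\<lambda>A. A \<inter> V x = {}))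
     + (\<Sum>I\<in>Pow {..<d}. \<Sum>y\<in>Y I. subset_prob p F (\<lambda>A. y \<notin> semigroup_gen A))"
    using fX fY by (intro add_mono subset_prob_bex[OF fF p1] order_trans[OF subset_prob_bex[OF fF p1] sum_mono]) auto
  also have "\<dots> \<le> (\<Sum>x\<in>X. p ^ B) + (\<Sum>I\<in>Pow {..<d}. \<Sum>y\<in>Y I. (real d + 2) * p ^ (3 * d + 2))"
  proof (intro add_mono sum_mono)
    fix x assume x: "x \<in> X"
    have fJ: "finite (J x)" by (simp add: J_def)
    have "1 * 4 \<le> (real d * real B) * (144 * L)" using dB L by (intro mult_mono) auto
    then have q: "4 \<le> 144 * real d * real B * L" by (simp add: mult_ac)
    have "(\<Prod>j\<in>J x. real (x j) / (144 * real d * real B * L)) \<le> (\<Prod>j\<in>J x. real (x j) / 4)"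
    proof (intro prod_mono conjI)
      fix j
      show "0 \<le> real (x j) / (144 * real d * real B * L)" using q by (intro divide_nonneg_nonneg) auto
      show "real (x j) / (144 * real d * real B * L) \<le> real (x j) / 4" using q by (intro divide_left_mono) auto
    qed
    also have "\<dots> \<le> real (card (V x))"
      unfolding V_def
    proof (rule card_vec_box_ge[OF fJ])
      fix j assume "j \<in> J x"
      moreover have "1 * 4 \<le> (real d * real B) * (180 * L)" using dB L by (intro mult_mono) auto
      ultimately have "4 \<le> real (x j)" by (simp add: J_def mult_ac)
      then show "real (x j) / 4 + 1 \<le> real (x j) / 2 - 0" by simp
    qed auto
    finally have "real B * L \<le> p * real (card (V x))"
      using prodx[OF x] mult_left_mono[OF _ p1(1)] order_trans by blast
    have "subset_prob p F (\<lambda>A. A \<inter> V x = {}) \<le> exp (- (p * real (card (V x))))"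
      using VF[of x] x by (intro subset_prob_avoid[OF fF p1]) (auto simp: X_def)
    also have "\<dots> \<le> exp (- (real B * L))" using \<open>real B * L \<le> p * real (card (V x))\<close> by simp
    also have "\<dots> = p ^ B" unfolding L_def by (rule exp_neg_mult_ln[OF p(1)])
    finally show "subset_prob p F (\<lambda>A. A \<inter> V x = {}) \<le> p ^ B" .
  next
    fix I y assume I: "I \<in> Pow {..<d}" and y: "y \<in> Y I"
    have "subset_prob p F (\<lambda>A. y \<notin> semigroup_gen A)
      \<le> real d * p ^ B + ((N + 1) ^ d) ^ d * (2 * (N + 1) ^ d * exp (- (real B * L) / 7))"
      unfolding F_def N_def L_def
    proof (rule subset_prob_large_not_generated[OF d _ p])
      show "1 \<le> B" using B1 by simp
      show "real (y j) \<le> 1 / p ^ 2" for j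
        using y xF(1)[of y j] N0 by (cases "y j = 0") (auto simp: Y_def N_def)
    qed (use I y L in \<open>auto simp: Y_def L_def\<close>)
    also have "exp (- (real B * L) / 7) = p ^ m"
    proof -
      have "real B = 7 * real m" by (simp add: B_def m_def)
      then have "- (real B * L) / 7 = - (real m * L)" by simp
      then show ?thesis using exp_neg_mult_ln[OF p(1), of m] by (simp only: L_def)
    qed
    also have "real d * p ^ B + ((N + 1) ^ d) ^ d * (2 * (N + 1) ^ d * p ^ m)
      \<le> real d * p ^ (3 * d + 2) + 1 / p ^ (3 * (d * d)) * (2 * (1 / p ^ (3 * d)) * p ^ m)"
    proof (intro add_mono mult_mono mult_left_mono)
      show "p ^ B \<le> p ^ (3 * d + 2)" using p1 by (intro power_decreasing) (auto simp: B_def)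
      show "((N + 1) ^ d) ^ d \<le> 1 / p ^ (3 * (d * d))" using Npow[of "d * d"] by (simp add: power_mult)
    qed (use Npow[of d] p1 N0 in auto)
    also have "1 / p ^ (3 * (d * d)) * (2 * (1 / p ^ (3 * d)) * p ^ m) = 2 * p ^ (3 * d + 2)"
    proof -
      \<comment> \<open>\<open>m\<close> pays for the bases, for the size of the cell, and for the vectors in the final union bound\<close>
      have "p ^ m = p ^ (3 * (d * d)) * p ^ (3 * d) * p ^ (3 * d + 2)"
        unfolding m_def power_add[symmetric] by (rule arg_cong[where f = "power p"]) simp
      then show ?thesis using p by simp
    qed
    finally show "subset_prob p F (\<lambda>A. y \<notin> semigroup_gen A) \<le> (real d + 2) * p ^ (3 * d + 2)"
      by (simp add: algebra_simps)
  qed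
  also have "\<dots> = real (card X) * p ^ B + (\<Sum>I\<in>Pow {..<d}. real (card (Y I)) * ((real d + 2) * p ^ (3 * d + 2)))"
    by simp
  also have "\<dots> \<le> 1 / p ^ (3 * d) * p ^ (3 * d + 2) + (\<Sum>I\<in>Pow {..<d}. 1 / p ^ (3 * d) * ((real d + 2) * p ^ (3 * d + 2)))"
  proof (intro add_mono mult_mono sum_mono mult_right_mono)
    show "real (card X) \<le> 1 / p ^ (3 * d)" using fX(2) cF by linarith
    show "real (card (Y I)) \<le> 1 / p ^ (3 * d)" for I using fY(2)[of I] cF by linarith
    show "p ^ B \<le> p ^ (3 * d + 2)" using p1 by (intro power_decreasing) (auto simp: B_def)
  qed (use p1 in auto)
  also have "\<dots> = p ^ 2 + 2 ^ d * ((real d + 2) * p ^ 2)"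
    using p by (simp add: power_add card_Pow power2_eq_square)
  also have "\<dots> \<le> 2 ^ d * p ^ 2 + 2 ^ d * ((real d + 2) * p ^ 2)"
    using mult_right_mono[of 1 "2 ^ d" "p ^ 2"] by simp
  also have "\<dots> = 2 ^ d * (real d + 3) * p ^ 2" by (simp add: algebra_simps)
  finally show ?thesis .
qed

text \<open>
  Halving a vector divides the product by at most \<open>2 ^ d\<close> because \<open>L \<ge> 1\<close> absorbs the rounding. Since a vector with entries at
  most one is not beyond \<open>Z\<close>, both halves are strictly smaller and induction applies.
\<close>

lemma generated_beyond_shell:
  fixes A :: "(nat \<Rightarrow> nat) set"
  assumes L: "1 \<le> L" and Z: "(1 + L) ^ d \<le> Z"
    and shell: "\<And>x. x \<in> nat_vecs d \<Longrightarrow> Z < (\<Prod>i<d. real (x i) + L) \<Longrightarrow>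
      (\<Prod>i<d. real (x i) + L) \<le> 2 ^ d * Z \<Longrightarrow> x \<in> semigroup_gen A"
    and x: "x \<in> nat_vecs d" "Z < (\<Prod>i<d. real (x i) + L)"
  shows "x \<in> semigroup_gen A"
  using x
proof (induction "\<Sum>i<d. x i" arbitrary: x rule: less_induct)
  case less
  show ?case
  proof (cases "(\<Prod>i<d. real (x i) + L) \<le> 2 ^ d * Z")
    case True
    then show ?thesis using less.prems shell by blast
  next
    case False
    define u v where "u i = x i div 2" and "v i = x i - x i div 2" for i
    have uv: "x = u + v" by (simp add: u_def v_def fun_eq_iff)
    have vecs: "u \<in> nat_vecs d" "v \<in> nat_vecs d"
      using less.prems(1) by (auto simp: nat_vecs_def u_def v_def)
    have half: "Z < (\<Prod>i<d. real (y i) + L)" if y: "\<And>i. real (x i) - 1 \<le> 2 * real (y i)" for y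
    proof -
      have "2 ^ d * Z < (\<Prod>i<d. real (x i) + L)" using False by simp
      also have "\<dots> \<le> (\<Prod>i<d. 2 * (real (y i) + L))"
      proof (intro prod_mono conjI)
        show "real (x i) + L \<le> 2 * (real (y i) + L)" for i using y[of i] L by (simp add: algebra_simps)
      qed (use L in auto)
      also have "\<dots> = 2 ^ d * (\<Prod>i<d. real (y i) + L)"
        by (subst prod.distrib) simp
      finally show ?thesis by simp
    qed
    have "\<exists>k<d. 2 \<le> x k"
    proof (rule ccontr)
      assume "\<not> (\<exists>k<d. 2 \<le> x k)"
      then have "x i \<le> 1" if "i < d" for i using that by (metis One_nat_def not_less_eq_eq numeral_2_eq_2)
      then have "(\<Prod>i<d. real (x i) + L) \<le> (\<Prod>i<d. 1 + L)" using L by (intro prod_mono) auto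
      then show False using less.prems(2) Z by simp
    qed
    then obtain k where k: "k < d" "2 \<le> x k" by blast
    have "(\<Sum>i<d. u i) < (\<Sum>i<d. x i)" "(\<Sum>i<d. v i) < (\<Sum>i<d. x i)"
      using k by (auto intro!: sum_strict_mono_ex1 bexI[of _ k] simp: u_def v_def)
    moreover have "Z < (\<Prod>i<d. real (u i) + L)" "Z < (\<Prod>i<d. real (v i) + L)"
      by (intro half; simp add: u_def v_def; linarith)+
    ultimately have "u \<in> semigroup_gen A" "v \<in> semigroup_gen A"
      using less.hyps vecs by blast+
    then show ?thesis unfolding uv by (rule semigroup_gen_add)
  qed
qed

section \<open>Sparsity inside the hyperbolic region\<close>

lemma sum_vec_box_prod:
  fixes f :: "nat \<Rightarrow> nat \<Rightarrow> real"
  assumes J: "finite J"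
  shows "(\<Sum>a\<in>vec_box J lo hi u. \<Prod>j\<in>J. f j (a j)) = (\<Prod>j\<in>J. \<Sum>n | lo j \<le> real n \<and> real n \<le> hi j. f j n)"
proof -
  let ?h = "\<lambda>g j. if j \<in> J then g j else u j"
  let ?P = "\<Pi>\<^sub>E j\<in>J. {n::nat. lo j \<le> real n \<and> real n \<le> hi j}"
  have inj: "inj_on ?h ?P"
    by (intro inj_onI PiE_ext) (auto simp: fun_eq_iff split: if_splits)
  have "(\<Sum>a\<in>vec_box J lo hi u. \<Prod>j\<in>J. f j (a j)) = (\<Sum>g\<in>?P. \<Prod>j\<in>J. f j (?h g j))"
    unfolding vec_box_eq_image using inj by (subst sum.reindex) auto
  also have "\<dots> = (\<Sum>g\<in>?P. \<Prod>j\<in>J. f j (g j))" by (intro sum.cong prod.cong) auto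
  also have "\<dots> = (\<Prod>j\<in>J. \<Sum>n | lo j \<le> real n \<and> real n \<le> hi j. f j n)"
    by (rule prod_sum_PiE[symmetric, OF J finite_nat_interval])
  finally show ?thesis .
qed

lemma geometric_sum_le:
  fixes u :: real
  assumes "0 \<le> u" "u < 1"
  shows "(\<Sum>m\<le>M. u ^ m) \<le> 1 / (1 - u)"
proof -
  have "(1 - u) * (\<Sum>m\<le>M. u ^ m) = 1 - u ^ Suc M" by (rule sum_gp_basic)
  also have "\<dots> \<le> 1" using assms by simp
  finally show ?thesis using assms by (simp add: field_simps)
qed

definition lin_weight :: "nat \<Rightarrow> (nat \<Rightarrow> real) \<Rightarrow> (nat \<Rightarrow> nat) \<Rightarrow> real" where
  "lin_weight d s a = (\<Sum>i<d. s i * real (a i))"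

lemma lin_weight_pos:
  assumes s: "\<And>i. i < d \<Longrightarrow> 0 < s i" and a: "a \<in> nat_vecs d" "a \<noteq> 0"
  shows "0 < lin_weight d s a"
proof -
  obtain i where "a i \<noteq> 0" using a(2) by (auto simp: fun_eq_iff)
  moreover then have "i < d" using a(1) nat_vecs_index by blast
  moreover have "0 \<le> s j * real (a j)" if "j < d" for j using s[OF that] by simp
  ultimately show ?thesis
    unfolding lin_weight_def using s by (intro sum_pos2[of _ i]) auto
qed

text \<open>
  Each generated element is a combination of the nonzero elements of \<open>A\<close> with multiplicities that are bounded in terms of
  \<open>W\<close>; the sum over all multiplicities factorizes into geometric series.
\<close>

lemma sum_exp_semigroup_gen_le:
  assumes s: "\<And>i. i < d \<Longrightarrow> 0 < s i" and A: "A \<subseteq> nat_vecs d" "finite A" and W: "finite W" "W \<subseteq> nat_vecs d"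
  shows "(\<Sum>x\<in>semigroup_gen A \<inter> W. exp (- lin_weight d s x)) \<le> (\<Prod>a\<in>A - {0}. 1 / (1 - exp (- lin_weight d s a)))"
proof -
  let ?t = "lin_weight d s"
  let ?A = "A - {0}"
  \<comment> \<open>every multiplicity in a representation of a vector in \<open>W\<close> is at most \<open>M\<close>\<close>
  define M where "M = (\<Sum>x\<in>W. \<Sum>i<d. x i)"
  define \<phi> where "\<phi> m i = (\<Sum>a\<in>?A. m a * a i)" for m :: "(nat \<Rightarrow> nat) \<Rightarrow> nat" and i :: nat
  let ?P = "\<Pi>\<^sub>E a\<in>?A. {..M}"
  have fP: "finite ?P" using A by (intro finite_PiE) auto
  have sub: "semigroup_gen A \<inter> W \<subseteq> \<phi> ` ?P"
  proof
    fix x assume x: "x \<in> semigroup_gen A \<inter> W"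
    then obtain as where as: "set as \<subseteq> A" "\<And>i. x i = sum_list (map (\<lambda>a. a i) as)"
      by (auto simp: semigroup_gen_apply)
    have xi: "x i = (\<Sum>a\<in>?A. count_list as a * a i)" for i
    proof -
      have "x i = (\<Sum>a\<in>set as. count_list as a * a i)"
        unfolding as(2) by (rule sum_list_map_eq_sum_count)
      also have "\<dots> = (\<Sum>a\<in>A. count_list as a * a i)"
        using A as by (intro sum.mono_neutral_left) (auto simp: count_list_0_iff)
      also have "\<dots> = (\<Sum>a\<in>?A. count_list as a * a i)"
        using A by (intro sum.mono_neutral_right) auto
      finally show ?thesis .
    qed
    have cM: "count_list as a \<le> M" if a: "a \<in> ?A" for a
    proof -
      obtain i where i: "a i \<noteq> 0" using a by (auto simp: fun_eq_iff)
      then have id: "i < d" using a A(1) nat_vecs_index[of a d i] by blast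
      have "count_list as a \<le> count_list as a * a i" using i by simp
      also have "\<dots> \<le> x i" unfolding xi[of i] using a A by (intro member_le_sum) auto
      also have "\<dots> \<le> (\<Sum>i<d. x i)" using id by (intro member_le_sum) auto
      also have "\<dots> \<le> M" unfolding M_def using x W by (intro member_le_sum[of x W "\<lambda>x. \<Sum>i<d. x i"]) auto
      finally show ?thesis .
    qed
    have "x = \<phi> (restrict (count_list as) ?A)"
      unfolding \<phi>_def fun_eq_iff xi by (intro allI sum.cong) auto
    moreover have "restrict (count_list as) ?A \<in> ?P" using cM by (auto simp: PiE_iff)
    ultimately show "x \<in> \<phi> ` ?P" by blast
  qed
  have "(\<Sum>x\<in>semigroup_gen A \<inter> W. exp (- ?t x)) \<le> (\<Sum>x\<in>\<phi> ` ?P. exp (- ?t x))"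
    using sub fP by (intro sum_mono2) auto
  also have "\<dots> \<le> (\<Sum>m\<in>?P. exp (- ?t (\<phi> m)))"
    using sum_image_le[OF fP, of "\<lambda>x. exp (- ?t x)" \<phi>] by simp
  also have "\<dots> = (\<Sum>m\<in>?P. \<Prod>a\<in>?A. exp (- ?t a) ^ m a)"
  proof (intro sum.cong refl)
    fix m
    have "?t (\<phi> m) = (\<Sum>i<d. \<Sum>a\<in>?A. real (m a) * (s i * real (a i)))"
      by (simp add: lin_weight_def \<phi>_def sum_distrib_left mult_ac)
    also have "\<dots> = (\<Sum>a\<in>?A. real (m a) * ?t a)"
      by (subst sum.swap) (simp add: lin_weight_def sum_distrib_left)
    finally have "exp (- ?t (\<phi> m)) = exp (\<Sum>a\<in>?A. real (m a) * (- ?t a))"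
      by (simp add: sum_negf)
    also have "\<dots> = (\<Prod>a\<in>?A. exp (- ?t a) ^ m a)"
      using A by (simp only: exp_sum[of ?A] exp_of_nat_mult finite_Diff)
    finally show "exp (- ?t (\<phi> m)) = (\<Prod>a\<in>?A. exp (- ?t a) ^ m a)" .
  qed
  also have "\<dots> = (\<Prod>a\<in>?A. \<Sum>m\<le>M. exp (- ?t a) ^ m)"
    using A by (intro prod_sum_PiE[symmetric]) auto
  also have "\<dots> \<le> (\<Prod>a\<in>?A. 1 / (1 - exp (- ?t a)))"
  proof (intro prod_mono conjI)
    fix a assume a: "a \<in> ?A"
    have "0 < ?t a" using a A by (intro lin_weight_pos s) auto
    then show "(\<Sum>m\<le>M. exp (- ?t a) ^ m) \<le> 1 / (1 - exp (- ?t a))"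
      by (intro geometric_sum_le) auto
  qed (auto intro: sum_nonneg)
  finally show ?thesis .
qed

text \<open>
  The decay factor \<open>exp (- t)\<close> makes the sum over all vectors converge, and the singularity \<open>1 / sqrt t\<close> at the origin, unlike
  the \<open>1 / t\<close> for the product without the square root, is summable.
\<close>

lemma inverse_sqrt_excess_le:
  fixes t :: real
  assumes t: "0 < t"
  shows "1 / sqrt (1 - exp (- t)) - 1 \<le> exp (- t) * (1 + 1 / sqrt t)"
proof -
  define v where "v = 1 - exp (- t)"
  have v: "0 < v" "v < 1" using t by (auto simp: v_def)
  have sv: "v \<le> sqrt v" using v by (intro real_le_rsqrt) (auto simp: power2_eq_square mult_left_le)
  have "1 / sqrt v - 1 = (1 - sqrt v) / sqrt v" using v by (simp add: field_simps)
  also have "\<dots> \<le> (1 - v) / sqrt v" using v sv by (intro divide_right_mono) auto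
  also have "\<dots> = exp (- t) * (1 / sqrt v)" by (simp add: v_def)
  also have "\<dots> \<le> exp (- t) * (1 + 1 / sqrt t)"
  proof (intro mult_left_mono)
    have "(1 + t) * exp (- t) \<le> exp t * exp (- t)" by (intro mult_right_mono) auto
    then have "t \<le> v * (1 + t)" by (simp add: v_def exp_minus algebra_simps)
    then have "1 / v \<le> (1 + t) / t" using v t by (simp add: field_simps)
    also have "\<dots> \<le> (1 + 1 / sqrt t)\<^sup>2" using t by (simp add: power2_eq_square field_simps)
    finally have "sqrt (1 / v) \<le> 1 + 1 / sqrt t" using t by (intro real_le_lsqrt) auto
    then show "1 / sqrt v \<le> 1 + 1 / sqrt t" by (simp add: real_sqrt_divide)
  qed auto
  finally show ?thesis by (simp add: v_def)
qed

lemma sum_exp_neg_le: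
  fixes s :: real
  assumes s: "0 < s" "s \<le> 1" and N: "finite N"
  shows "(\<Sum>n\<in>N. exp (- (s * real n))) \<le> 2 / s"
proof -
  obtain M where M: "N \<subseteq> {..M}" using N finite_nat_iff_bounded_le by auto
  have "(\<Sum>n\<in>N. exp (- (s * real n))) \<le> (\<Sum>n\<le>M. exp (- (s * real n)))"
    using M by (intro sum_mono2) auto
  also have "\<dots> = (\<Sum>n\<le>M. exp (- s) ^ n)"
    by (intro sum.cong) (auto simp: exp_of_nat_mult[symmetric] mult.commute)
  also have "\<dots> \<le> 1 / (1 - exp (- s))" using s by (intro geometric_sum_le) auto
  also have "\<dots> \<le> 2 / s"
  proof -
    have "(1 + s) * exp (- s) \<le> exp s * exp (- s)" by (intro mult_right_mono) auto
    then have "(1 + s) * exp (- s) \<le> 1" by (simp add: exp_minus)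
    then have "s \<le> (1 + s) * (1 - exp (- s))" by (simp add: algebra_simps)
    also have "\<dots> \<le> 2 * (1 - exp (- s))" using s by (intro mult_right_mono) auto
    finally show ?thesis using s by (simp add: field_simps)
  qed
  finally show ?thesis .
qed

lemma sum_inverse_sqrt_le: "(\<Sum>n=1..m. 1 / sqrt (real n)) \<le> 2 * sqrt (real m)"
proof (induction m)
  case (Suc m)
  let ?a = "sqrt (real m)" and ?b = "sqrt (real (Suc m))"
  have ab: "0 \<le> ?a" "?a \<le> ?b" "0 < ?b" "?b * ?b = real m + 1" "?a * ?a = real m" by auto
  have "(?b - ?a) * (2 * ?b) \<ge> 1"
  proof -
    have "1 = (?b - ?a) * (?b + ?a)" using ab by (simp add: algebra_simps)
    also have "\<dots> \<le> (?b - ?a) * (2 * ?b)" using ab by (intro mult_left_mono) auto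
    finally show ?thesis .
  qed
  then have "1 / ?b \<le> 2 * (?b - ?a)" using ab by (simp add: field_simps)
  then show ?case using Suc by simp
qed simp

text \<open>
  Up to \<open>1 / s\<close> the exponential is bounded by one, and beyond it the square root is at least one. The term \<open>n = 0\<close> vanishes
  as division by zero gives zero.
\<close>

lemma sum_exp_neg_div_sqrt_le:
  fixes s :: real
  assumes s: "0 < s" "s \<le> 1" and N: "finite N"
  shows "(\<Sum>n\<in>N. exp (- (s * real n)) / sqrt (s * real n)) \<le> 4 / s"
proof -
  define m where "m = nat \<lfloor>1 / s\<rfloor>"
  let ?g = "\<lambda>n. exp (- (s * real n)) / sqrt (s * real n)"
  have ms: "real m \<le> 1 / s" using s by (simp add: m_def)
  have "(\<Sum>n\<in>N. ?g n) \<le> (\<Sum>n\<in>N. (if n \<in> {1..m} then 1 / sqrt (s * real n) else 0) + exp (- (s * real n)))"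
  proof (intro sum_mono)
    fix n
    show "?g n \<le> (if n \<in> {1..m} then 1 / sqrt (s * real n) else 0) + exp (- (s * real n))"
    proof (cases "n \<in> {1..m}")
      case True
      have "?g n \<le> 1 / sqrt (s * real n)" using s by (intro divide_right_mono) auto
      then show ?thesis using True by (simp add: add_increasing2)
    next
      case False
      then consider "n = 0" | "m < n" by fastforce
      then show ?thesis
      proof cases
        case 2
        then have "1 / s < real n" unfolding m_def using s by linarith
        then have "1 < s * real n" using s by (simp add: field_simps)
        then have "exp (- (s * real n)) / sqrt (s * real n) \<le> exp (- (s * real n)) / 1"
          by (intro divide_left_mono) auto
        then show ?thesis unfolding if_not_P[OF False] by simp
      qed simp
    qed
  qed
  also have "\<dots> = (\<Sum>n\<in>N \<inter> {1..m}. 1 / sqrt (s * real n)) + (\<Sum>n\<in>N. exp (- (s * real n)))"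
    using N by (simp add: sum.distrib sum.inter_restrict)
  also have "\<dots> \<le> (\<Sum>n=1..m. 1 / sqrt (s * real n)) + 2 / s"
    using s N by (intro add_mono sum_exp_neg_le sum_mono2) auto
  also have "(\<Sum>n=1..m. 1 / sqrt (s * real n)) = 1 / sqrt s * (\<Sum>n=1..m. 1 / sqrt (real n))"
    by (simp add: sum_distrib_left real_sqrt_mult)
  also have "\<dots> \<le> 1 / sqrt s * (2 * sqrt (1 / s))"
  proof (intro mult_left_mono)
    have "sqrt (real m) \<le> sqrt (1 / s)" using ms by (rule real_sqrt_le_mono)
    then show "(\<Sum>n=1..m. 1 / sqrt (real n)) \<le> 2 * sqrt (1 / s)" using sum_inverse_sqrt_le[of m] by linarith
  qed (use s in auto)
  also have "\<dots> = 2 / s" using s by (simp add: real_sqrt_divide)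
  finally show ?thesis by simp
qed

text \<open>
  For \<open>a \<noteq> 0\<close> some term \<open>s i * a i\<close> of the linear weight is positive, so \<open>1 / sqrt\<close> of the weight is at most the sum of the
  \<open>1 / sqrt (s i * a i)\<close> over \<open>i\<close>, where coordinates with \<open>a i = 0\<close> contribute zero. After this step all
  sums factorize over the coordinates.
\<close>

lemma sum_inverse_sqrt_excess_le:
  assumes s: "\<And>i. i < d \<Longrightarrow> 0 < s i" "\<And>i. i < d \<Longrightarrow> s i \<le> 1"
  shows "(\<Sum>a\<in>corner_box {..<d} hi - {0}. 1 / sqrt (1 - exp (- lin_weight d s a)) - 1)
     \<le> (1 + 2 * real d) * (\<Prod>i<d. 2 / s i)"
proof -
  let ?W = "corner_box {..<d} hi"
  let ?t = "lin_weight d s"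
  let ?N = "\<lambda>j. {n::nat. 0 \<le> real n \<and> real n \<le> hi j}"
  have fW: "finite ?W" by (rule finite_vec_box) simp
  have fN: "finite (?N j)" for j
    by (rule finite_nat_interval)
  have s0: "0 \<le> s i" if "i < d" for i using s(1)[OF that] by simp
  have Wv: "?W \<subseteq> nat_vecs d" by (rule vec_box_subset_nat_vecs)
  have e: "exp (- ?t a) = (\<Prod>j<d. exp (- (s j * real (a j))))" for a
    by (simp only: lin_weight_def exp_sum[symmetric] sum_negf finite_lessThan)
  have "(\<Sum>a\<in>?W - {0}. 1 / sqrt (1 - exp (- ?t a)) - 1)
      \<le> (\<Sum>a\<in>?W - {0}. exp (- ?t a) + (\<Sum>i<d. exp (- ?t a) / sqrt (s i * real (a i))))"
  proof (intro sum_mono)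
    fix a assume a: "a \<in> ?W - {0}"
    have t: "0 < ?t a" using a Wv by (intro lin_weight_pos s) auto
    obtain i where i: "a i \<noteq> 0" using a by (auto simp: fun_eq_iff)
    then have id: "i < d" using a Wv nat_vecs_index[of a d i] by blast
    have si: "0 < s i * real (a i)" using i s(1)[OF id] by simp
    have "s i * real (a i) \<le> ?t a"
      unfolding lin_weight_def using id s0
      by (intro member_le_sum[of i "{..<d}" "\<lambda>i. s i * real (a i)"]) auto
    then have "1 / sqrt (?t a) \<le> 1 / sqrt (s i * real (a i))"
      using si by (intro divide_left_mono) auto
    also have "\<dots> \<le> (\<Sum>i<d. 1 / sqrt (s i * real (a i)))"
      using id s0 by (intro member_le_sum[of i "{..<d}" "\<lambda>i. 1 / sqrt (s i * real (a i))"]) auto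
    finally have "1 / sqrt (?t a) \<le> (\<Sum>i<d. 1 / sqrt (s i * real (a i)))" .
    then have "exp (- ?t a) * (1 + 1 / sqrt (?t a)) \<le> exp (- ?t a) * (1 + (\<Sum>i<d. 1 / sqrt (s i * real (a i))))"
      by (intro mult_left_mono add_left_mono) auto
    also have "\<dots> = exp (- ?t a) + (\<Sum>i<d. exp (- ?t a) / sqrt (s i * real (a i)))"
      by (simp only: distrib_left mult_1_right sum_distrib_left times_divide_eq_right)
    finally show "1 / sqrt (1 - exp (- ?t a)) - 1 \<le> exp (- ?t a) + (\<Sum>i<d. exp (- ?t a) / sqrt (s i * real (a i)))"
      using inverse_sqrt_excess_le[OF t] by (rule order_trans[rotated])
  qed
  also have "\<dots> \<le> (\<Sum>a\<in>?W. exp (- ?t a) + (\<Sum>i<d. exp (- ?t a) / sqrt (s i * real (a i))))"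
    using fW s0 by (intro sum_mono2 add_nonneg_nonneg sum_nonneg divide_nonneg_nonneg) auto
  also have "\<dots> = (\<Sum>a\<in>?W. exp (- ?t a)) + (\<Sum>i<d. \<Sum>a\<in>?W. exp (- ?t a) / sqrt (s i * real (a i)))"
    unfolding sum.distrib by (subst sum.swap) simp
  also have "\<dots> \<le> (\<Prod>j<d. 2 / s j) + (\<Sum>i<d. 2 * (\<Prod>j<d. 2 / s j))"
  proof (intro add_mono sum_mono)
    have "(\<Sum>a\<in>?W. exp (- ?t a)) = (\<Prod>j<d. \<Sum>n\<in>?N j. exp (- (s j * real n)))"
      unfolding e by (rule sum_vec_box_prod) simp
    also have "\<dots> \<le> (\<Prod>j<d. 2 / s j)"
      using s fN by (intro prod_mono conjI sum_nonneg sum_exp_neg_le) auto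
    finally show "(\<Sum>a\<in>?W. exp (- ?t a)) \<le> (\<Prod>j<d. 2 / s j)" .
  next
    fix i assume i: "i \<in> {..<d}"
    let ?f = "\<lambda>j n. exp (- (s j * real n)) / (if j = i then sqrt (s j * real n) else 1)"
    have "exp (- ?t a) / sqrt (s i * real (a i)) = (\<Prod>j<d. ?f j (a j))" for a
    proof -
      have "(\<Prod>j<d. ?f j (a j)) = (\<Prod>j<d. exp (- (s j * real (a j)))) / (\<Prod>j<d. if j = i then sqrt (s j * real (a j)) else 1)"
        by (rule prod_dividef)
      also have "(\<Prod>j<d. if j = i then sqrt (s j * real (a j)) else 1) = sqrt (s i * real (a i))"
        using i by simp
      finally show ?thesis by (simp add: e)
    qed
    then have "(\<Sum>a\<in>?W. exp (- ?t a) / sqrt (s i * real (a i))) = (\<Sum>a\<in>?W. \<Prod>j<d. ?f j (a j))"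
      by simp
    also have "\<dots> = (\<Prod>j<d. \<Sum>n\<in>?N j. ?f j n)" by (rule sum_vec_box_prod) simp
    also have "\<dots> \<le> (\<Prod>j<d. (if j = i then 2 else 1) * (2 / s j))"
    proof (intro prod_mono conjI)
      fix j assume j: "j \<in> {..<d}"
      show "0 \<le> (\<Sum>n\<in>?N j. ?f j n)"
        using s0[of j] j by (intro sum_nonneg divide_nonneg_nonneg) auto
      show "(\<Sum>n\<in>?N j. ?f j n) \<le> (if j = i then 2 else 1) * (2 / s j)"
        using sum_exp_neg_div_sqrt_le[of "s j" "?N j"] sum_exp_neg_le[of "s j" "?N j"] s[of j] j fN[of j] by auto
    qed
    also have "\<dots> = 2 * (\<Prod>j<d. 2 / s j)"
      using i by (subst prod.distrib) simp
    finally show "(\<Sum>a\<in>?W. exp (- ?t a) / sqrt (s i * real (a i))) \<le> 2 * (\<Prod>j<d. 2 / s j)" .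
  qed
  also have "\<dots> = (1 + 2 * real d) * (\<Prod>j<d. 2 / s j)" by (simp add: algebra_simps)
  finally show ?thesis .
qed

text \<open>
  Markov's inequality for the square root of the product that bounds the number of generated elements. Half of the
  exponent \<open>L / 2\<close> is spent on the factor \<open>exp (L / 4)\<close>, the square root halves the rest, and the expectation
  costs at most \<open>exp (L / 16)\<close>.
\<close>

lemma subset_prob_box_dense:
  fixes d :: nat and k :: "nat \<Rightarrow> nat" and p C :: real
  defines "L \<equiv> ln (1 / p)"
  defines "W \<equiv> corner_box {..<d} (\<lambda>i. 2 ^ k i * L)"
  assumes d: "d \<ge> 1" and p: "0 < p" "p \<le> 1" and L: "L \<ge> 1"
    and C: "16 * (1 + 2 * real d) * (16 * real d) ^ d \<le> C"
    and k: "(\<Prod>i<d. 2 ^ k i * L) \<le> 2 ^ d * (1 / C * (1 / p) * L ^ (d + 1))"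
  shows "subset_prob p W (\<lambda>A. exp (L / 2) < real (card (semigroup_gen A \<inter> W))) \<le> exp (- L / 16)"
proof -
  have d1: "1 \<le> real d" using d by simp
  have p1: "0 \<le> p" "p \<le> 1" using p by auto
  have "0 < 16 * (1 + 2 * real d) * (16 * real d) ^ d" using d1 by (intro mult_pos_pos zero_less_power) auto
  then have C0: "0 < C" using C by linarith
  define s where "s i = 1 / (4 * real d * 2 ^ k i)" for i
  let ?t = "lin_weight d s"
  have s: "0 < s i" "s i \<le> 1" for i
  proof -
    have "1 * 1 \<le> 4 * real d * 2 ^ k i" using d1 by (intro mult_mono) auto
    then show "0 < s i" "s i \<le> 1" by (auto simp: s_def)
  qed
  have fW: "finite W" unfolding W_def by (rule finite_vec_box) simp
  have Wv: "W \<subseteq> nat_vecs d" unfolding W_def by (rule vec_box_subset_nat_vecs)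
  have tW: "?t x \<le> L / 4" if x: "x \<in> W" for x
  proof -
    have "?t x \<le> (\<Sum>i<d. L / (4 * real d))"
      unfolding lin_weight_def
    proof (intro sum_mono)
      fix i assume i: "i \<in> {..<d}"
      have "real (x i) \<le> 2 ^ k i * L" using x i by (auto simp: W_def vec_box_def dest!: spec[of _ i])
      then have "s i * real (x i) \<le> s i * (2 ^ k i * L)" using s(1)[of i] by (intro mult_left_mono) auto
      then show "s i * real (x i) \<le> L / (4 * real d)" by (simp add: s_def)
    qed
    then show ?thesis using d1 by simp
  qed
  define g where "g a = (if a = 0 then 1 else 1 / sqrt (1 - exp (- ?t a)))" for a
  have tpos: "0 < ?t a" if "a \<in> W" "a \<noteq> 0" for a
    using that Wv s(1) by (intro lin_weight_pos) auto
  have g0: "0 \<le> g a" if "a \<in> W" for a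
    using tpos[OF that] by (auto simp: g_def)
  have big: "exp (L / 8) \<le> (\<Prod>a\<in>A. g a)" if A: "A \<subseteq> W" "exp (L / 2) < real (card (semigroup_gen A \<inter> W))" for A
  proof -
    have fA: "finite A" using A(1) fW by (rule finite_subset)
    have "exp (- L / 4) * real (card (semigroup_gen A \<inter> W)) = (\<Sum>x\<in>semigroup_gen A \<inter> W. exp (- L / 4))"
      by simp
    also have "\<dots> \<le> (\<Sum>x\<in>semigroup_gen A \<inter> W. exp (- ?t x))"
    proof (intro sum_mono)
      fix x assume "x \<in> semigroup_gen A \<inter> W"
      then show "exp (- L / 4) \<le> exp (- ?t x)" using tW[of x] by simp
    qed
    also have "\<dots> \<le> (\<Prod>a\<in>A - {0}. 1 / (1 - exp (- ?t a)))"
      using s(1) A(1) Wv fA fW by (intro sum_exp_semigroup_gen_le) auto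
    also have "\<dots> = (\<Prod>a\<in>A - {0}. (g a)\<^sup>2)"
    proof (intro prod.cong refl)
      fix a assume a: "a \<in> A - {0}"
      then have "0 < ?t a" using tpos A(1) by auto
      then show "1 / (1 - exp (- ?t a)) = (g a)\<^sup>2" using a by (simp add: g_def power_divide)
    qed
    also have "\<dots> = (\<Prod>a\<in>A. (g a)\<^sup>2)"
      using fA by (intro prod.mono_neutral_left) (auto simp: g_def)
    finally have 1: "exp (- L / 4) * real (card (semigroup_gen A \<inter> W)) \<le> (\<Prod>a\<in>A. g a)\<^sup>2"
      by (simp add: prod_power_distrib)
    have "(exp (L / 8))\<^sup>2 = exp (- L / 4) * exp (L / 2)"
      by (simp add: exp_add[symmetric] exp_double[symmetric] power2_eq_square)
    also have "\<dots> \<le> exp (- L / 4) * real (card (semigroup_gen A \<inter> W))" using A(2) by (intro mult_left_mono) auto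
    also note 1
    finally show ?thesis
      using A(1) g0 by (intro power2_le_imp_le[of "exp (L / 8)"] prod_nonneg) auto
  qed
  have "subset_prob p W (\<lambda>A. exp (L / 2) < real (card (semigroup_gen A \<inter> W)))
    \<le> (\<Sum>A\<in>Pow W. subset_weight p W A * (exp (- L / 8) * (\<Prod>a\<in>A. g a)))"
  proof (rule subset_prob_le_expectation[OF fW p1])
    fix A assume A: "A \<subseteq> W"
    show "0 \<le> exp (- L / 8) * (\<Prod>a\<in>A. g a)" using g0 A by (intro mult_nonneg_nonneg prod_nonneg) auto
    assume "exp (L / 2) < real (card (semigroup_gen A \<inter> W))"
    then have "exp (- L / 8) * exp (L / 8) \<le> exp (- L / 8) * (\<Prod>a\<in>A. g a)"
      using big[OF A] by (intro mult_left_mono) auto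
    then show "1 \<le> exp (- L / 8) * (\<Prod>a\<in>A. g a)" by (simp add: exp_add[symmetric])
  qed
  also have "\<dots> = exp (- L / 8) * (\<Prod>a\<in>W. 1 - p + p * g a)"
    unfolding sum_subset_weight_prod[OF fW, symmetric] by (simp add: sum_distrib_left mult_ac)
  also have "\<dots> \<le> exp (- L / 8) * exp (\<Sum>a\<in>W. p * (g a - 1))"
  proof (intro mult_left_mono)
    have "(\<Prod>a\<in>W. 1 - p + p * g a) \<le> (\<Prod>a\<in>W. exp (p * (g a - 1)))"
    proof (intro prod_mono conjI)
      fix a assume a: "a \<in> W"
      show "0 \<le> 1 - p + p * g a" using p g0[OF a] by simp
      show "1 - p + p * g a \<le> exp (p * (g a - 1))"
        using exp_ge_add_one_self[of "p * (g a - 1)"] by (simp add: algebra_simps)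
    qed
    then show "(\<Prod>a\<in>W. 1 - p + p * g a) \<le> exp (\<Sum>a\<in>W. p * (g a - 1))" using fW by (simp add: exp_sum)
  qed auto
  also have "\<dots> \<le> exp (- L / 8) * exp (L / 16)"
  proof -
    have "(\<Sum>a\<in>W. p * (g a - 1)) = p * (\<Sum>a\<in>W. g a - 1)" by (simp add: sum_distrib_left)
    also have "(\<Sum>a\<in>W. g a - 1) = (\<Sum>a\<in>W - {0}. g a - 1)"
      using fW by (intro sum.mono_neutral_right) (auto simp: g_def)
    also have "\<dots> = (\<Sum>a\<in>W - {0}. 1 / sqrt (1 - exp (- ?t a)) - 1)" by (intro sum.cong) (auto simp: g_def)
    also have "\<dots> \<le> (1 + 2 * real d) * (\<Prod>i<d. 2 / s i)"
      unfolding W_def using s by (intro sum_inverse_sqrt_excess_le)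
    also have "(\<Prod>i<d. 2 / s i) = (8 * real d) ^ d * (\<Prod>i<d. 2 ^ k i)"
    proof -
      have "2 / s i = (8 * real d) * 2 ^ k i" for i by (simp add: s_def)
      then show ?thesis by (simp only: prod.distrib prod_constant card_lessThan power_mult_distrib)
    qed
    also have "(\<Prod>i<d. 2 ^ k i) \<le> 2 ^ d * (L / (C * p))"
    proof -
      have "(\<Prod>i<d. 2 ^ k i) * L ^ d \<le> 2 ^ d * (L / (C * p)) * L ^ d"
        using k C0 p by (simp add: prod.distrib field_simps)
      moreover have "0 < L ^ d" using L by simp
      ultimately show ?thesis by (simp only: mult_le_cancel_right_pos)
    qed
    also have "p * ((1 + 2 * real d) * ((8 * real d) ^ d * (2 ^ d * (L / (C * p)))))
        = ((1 + 2 * real d) * (16 * real d) ^ d) * L / C"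
    proof -
      have "(16 * real d) ^ d = (8 * real d) ^ d * 2 ^ d" unfolding power_mult_distrib[symmetric] by simp
      then show ?thesis using p C0 by (simp only:) simp
    qed
    also have "\<dots> \<le> L / 16"
    proof -
      have "16 * (1 + 2 * real d) * (16 * real d) ^ d * L \<le> C * L" using C L by (intro mult_right_mono) auto
      then show ?thesis using C0 by (simp add: field_simps)
    qed
    finally show ?thesis using p d1 by (simp add: mult_left_mono)
  qed
  also have "\<dots> = exp (- L / 16)" by (simp add: exp_add[symmetric])
  finally show ?thesis .
qed

lemma factor_le_prod:
  fixes f :: "'i \<Rightarrow> real"
  assumes "finite I" "i \<in> I" "\<And>j. j \<in> I \<Longrightarrow> 1 \<le> f j"
  shows "f i \<le> (\<Prod>j\<in>I. f j)"
proof -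
  have "(\<Prod>j\<in>{i}. f j) \<le> (\<Prod>j\<in>I. f j)"
    using assms by (intro prod_mono2) (auto intro: order_trans[OF zero_le_one])
  then show ?thesis by simp
qed

text \<open>
  Each vector of the region lies in a dyadic box whose sides are at most twice its shifted coordinates, so the product of the sides
  is at most \<open>2 ^ d * Z\<close>. The exponents are at most \<open>8 * L\<close>, which bounds the number of boxes.
\<close>

lemma subset_prob_region_dense:
  fixes d :: nat and p C N :: real
  defines "L \<equiv> ln (1 / p)"
  defines "Z \<equiv> 1 / C * (1 / p) * L ^ (d + 1)" and "F \<equiv> corner_box {..<d} (\<lambda>_. N)"
  assumes d: "d \<ge> 1" and p: "0 < p" "p \<le> 1" and L: "L \<ge> 1"
    and C: "16 * (1 + 2 * real d) * (16 * real d) ^ d \<le> C"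
    and N: "2 ^ d * Z \<le> N" and Z: "2 * Z \<le> exp (4 * L)"
  shows "subset_prob p F (\<lambda>A. (8 * L + 1) ^ d * exp (L / 2) < real (card (semigroup_gen A \<inter> hyp_region d p Z)))
    \<le> (8 * L + 1) ^ d * exp (- L / 16)"
proof -
  have p1: "0 \<le> p" "p \<le> 1" using p by auto
  have fF: "finite F" unfolding F_def by (rule finite_vec_box) simp
  define W where "W k = corner_box {..<d} (\<lambda>i. 2 ^ k i * L)" for k :: "nat \<Rightarrow> nat"
  define K where "K = {k \<in> {..<d} \<rightarrow>\<^sub>E {..nat \<lfloor>8 * L\<rfloor>}. (\<Prod>i<d. 2 ^ k i * L) \<le> 2 ^ d * Z}"
  have fP: "finite ({..<d} \<rightarrow>\<^sub>E {..nat \<lfloor>8 * L\<rfloor>})" by (intro finite_PiE) auto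
  have fK: "finite K" unfolding K_def using fP by simp
  have cK: "real (card K) \<le> (8 * L + 1) ^ d"
  proof -
    have "card K \<le> card ({..<d} \<rightarrow>\<^sub>E {..nat \<lfloor>8 * L\<rfloor>})" unfolding K_def using fP by (intro card_mono) auto
    also have "\<dots> = (nat \<lfloor>8 * L\<rfloor> + 1) ^ d" by (simp add: card_PiE)
    finally have "real (card K) \<le> real ((nat \<lfloor>8 * L\<rfloor> + 1) ^ d)" by (rule of_nat_mono)
    also have "\<dots> = (real (nat \<lfloor>8 * L\<rfloor>) + 1) ^ d" by (simp add: add.commute)
    also have "\<dots> \<le> (8 * L + 1) ^ d" using L by (intro power_mono add_right_mono) auto
    finally show ?thesis .
  qed
  have one_le: "1 \<le> (2::real) ^ n * L" for n using L mult_mono[of 1 "2 ^ n" 1 L] by simp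
  have WF: "W k \<subseteq> F" if "k \<in> K" for k
  proof
    fix a assume a: "a \<in> W k"
    have "if j \<in> {..<d} then 0 \<le> real (a j) \<and> real (a j) \<le> N else a j = 0" for j
    proof (cases "j < d")
      case True
      have "real (a j) \<le> 2 ^ k j * L" using a True by (auto simp: W_def vec_box_def dest!: spec[of _ j])
      also have "\<dots> \<le> (\<Prod>i<d. 2 ^ k i * L)" using True one_le by (intro factor_le_prod) auto
      also have "\<dots> \<le> N" using that N by (simp add: K_def)
      finally show ?thesis using True by simp
    next
      case False
      then show ?thesis using a by (auto simp: W_def vec_box_def dest!: spec[of _ j])
    qed
    then show "a \<in> F" by (simp add: F_def vec_box_def)
  qed
  have cover: "hyp_region d p Z \<subseteq> (\<Union>k\<in>K. W k)"
  proof
    fix x assume x: "x \<in> hyp_region d p Z"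
    then have xv: "x \<in> nat_vecs d" and xZ: "(\<Prod>i<d. real (x i) + L) \<le> Z"
      by (simp_all add: hyp_region_def L_def)
    \<comment> \<open>minimality of \<open>k i\<close> bounds the side of the box by twice the shifted coordinate\<close>
    define k where "k i = (LEAST n. real (x i) \<le> 2 ^ n * L)" for i
    have ex: "\<exists>n. real (x i) \<le> 2 ^ n * L" for i
    proof -
      have "real (x i) \<le> 2 ^ x i" by (simp add: less_imp_le of_nat_less_two_power)
      also have "\<dots> \<le> 2 ^ x i * L" using L by simp
      finally show ?thesis by blast
    qed
    have k1: "real (x i) \<le> 2 ^ k i * L" for i unfolding k_def using ex by (rule LeastI_ex)
    have k2: "2 ^ k i * L \<le> 2 * (real (x i) + L)" for i
    proof (cases "k i")
      case 0
      then show ?thesis using L by simp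
    next
      case (Suc n)
      then have "\<not> real (x i) \<le> 2 ^ n * L" unfolding k_def by (intro not_less_Least) simp
      then show ?thesis using Suc L by simp
    qed
    have k3: "(\<Prod>i<d. 2 ^ k i * L) \<le> 2 ^ d * Z"
    proof -
      have "(\<Prod>i<d. 2 ^ k i * L) \<le> (\<Prod>i<d. 2 * (real (x i) + L))"
        using k2 L by (intro prod_mono conjI) auto
      also have "\<dots> = 2 ^ d * (\<Prod>i<d. real (x i) + L)" by (subst prod.distrib) simp
      also have "\<dots> \<le> 2 ^ d * Z" using xZ by simp
      finally show ?thesis .
    qed
    have k4: "k i \<le> nat \<lfloor>8 * L\<rfloor>" if i: "i < d" for i
    proof -
      have "2 ^ k i \<le> 2 ^ k i * L" using L by simp
      also have "\<dots> \<le> 2 * (real (x i) + L)" by (rule k2)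
      also have "real (x i) + L \<le> (\<Prod>i<d. real (x i) + L)"
        using i L by (intro factor_le_prod[of "{..<d}" i "\<lambda>i. real (x i) + L"]) auto
      finally have "2 ^ k i \<le> exp (4 * L)" using xZ Z by linarith
      then have "ln (2 ^ k i) \<le> ln (exp (4 * L))" by (subst ln_le_cancel_iff) auto
      then have "real (k i) * ln 2 \<le> 4 * L" by (simp add: ln_realpow)
      moreover have "real (k i) * (1 / 2) \<le> real (k i) * ln 2"
        using ln2_ge_two_thirds by (intro mult_left_mono) auto
      ultimately have "real (k i) \<le> 8 * L" by linarith
      then show ?thesis by (simp add: le_nat_floor)
    qed
    have "restrict k {..<d} \<in> K"
      unfolding K_def using k3 k4 by (auto simp: PiE_iff)
    moreover have "x \<in> W (restrict k {..<d})"
      using k1 xv by (auto simp: W_def vec_box_def nat_vecs_def)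
    ultimately show "x \<in> (\<Union>k\<in>K. W k)" by blast
  qed
  let ?D = "\<lambda>k A. exp (L / 2) < real (card (semigroup_gen (A \<inter> W k) \<inter> W k))"
  have loc: "semigroup_gen A \<inter> W k = semigroup_gen (A \<inter> W k) \<inter> W k" if A: "A \<subseteq> F" for A k
  proof -
    have "x \<in> semigroup_gen A \<longleftrightarrow> x \<in> semigroup_gen (A \<inter> W k)" if x: "x \<in> W k" for x
    proof (rule semigroup_gen_local)
      fix a assume a: "\<And>i. a i \<le> x i" "a \<in> A"
      have "if j \<in> {..<d} then 0 \<le> real (a j) \<and> real (a j) \<le> 2 ^ k j * L else a j = 0" for j
        using x a(1)[of j] by (auto simp: W_def vec_box_def dest!: spec[of _ j])
      then show "a \<in> W k" by (simp add: W_def vec_box_def)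
    qed
    then show ?thesis by blast
  qed
  have "subset_prob p F (\<lambda>A. (8 * L + 1) ^ d * exp (L / 2) < real (card (semigroup_gen A \<inter> hyp_region d p Z)))
     \<le> subset_prob p F (\<lambda>A. \<exists>k\<in>K. ?D k A)"
  proof (rule subset_prob_mono[OF fF p1], rule ccontr)
    fix A assume A: "A \<subseteq> F" "(8 * L + 1) ^ d * exp (L / 2) < real (card (semigroup_gen A \<inter> hyp_region d p Z))"
      and neg: "\<not> (\<exists>k\<in>K. ?D k A)"
    have fin: "finite (semigroup_gen A \<inter> W k)" for k
      unfolding W_def using finite_vec_box[of "{..<d}"] by auto
    have "card (semigroup_gen A \<inter> hyp_region d p Z) \<le> card (\<Union>k\<in>K. semigroup_gen A \<inter> W k)"
    proof (rule card_mono)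
      show "finite (\<Union>k\<in>K. semigroup_gen A \<inter> W k)" using fK fin by (intro finite_UN_I)
    qed (use cover in blast)
    also have "\<dots> \<le> (\<Sum>k\<in>K. card (semigroup_gen A \<inter> W k))" by (rule card_UN_le[OF fK])
    finally have "real (card (semigroup_gen A \<inter> hyp_region d p Z)) \<le> (\<Sum>k\<in>K. real (card (semigroup_gen A \<inter> W k)))"
      by (metis of_nat_mono of_nat_sum)
    also have "\<dots> \<le> (\<Sum>k\<in>K. exp (L / 2))"
    proof (intro sum_mono)
      fix k assume "k \<in> K"
      then show "real (card (semigroup_gen A \<inter> W k)) \<le> exp (L / 2)"
        unfolding loc[OF A(1)] using neg by (meson not_less)
    qed
    also have "\<dots> \<le> (8 * L + 1) ^ d * exp (L / 2)" using cK by (simp add: mult_right_mono)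
    finally show False using A(2) by simp
  qed
  also have "\<dots> \<le> (\<Sum>k\<in>K. subset_prob p F (?D k))" by (rule subset_prob_bex[OF fF p1 fK])
  also have "\<dots> \<le> (\<Sum>k\<in>K. exp (- L / 16))"
  proof (intro sum_mono)
    fix k assume k: "k \<in> K"
    have "subset_prob p F (?D k) = subset_prob p (W k) (\<lambda>A. exp (L / 2) < real (card (semigroup_gen A \<inter> W k)))"
      by (rule subset_prob_restrict[OF fF p1 WF[OF k]])
    also have "\<dots> \<le> exp (- L / 16)"
      unfolding W_def L_def
      by (rule subset_prob_box_dense[OF d p _ C]) (use k L in \<open>auto simp: K_def Z_def L_def\<close>)
    finally show "subset_prob p F (?D k) \<le> exp (- L / 16)" .
  qed
  also have "\<dots> \<le> (8 * L + 1) ^ d * exp (- L / 16)" using cK by (simp add: mult_right_mono)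
  finally show ?thesis .
qed

section \<open>The size of a hyperbolic region\<close>

text \<open>
  The first \<open>e\<close> coordinates form the vector \<open>g\<close>; the last one is counted for each \<open>g\<close> separately.
\<close>

lemma card_region_slices:
  fixes p Z :: real
  defines "L \<equiv> ln (1 / p)"
  assumes G: "finite G" "G \<subseteq> {..<e} \<rightarrow>\<^sub>E UNIV" and L: "1 \<le> L"
  shows "card {x \<in> hyp_region (Suc e) p Z. restrict x {..<e} \<in> G}
     = (\<Sum>g\<in>G. card {n::nat. (\<Prod>i<e. real (g i) + L) * (real n + L) \<le> Z})"
proof -
  let ?P = "\<lambda>g. \<Prod>i<e. real (g i) + L"
  let ?N = "\<lambda>g. {n::nat. ?P g * (real n + L) \<le> Z}"
  let ?h = "\<lambda>(g, n) i. if i < e then g i else if i = e then n else (0::nat)"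
  have P1: "1 \<le> ?P g" for g :: "nat \<Rightarrow> nat" using L by (intro prod_ge_1) auto
  have fN: "finite (?N g)" for g
  proof (rule finite_subset)
    show "?N g \<subseteq> {..nat \<lfloor>Z\<rfloor>}"
    proof
      fix n assume "n \<in> ?N g"
      then have "?P g * (real n + L) \<le> Z" by simp
      moreover have "1 * (real n + L) \<le> ?P g * (real n + L)" using P1 L by (intro mult_right_mono) auto
      ultimately have "real n + L \<le> Z" by (metis mult_1 order_trans)
      then have "real n \<le> Z" using L by linarith
      then show "n \<in> {..nat \<lfloor>Z\<rfloor>}" by (simp add: le_nat_floor)
    qed
  qed simp
  have eq: "{x \<in> hyp_region (Suc e) p Z. restrict x {..<e} \<in> G} = ?h ` (Sigma G ?N)"
  proof (intro equalityI subsetI)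
    fix x assume x: "x \<in> {x \<in> hyp_region (Suc e) p Z. restrict x {..<e} \<in> G}"
    then have v: "x i = 0" if "e < i" for i using that by (simp add: hyp_region_def nat_vecs_def)
    have "x = ?h (restrict x {..<e}, x e)" using v by (auto simp: fun_eq_iff not_less)
    moreover have "(restrict x {..<e}, x e) \<in> Sigma G ?N"
      using x by (simp add: hyp_region_def L_def)
    ultimately show "x \<in> ?h ` (Sigma G ?N)" by blast
  next
    fix x assume "x \<in> ?h ` (Sigma G ?N)"
    then obtain g n where gn: "g \<in> G" "n \<in> ?N g" "x = ?h (g, n)" by auto
    have "restrict x {..<e} = g" using gn(1,3) G(2) by (auto simp: fun_eq_iff PiE_iff extensional_def)
    moreover have "x \<in> hyp_region (Suc e) p Z"
      using gn(2,3) by (auto simp: hyp_region_def nat_vecs_def L_def)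
    ultimately show "x \<in> {x \<in> hyp_region (Suc e) p Z. restrict x {..<e} \<in> G}" using gn(1) by simp
  qed
  have inj: "inj_on ?h (Sigma G ?N)"
  proof (rule inj_onI)
    fix u u' assume u: "u \<in> Sigma G ?N" "u' \<in> Sigma G ?N" "?h u = ?h u'"
    obtain g n g' n' where uu: "u = (g, n)" "u' = (g', n')" by (cases u, cases u')
    have g: "g \<in> G" "g' \<in> G" and eq: "?h (g, n) = ?h (g', n')" using u unfolding uu by blast+
    have "g i = g' i" for i
    proof (cases "i < e")
      case True
      then show ?thesis using fun_cong[OF eq, of i] by simp
    next
      case False
      moreover have "g \<in> {..<e} \<rightarrow>\<^sub>E UNIV" "g' \<in> {..<e} \<rightarrow>\<^sub>E UNIV" using g G(2) by auto
      ultimately show ?thesis by (metis PiE_arb lessThan_iff)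
    qed
    moreover have "n = n'" using fun_cong[OF eq, of e] by simp
    ultimately show "u = u'" unfolding uu by auto
  qed
  have "card {x \<in> hyp_region (Suc e) p Z. restrict x {..<e} \<in> G} = card (Sigma G ?N)"
    unfolding eq using inj by (rule card_image)
  also have "\<dots> = (\<Sum>g\<in>G. card (?N g))" using G(1) fN by (intro card_SigmaI) auto
  finally show ?thesis .
qed

lemma sum_inverse_shift_le:
  fixes L :: real
  assumes "1 \<le> L"
  shows "(\<Sum>n\<le>M. 1 / (real n + L)) \<le> 1 + ln (real M + L)"
proof (induction M)
  case 0
  have "1 / L \<le> 1" "0 \<le> ln L" using assms by auto
  then show ?case by simp
next
  case (Suc M)
  let ?y = "real M + L"
  have y: "0 < ?y" using assms by simp
  have "ln (?y / (?y + 1)) \<le> ?y / (?y + 1) - 1" using y by (intro ln_le_minus_one) auto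
  then have "1 / (?y + 1) \<le> ln (?y + 1) - ln ?y" using y by (simp add: ln_div field_simps)
  then show ?case using Suc by (simp add: algebra_simps)
qed

lemma sum_inverse_shift_ge:
  fixes L :: real
  assumes "1 \<le> L"
  shows "ln ((real M + 1 + L) / L) \<le> (\<Sum>n\<le>M. 1 / (real n + L))"
proof -
  have step: "ln ((y + 1) / y) \<le> 1 / y" if "0 < y" for y :: real
    using ln_le_minus_one[of "(y + 1) / y"] that by (simp add: field_simps)
  show ?thesis
  proof (induction M)
    case 0
    then show ?case using step[of L] assms by (simp add: add.commute)
  next
    case (Suc M)
    let ?y = "real (Suc M) + L"
    have "ln ((?y + 1) / L) = ln ((?y + 1) / ?y) + ln (?y / L)" using assms by (simp add: ln_div)
    also have "\<dots> \<le> 1 / ?y + (\<Sum>n\<le>M. 1 / (real n + L))"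
      using step[of ?y] Suc assms by (intro add_mono) (auto simp: algebra_simps)
    finally show ?case by (simp add: algebra_simps)
  qed
qed

lemma finite_hyp_region:
  assumes L: "1 \<le> ln (1 / p)"
  shows "finite (hyp_region d p Z)"
    and "x \<in> hyp_region d p Z \<Longrightarrow> i < d \<Longrightarrow> real (x i) + ln (1 / p) \<le> Z"
proof -
  show b: "real (x i) + ln (1 / p) \<le> Z" if "x \<in> hyp_region d p Z" "i < d" for x i
  proof -
    have "(\<Prod>j\<in>{i}. real (x j) + ln (1 / p)) \<le> (\<Prod>j<d. real (x j) + ln (1 / p))"
      using that L by (intro prod_mono2) auto
    then show ?thesis using that by (simp add: hyp_region_def)
  qed
  have "hyp_region d p Z \<subseteq> corner_box {..<d} (\<lambda>_. Z)"
  proof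
    fix x assume x: "x \<in> hyp_region d p Z"
    then have "real (x i) \<le> Z" if "i < d" for i using b[OF x that] L by linarith
    then show "x \<in> corner_box {..<d} (\<lambda>_. Z)"
      using x by (simp add: vec_box_def hyp_region_def nat_vecs_def)
  qed
  then show "finite (hyp_region d p Z)" using finite_vec_box finite_subset finite_lessThan by metis
qed

text \<open>
  A slice over \<open>g\<close> has at most \<open>Z / (\<Prod>i<e. g i + L)\<close> points, and the sum of these quotients over all \<open>g\<close> factorizes.
\<close>

lemma card_hyp_region_le:
  fixes d :: nat and p Z :: real
  defines "L \<equiv> ln (1 / p)"
  assumes d: "d \<ge> 1" and L: "1 \<le> L" and Z: "L \<le> Z"
  shows "real (card (hyp_region d p Z)) \<le> Z * (1 + ln (2 * Z)) ^ (d - 1)"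
proof -
  obtain e where e: "d = Suc e" using d by (cases d) auto
  define M where "M = nat \<lfloor>Z\<rfloor>"
  let ?G = "{..<e} \<rightarrow>\<^sub>E {..M}"
  let ?P = "\<lambda>g. \<Prod>i<e. real (g i) + L"
  have Z1: "1 \<le> Z" using L Z by simp
  have P1: "1 \<le> ?P g" for g :: "nat \<Rightarrow> nat" using L by (intro prod_ge_1) auto
  have fG: "finite ?G" by (intro finite_PiE) auto
  have "hyp_region d p Z = {x \<in> hyp_region (Suc e) p Z. restrict x {..<e} \<in> ?G}"
  proof -
    have "restrict x {..<e} \<in> ?G" if x: "x \<in> hyp_region (Suc e) p Z" for x
    proof -
      have "x i \<le> M" if "i < e" for i
      proof -
        have "real (x i) + L \<le> Z"
          using finite_hyp_region(2)[of p x "Suc e" Z i] x that L by (simp add: L_def)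
        then show ?thesis using L by (simp add: M_def le_nat_floor)
      qed
      then show ?thesis by (auto simp: PiE_iff)
    qed
    then show ?thesis unfolding e by blast
  qed
  then have "real (card (hyp_region d p Z)) = (\<Sum>g\<in>?G. real (card {n::nat. ?P g * (real n + L) \<le> Z}))"
    using card_region_slices[of ?G e p Z] fG L by (simp add: L_def PiE_mono)
  also have "\<dots> \<le> (\<Sum>g\<in>?G. Z * (\<Prod>i<e. 1 / (real (g i) + L)))"
  proof (intro sum_mono)
    fix g
    let ?N = "{n::nat. ?P g * (real n + L) \<le> Z}"
    have P0: "0 < ?P g" using P1[of g] by linarith
    have "real (card ?N) \<le> Z / ?P g"
    proof (cases "?N = {}")
      case True
      then show ?thesis using P0 Z1 by simp
    next
      case False
      have n: "real n + 1 \<le> Z / ?P g" if "n \<in> ?N" for n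
      proof -
        have "real n + L \<le> Z / ?P g" using that P0 by (simp add: pos_le_divide_eq mult.commute)
        moreover have "real n + 1 \<le> real n + L" using L by simp
        ultimately show ?thesis by (rule order_trans[rotated])
      qed
      obtain n0 where "n0 \<in> ?N" using False by blast
      then have "real n0 + 1 \<le> Z / ?P g" by (rule n)
      moreover have "1 \<le> real n0 + 1" by simp
      ultimately have pos: "1 \<le> Z / ?P g" by (rule order_trans[rotated])
      have "?N \<subseteq> {..nat (\<lfloor>Z / ?P g\<rfloor>) - 1}"
      proof
        fix n assume "n \<in> ?N"
        then have "real (Suc n) \<le> Z / ?P g" using n[of n] by (simp only: of_nat_Suc add.commute)
        then have "Suc n \<le> nat \<lfloor>Z / ?P g\<rfloor>" by (rule le_nat_floor)
        then show "n \<in> {..nat (\<lfloor>Z / ?P g\<rfloor>) - 1}" by simp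
      qed
      then have "card ?N \<le> card {..nat (\<lfloor>Z / ?P g\<rfloor>) - 1}" by (intro card_mono) auto
      moreover have "1 \<le> nat \<lfloor>Z / ?P g\<rfloor>" using pos by (simp add: le_nat_floor)
      ultimately have "card ?N \<le> nat \<lfloor>Z / ?P g\<rfloor>" by simp
      then have "real (card ?N) \<le> real (nat \<lfloor>Z / ?P g\<rfloor>)" by (rule of_nat_mono)
      also have "\<dots> \<le> Z / ?P g" using pos by simp
      finally show ?thesis .
    qed
    then show "real (card ?N) \<le> Z * (\<Prod>i<e. 1 / (real (g i) + L))" by (simp add: prod_dividef)
  qed
  also have "\<dots> = Z * (\<Prod>i<e. \<Sum>n\<le>M. 1 / (real n + L))"
    by (subst prod_sum_PiE) (auto simp: sum_distrib_left)
  also have "\<dots> \<le> Z * (\<Prod>i<e. 1 + ln (2 * Z))"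
  proof (intro mult_left_mono prod_mono conjI)
    have "real M \<le> Z" using Z1 by (simp add: M_def)
    then have "ln (real M + L) \<le> ln (2 * Z)" using Z L by (subst ln_le_cancel_iff) auto
    then show "(\<Sum>n\<le>M. 1 / (real n + L)) \<le> 1 + ln (2 * Z)"
      using sum_inverse_shift_le[OF L, of M] by linarith
  qed (use L Z1 in \<open>auto intro!: sum_nonneg\<close>)
  finally show ?thesis by (simp add: e)
qed

text \<open>
  Only slices over \<open>g\<close> with entries at most \<open>m\<close> are counted. For these, \<open>m\<close> is so small that the slice
  has at least \<open>Z / (2 * (\<Prod>i<e. g i + L))\<close> points.
\<close>

lemma card_hyp_region_ge:
  fixes d m :: nat and p Z :: real
  defines "L \<equiv> ln (1 / p)"
  assumes d: "d \<ge> 1" and L: "1 \<le> L" and m: "2 * L * (real m + L) ^ (d - 1) \<le> Z"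
  shows "Z / 2 * ln ((real m + 1 + L) / L) ^ (d - 1) \<le> real (card (hyp_region d p Z))"
proof -
  obtain e where e: "d = Suc e" using d by (cases d) auto
  let ?G = "{..<e} \<rightarrow>\<^sub>E {..m}"
  let ?P = "\<lambda>g. \<Prod>i<e. real (g i) + L"
  have Z0: "0 \<le> Z" using m L by (smt (verit) mult_nonneg_nonneg of_nat_0_le_iff zero_le_power)
  have P1: "1 \<le> ?P g" for g :: "nat \<Rightarrow> nat" using L by (intro prod_ge_1) auto
  have fG: "finite ?G" by (intro finite_PiE) auto
  have "Z / 2 * ln ((real m + 1 + L) / L) ^ (d - 1) = Z / 2 * (\<Prod>i<e. ln ((real m + 1 + L) / L))"
    by (simp add: e)
  also have "\<dots> \<le> Z / 2 * (\<Prod>i<e. \<Sum>n\<le>m. 1 / (real n + L))"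
    using Z0 L sum_inverse_shift_ge[OF L] by (intro mult_left_mono prod_mono conjI) auto
  also have "\<dots> = (\<Sum>g\<in>?G. Z / 2 * (\<Prod>i<e. 1 / (real (g i) + L)))"
    by (subst prod_sum_PiE) (auto simp: sum_distrib_left)
  also have "\<dots> \<le> (\<Sum>g\<in>?G. real (card {n::nat. ?P g * (real n + L) \<le> Z}))"
  proof (intro sum_mono)
    fix g assume g: "g \<in> ?G"
    let ?N = "{n::nat. ?P g * (real n + L) \<le> Z}"
    have P0: "0 < ?P g" using P1[of g] by linarith
    have "?P g \<le> (\<Prod>i<e. real m + L)" using g L by (intro prod_mono conjI) (auto simp: PiE_iff)
    then have "2 * L * ?P g \<le> 2 * L * (real m + L) ^ (d - 1)" using L by (intro mult_left_mono) (auto simp: e)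
    then have "2 * L * ?P g \<le> Z" using m by linarith
    then have big: "2 * L \<le> Z / ?P g" using P0 by (simp add: pos_le_divide_eq)
    have eq: "?N = {..nat \<lfloor>Z / ?P g - L\<rfloor>}"
    proof -
      have "?P g * (real n + L) \<le> Z \<longleftrightarrow> real n \<le> Z / ?P g - L" for n
        using P0 by (simp add: pos_le_divide_eq le_diff_eq mult.commute)
      moreover have "real n \<le> Z / ?P g - L \<longleftrightarrow> n \<le> nat \<lfloor>Z / ?P g - L\<rfloor>" for n
        using big L by (simp add: le_nat_iff le_floor_iff)
      ultimately show ?thesis by auto
    qed
    have "Z / 2 * (\<Prod>i<e. 1 / (real (g i) + L)) = (Z / ?P g) / 2" by (simp add: prod_dividef)
    also have "\<dots> \<le> real (nat \<lfloor>Z / ?P g - L\<rfloor>) + 1"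
    proof -
      have "y / 2 \<le> real (nat \<lfloor>y - L\<rfloor>) + 1" if "2 * L \<le> y" for y using that by linarith
      then show ?thesis using big by blast
    qed
    also have "\<dots> = real (card ?N)" unfolding eq by simp
    finally show "Z / 2 * (\<Prod>i<e. 1 / (real (g i) + L)) \<le> real (card ?N)" .
  qed
  also have "\<dots> = real (card {x \<in> hyp_region (Suc e) p Z. restrict x {..<e} \<in> ?G})"
    using card_region_slices[of ?G e p Z] fG L by (simp add: L_def PiE_mono)
  also have "\<dots> \<le> real (card (hyp_region d p Z))"
    using finite_hyp_region(1)[of p d Z] L unfolding e L_def by (intro of_nat_mono card_mono) auto
  finally show ?thesis .
qed

section \<open>Combining the estimates\<close>

lemma countable_nat_vecs: "countable (nat_vecs d)"
proof -
  have "nat_vecs d \<subseteq> (\<Union>N::nat. corner_box {..<d} (\<lambda>_. real N))"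
  proof
    fix x assume x: "x \<in> nat_vecs d"
    have "x i \<le> (\<Sum>i<d. x i)" if "i < d" for i using that by (intro member_le_sum) auto
    then have "x \<in> corner_box {..<d} (\<lambda>_. real (\<Sum>i<d. x i))"
      unfolding vec_box_def using x by (simp add: nat_vecs_def del: of_nat_sum)
    then show "x \<in> (\<Union>N::nat. corner_box {..<d} (\<lambda>_. real N))" by blast
  qed
  moreover have "countable (\<Union>N::nat. corner_box {..<d} (\<lambda>_. real N))"
    by (rule countable_UN) (auto intro: countable_finite finite_vec_box)
  ultimately show ?thesis by (rule countable_subset)
qed

lemma semigroup_gen_box:
  assumes A: "A \<subseteq> nat_vecs d" and x: "x \<in> corner_box {..<d} hi"
  shows "x \<in> semigroup_gen A \<longleftrightarrow> x \<in> semigroup_gen (A \<inter> corner_box {..<d} hi)"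
proof (rule semigroup_gen_local)
  fix a assume a: "\<And>i. a i \<le> x i" "a \<in> A"
  have "if j \<in> {..<d} then 0 \<le> real (a j) \<and> real (a j) \<le> hi j else a j = 0" for j
  proof (cases "j < d")
    case True
    then have "real (x j) \<le> hi j" using x by (auto simp: vec_box_def dest!: spec[of _ j])
    then show ?thesis using a(1)[of j] True by auto
  next
    case False
    then show ?thesis using a(2) A by (auto simp: nat_vecs_def)
  qed
  then show "a \<in> corner_box {..<d} hi" by (simp add: vec_box_def)
qed

lemma subset_event_subset:
  assumes "\<And>A. A \<subseteq> X \<Longrightarrow> P A \<longleftrightarrow> Q A"
  shows "subset_event X p P = subset_event X p Q"
proof -
  have "P {x \<in> X. \<omega> x} \<longleftrightarrow> Q {x \<in> X. \<omega> x}" for \<omega> by (rule assms) blast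
  then show ?thesis by (simp only: subset_event_def)
qed

lemma subset_event_mem_semigroup_gen:
  assumes p: "0 \<le> p" "p \<le> 1" and x: "x \<in> nat_vecs d"
  shows "subset_event (nat_vecs d) p (\<lambda>A. x \<in> semigroup_gen A) \<in> sets (bernoulli_product (nat_vecs d) p)"
proof -
  let ?F = "corner_box {..<d} (\<lambda>j. real (x j))"
  have "x \<in> ?F" unfolding vec_box_def using x by (simp add: nat_vecs_def)
  then have "subset_event (nat_vecs d) p (\<lambda>A. x \<in> semigroup_gen A)
      = subset_event (nat_vecs d) p (\<lambda>A. x \<in> semigroup_gen (A \<inter> ?F))"
    by (intro subset_event_subset semigroup_gen_box)
  also have "\<dots> \<in> sets (bernoulli_product (nat_vecs d) p)"
    using p by (intro subset_event_finite finite_vec_box vec_box_subset_nat_vecs) auto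
  finally show ?thesis .
qed

text \<open>
  The event \<open>P\<close> involves infinitely many memberships, but it is a countable intersection of events that depend on
  finitely many elements each, hence measurable; its complement lies in the finitely determined event \<open>B\<close>.
\<close>

lemma prob_random_subset_ge:
  fixes P Q B :: "(nat \<Rightarrow> nat) set \<Rightarrow> bool" and p :: real and d :: nat
  defines "X \<equiv> nat_vecs d"
  assumes p: "0 \<le> p" "p \<le> 1" and F: "F = corner_box {..<d} (\<lambda>_. N)" and Y: "Y \<subseteq> X"
    and P: "\<And>A. A \<subseteq> X \<Longrightarrow> P A \<longleftrightarrow> Q (A \<inter> F) \<and> (\<forall>x\<in>Y. x \<in> semigroup_gen A)"
    and B: "\<And>A. A \<subseteq> X \<Longrightarrow> \<not> B (A \<inter> F) \<Longrightarrow> P A"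
  shows "1 - subset_prob p F B \<le> prob_random_subset X p P" "prob_random_subset X p P \<le> 1"
proof -
  let ?M = "bernoulli_product X p"
  interpret prob_space ?M by (rule prob_space_bernoulli_product)
  have F': "finite F" "F \<subseteq> X" unfolding F X_def by (rule finite_vec_box, simp, rule vec_box_subset_nat_vecs)
  have cY: "countable Y" using countable_subset[OF Y] countable_nat_vecs by (simp add: X_def)
  have mB: "subset_event X p (\<lambda>A. B (A \<inter> F)) \<in> sets ?M" by (rule subset_event_finite[OF p F'])
  have mQ: "subset_event X p (\<lambda>A. Q (A \<inter> F)) \<in> sets ?M" by (rule subset_event_finite[OF p F'])
  have mY: "(\<Inter>x\<in>Y. subset_event X p (\<lambda>A. x \<in> semigroup_gen A)) \<inter> space ?M \<in> sets ?M"
  proof (cases "Y = {}")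
    case False
    have "(\<Inter>x\<in>Y. subset_event X p (\<lambda>A. x \<in> semigroup_gen A)) \<in> sets ?M"
      using cY False Y subset_event_mem_semigroup_gen[OF p, of _ d]
      by (intro sets.countable_INT') (auto simp: X_def)
    then show ?thesis by (rule sets.Int) simp
  qed simp
  have eq: "subset_event X p P = subset_event X p (\<lambda>A. Q (A \<inter> F)) \<inter>
      ((\<Inter>x\<in>Y. subset_event X p (\<lambda>A. x \<in> semigroup_gen A)) \<inter> space ?M)"
  proof -
    have "subset_event X p P = subset_event X p (\<lambda>A. Q (A \<inter> F) \<and> (\<forall>x\<in>Y. x \<in> semigroup_gen A))"
      by (rule subset_event_subset) (rule P)
    then show ?thesis by (auto simp: subset_event_def)
  qed
  have mP: "subset_event X p P \<in> sets ?M" unfolding eq using mQ mY by (rule sets.Int)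
  have "space ?M - subset_event X p (\<lambda>A. B (A \<inter> F)) \<subseteq> subset_event X p P"
  proof
    fix \<omega> assume "\<omega> \<in> space ?M - subset_event X p (\<lambda>A. B (A \<inter> F))"
    then show "\<omega> \<in> subset_event X p P"
      using B[of "{x \<in> X. \<omega> x}"] unfolding subset_event_def by blast
  qed
  then have "prob (space ?M - subset_event X p (\<lambda>A. B (A \<inter> F))) \<le> prob (subset_event X p P)"
    using mP by (rule finite_measure_mono)
  then show "1 - subset_prob p F B \<le> prob_random_subset X p P"
    using prob_compl[OF mB] prob_random_subset_finite[OF p F', of B] by (simp add: prob_random_subset_eq)
  show "prob_random_subset X p P \<le> 1" by (simp add: prob_random_subset_eq)
qed

lemma tendsto_power_mult_exp_neg:
  fixes a :: real
  assumes a: "0 < a"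
  shows "((\<lambda>L. (8 * L + 1) ^ d * exp (- a * L)) \<longlongrightarrow> 0) at_top"
proof -
  have "filterlim (\<lambda>L. a * L) at_top at_top"
    using a by (intro filterlim_tendsto_pos_mult_at_top[OF tendsto_const] filterlim_ident)
  from filterlim_compose[OF tendsto_power_div_exp_0[of d] this]
  have "((\<lambda>L. (9 / a) ^ d * ((a * L) ^ d / exp (a * L))) \<longlongrightarrow> (9 / a) ^ d * 0) at_top"
    by (intro tendsto_intros)
  then have lim: "((\<lambda>L. (9 / a) ^ d * ((a * L) ^ d / exp (a * L))) \<longlongrightarrow> 0) at_top" by simp
  have lower: "\<forall>\<^sub>F L in at_top. 0 \<le> (8 * L + 1) ^ d * exp (- a * L)"
    using eventually_ge_at_top[of 0] by eventually_elim simp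
  have upper: "\<forall>\<^sub>F L in at_top. (8 * L + 1) ^ d * exp (- a * L) \<le> (9 / a) ^ d * ((a * L) ^ d / exp (a * L))"
    using eventually_ge_at_top[of 1]
  proof eventually_elim
    case (elim L)
    have "(8 * L + 1) ^ d * exp (- a * L) \<le> (9 * L) ^ d * exp (- a * L)"
      using elim by (intro mult_right_mono power_mono) auto
    also have "9 * L = 9 / a * (a * L)" using a by simp
    also have "(9 / a * (a * L)) ^ d * exp (- a * L) = (9 / a) ^ d * ((a * L) ^ d / exp (a * L))"
      unfolding power_mult_distrib[of "9 / a" "a * L"] by (simp add: exp_minus divide_inverse)
    finally show ?case .
  qed
  show ?thesis by (rule tendsto_sandwich[OF lower upper tendsto_const lim])
qed

text \<open>
  The entries of \<open>g\<close> range up to \<open>m\<close> of size \<open>exp (L / (2 d))\<close>: their product is at most about \<open>1 / sqrt p\<close>, and each of the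
  \<open>d - 1\<close> logarithmic sums still has order \<open>L\<close>.
\<close>

lemma card_region_lower:
  fixes d :: nat and p C :: real
  defines "L \<equiv> ln (1 / p)"
  assumes d: "d \<ge> 1" and p: "0 < p" and L: "1 \<le> L" and C: "1 \<le> C"
    and L1: "2 * C * (1 + 2 * real d) ^ d \<le> exp (L / 2)" and L2: "ln L \<le> L / (4 * real d)"
  shows "1 / (2 * C * (4 * real d) ^ (d - 1)) * ((1 / p) * L ^ (2 * d))
     \<le> real (card (hyp_region d p (1 / C * (1 / p) * L ^ (d + 1))))"
proof -
  let ?Z = "1 / C * (1 / p) * L ^ (d + 1)"
  have d1: "1 \<le> real d" using d by simp
  have pL: "1 / p = exp L" using p by (simp add: L_def)
  define m where "m = nat \<lfloor>exp (L / (2 * real d))\<rfloor>"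
  have m: "real m \<le> exp (L / (2 * real d))" "exp (L / (2 * real d)) \<le> real m + 1"
    unfolding m_def by (simp, linarith)
  have e: "2 * L * (real m + L) ^ (d - 1) \<le> ?Z"
  proof -
    let ?E = "(1 + 2 * real d) * exp (L / (2 * real d))"
    have "L / (2 * real d) \<le> exp (L / (2 * real d))" using exp_ge_add_one_self[of "L / (2 * real d)"] by linarith
    then have "L \<le> 2 * real d * exp (L / (2 * real d))" using d1 by (simp add: field_simps)
    then have mL: "real m + L \<le> ?E" using m by (simp add: distrib_right)
    have "1 * 1 \<le> ?E" using L d1 by (intro mult_mono) auto
    have "(real m + L) ^ (d - 1) \<le> ?E ^ (d - 1)" using mL L by (intro power_mono) auto
    also have "\<dots> \<le> ?E ^ d" using \<open>1 * 1 \<le> ?E\<close> by (intro power_increasing) auto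
    also have "\<dots> = (1 + 2 * real d) ^ d * exp (L / 2)"
      using d1 by (simp add: power_mult_distrib exp_of_nat_mult[symmetric])
    finally have "2 * L * (real m + L) ^ (d - 1) \<le> 2 * L * ((1 + 2 * real d) ^ d * exp (L / 2))"
      using L by (intro mult_left_mono) auto
    also have "\<dots> = (2 * C * (1 + 2 * real d) ^ d) * exp (L / 2) * L / C" using C by simp
    also have "\<dots> \<le> exp (L / 2) * exp (L / 2) * L ^ (d + 1) / C"
      using L1 L C self_le_power[of L "d + 1"] by (intro divide_right_mono mult_mono) auto
    also have "\<dots> = ?Z" unfolding pL by (simp add: exp_add[symmetric])
    finally show ?thesis .
  qed
  have "L / (4 * real d) \<le> ln ((real m + 1 + L) / L)"
  proof -
    have "L / (4 * real d) \<le> L / (2 * real d) - ln L" using L2 d1 by (simp add: field_simps)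
    also have "\<dots> = ln (exp (L / (2 * real d)) / L)" using L by (simp add: ln_div)
    also have "\<dots> \<le> ln ((real m + 1 + L) / L)"
      using m L by (subst ln_le_cancel_iff) (auto intro!: divide_right_mono)
    finally show ?thesis .
  qed
  then have "?Z / 2 * (L / (4 * real d)) ^ (d - 1) \<le> ?Z / 2 * ln ((real m + 1 + L) / L) ^ (d - 1)"
    using L C p by (intro mult_left_mono power_mono) auto
  also have "\<dots> \<le> real (card (hyp_region d p ?Z))"
    using card_hyp_region_ge[OF d, of p m ?Z] e L by (simp add: L_def)
  finally have "?Z / 2 * (L / (4 * real d)) ^ (d - 1) \<le> real (card (hyp_region d p ?Z))" .
  moreover have "L ^ (2 * d) = L ^ (d + 1) * L ^ (d - 1)"
    unfolding power_add[symmetric] using d by (intro arg_cong[where f = "power L"]) simp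
  ultimately show ?thesis by (simp add: power_divide mult_ac)
qed

lemma card_region_upper:
  fixes d :: nat and p C :: real
  defines "L \<equiv> ln (1 / p)"
  assumes d: "d \<ge> 1" and p: "0 < p" and L: "1 \<le> L" and C: "1 \<le> C"
    and L1: "2 * (C * (1 / p) * L ^ (d + 1)) \<le> exp (2 * L)"
  shows "real (card (hyp_region d p (C * (1 / p) * L ^ (d + 1)))) \<le> 3 ^ (d - 1) * C * ((1 / p) * L ^ (2 * d))"
proof -
  let ?Z = "C * (1 / p) * L ^ (d + 1)"
  have pL: "1 / p = exp L" using p by (simp add: L_def)
  have "1 * 1 * L \<le> ?Z"
    unfolding pL using L C self_le_power[of L "d + 1"] by (intro mult_mono) auto
  then have ZL: "L \<le> ?Z" by simp
  then have "ln (2 * ?Z) \<le> ln (exp (2 * L))" using L1 L by (subst ln_le_cancel_iff) auto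
  then have ln2Z: "ln (2 * ?Z) \<le> 2 * L" by simp
  have "0 \<le> ln (2 * ?Z)" using ZL L by (intro ln_ge_zero) auto
  have "real (card (hyp_region d p ?Z)) \<le> ?Z * (1 + ln (2 * ?Z)) ^ (d - 1)"
    using card_hyp_region_le[OF d, of p ?Z] L ZL by (simp add: L_def)
  also have "\<dots> \<le> ?Z * (3 * L) ^ (d - 1)"
    using ln2Z L ZL \<open>0 \<le> ln (2 * ?Z)\<close> by (intro mult_left_mono power_mono) auto
  also have "\<dots> = 3 ^ (d - 1) * C * ((1 / p) * (L ^ (d + 1) * L ^ (d - 1)))"
    by (simp add: power_mult_distrib)
  also have "L ^ (d + 1) * L ^ (d - 1) = L ^ (2 * d)"
    unfolding power_add[symmetric] using d by (intro arg_cong[where f = "power L"]) simp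
  finally show ?thesis .
qed

text \<open>
  For a single \<open>p\<close>, all three conclusions follow from the sparsity of the inner region and from the shell being generated. The numerical
  hypotheses hold for all small \<open>p\<close>; the constant \<open>2 * c\<close> bounds the normalized size of the inner region from below.
\<close>

lemma prob_gap_event:
  fixes d :: nat and C \<delta> c c' p :: real
  defines "L \<equiv> ln (1 / p)"
  defines "R1 \<equiv> hyp_region d p (1 / C * (1 / p) * L ^ (d + 1))"
    and "R2 \<equiv> hyp_region d p (C * (1 / p) * L ^ (d + 1))"
    and "B \<equiv> 7 * (3 * d * d + 6 * d + 2)"
  defines "T \<equiv> (8 * L + 1) ^ d * exp (L / 2)" and "U \<equiv> (1 / p) * L ^ (2 * d)"
  assumes d: "d \<ge> 1" and p: "0 < p" "p \<le> 1 / 8" and L: "1 \<le> L"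
    and C1: "1 \<le> C" and C2: "2 ^ d \<le> C" and C3: "16 * (1 + 2 * real d) * (16 * real d) ^ d \<le> C"
    and C4: "real B * (360 * real d * real B) ^ d \<le> C"
    and N: "2 ^ d * (C * (1 / p) * L ^ (d + 1)) \<le> 1 / p ^ 2"
    and \<delta>: "T \<le> \<delta> * (2 * c * (1 / p))" "0 \<le> \<delta>" "\<delta> \<le> 1 / 2" and c: "0 < c"
    and low: "2 * c * U \<le> real (card R1)" and up: "real (card R2) \<le> c' * U"
  defines "prb \<equiv> prob_random_subset (nat_vecs d) p (\<lambda>A.
         let S = semigroup_gen A; G = nat_vecs d - S
         in real (card (S \<inter> R1)) \<le> \<delta> * real (card R1) \<and> nat_vecs d - R2 \<subseteq> S \<and> finite G \<and>
            c * U \<le> real (card G) \<and> real (card G) \<le> c' * U)"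
  shows "1 - ((8 * L + 1) ^ d * exp (- L / 16) + 2 ^ d * (real d + 3) * p ^ 2) \<le> prb" and "prb \<le> 1"
proof -
  let ?X = "nat_vecs d" and ?N = "1 / p ^ 2"
  let ?Z1 = "1 / C * (1 / p) * L ^ (d + 1)" and ?Z2 = "C * (1 / p) * L ^ (d + 1)"
  define F where "F = corner_box {..<d} (\<lambda>_. ?N)"
  have p1: "0 \<le> p" "p \<le> 1" using p by auto
  have fF: "finite F" unfolding F_def by (rule finite_vec_box) simp
  have pL: "1 / p = exp L" using p by (simp add: L_def)
  have NL: "?N = exp (2 * L)"
  proof -
    have "?N = (1 / p) * (1 / p)" by (simp add: power2_eq_square)
    then show ?thesis unfolding pL by (simp add: exp_add[symmetric])
  qed
  have Z2L: "L \<le> ?Z2"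
  proof -
    have "1 * 1 * L \<le> ?Z2" unfolding pL using L C1 self_le_power[of L "d + 1"] by (intro mult_mono) auto
    then show ?thesis by simp
  qed
  have Z12: "?Z1 \<le> ?Z2"
  proof -
    have "1 * 1 \<le> C * C" using C1 by (intro mult_mono) auto
    then have "1 / C \<le> C" using C1 by (simp add: divide_le_eq)
    then show ?thesis using p L by (intro mult_right_mono) auto
  qed
  have two: "(2::real) \<le> 2 ^ d" using d self_le_power[of "2::real" d] by simp
  have Z2N: "?Z2 \<le> ?N" "2 * ?Z2 \<le> ?N"
    using mult_right_mono[OF two, of ?Z2] Z2L L N by linarith+
  have inF: "x \<in> F" if x: "x \<in> ?X" "(\<Prod>i<d. real (x i) + L) \<le> ?N" for x
  proof -
    have "real (x i) \<le> ?N" if i: "i < d" for i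
    proof -
      have "real (x i) + L \<le> (\<Prod>i<d. real (x i) + L)"
        using i L by (intro factor_le_prod[of "{..<d}" i "\<lambda>i. real (x i) + L"]) auto
      then show ?thesis using x(2) L by linarith
    qed
    then show ?thesis using x(1) by (simp add: F_def vec_box_def nat_vecs_def)
  qed
  have R2: "R2 = {x \<in> ?X. (\<Prod>i<d. real (x i) + L) \<le> ?Z2}" by (simp add: R2_def hyp_region_def L_def)
  have R1: "R1 = {x \<in> ?X. (\<Prod>i<d. real (x i) + L) \<le> ?Z1}" by (simp add: R1_def hyp_region_def L_def)
  have R12: "R1 \<subseteq> R2" unfolding R1 R2 using Z12 by (auto intro: order_trans)
  have R2F: "R2 \<subseteq> F" unfolding R2 using inF Z2N(1) by (blast intro: order_trans)
  have fR2: "finite R2" using R2F fF by (rule finite_subset)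
  have fR1: "finite R1" using R12 fR2 by (rule finite_subset)
  have memF: "x \<in> semigroup_gen A \<longleftrightarrow> x \<in> semigroup_gen (A \<inter> F)" if "A \<subseteq> ?X" "x \<in> F" for A x
    using semigroup_gen_box that unfolding F_def by blast
  let ?P = "\<lambda>A. let S = semigroup_gen A; G = ?X - S
         in real (card (S \<inter> R1)) \<le> \<delta> * real (card R1) \<and> ?X - R2 \<subseteq> S \<and> finite G \<and>
            c * U \<le> real (card G) \<and> real (card G) \<le> c' * U"
  let ?Q = "\<lambda>A. real (card (semigroup_gen A \<inter> R1)) \<le> \<delta> * real (card R1) \<and>
      c * U \<le> real (card (R2 - semigroup_gen A)) \<and> real (card (R2 - semigroup_gen A)) \<le> c' * U"
  let ?B1 = "\<lambda>A. T < real (card (semigroup_gen A \<inter> R1))"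
  let ?B2 = "\<lambda>A. \<exists>x\<in>F. ?Z2 \<le> (\<Prod>i<d. real (x i) + L) \<and> x \<notin> semigroup_gen A"
  let ?B = "\<lambda>A. ?B1 A \<or> ?B2 A"
  have PQ: "?P A \<longleftrightarrow> ?Q (A \<inter> F) \<and> (\<forall>x\<in>?X - R2. x \<in> semigroup_gen A)" if A: "A \<subseteq> ?X" for A
  proof -
    have 1: "semigroup_gen (A \<inter> F) \<inter> R1 = semigroup_gen A \<inter> R1"
      using memF[OF A] R12 R2F by blast
    have 2: "R2 - semigroup_gen (A \<inter> F) = R2 - semigroup_gen A"
      using memF[OF A] R2F by blast
    show ?thesis
    proof (cases "?X - R2 \<subseteq> semigroup_gen A")
      case True
      have "?X - semigroup_gen A = R2 - semigroup_gen A" using True R2 by blast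
      then show ?thesis unfolding Let_def 1 2 using True fR2 by (simp add: subset_iff)
    next
      case False
      then show ?thesis unfolding Let_def by blast
    qed
  qed
  have BP: "?P A" if A: "A \<subseteq> ?X" and B: "\<not> ?B (A \<inter> F)" for A
  proof -
    have 1: "semigroup_gen (A \<inter> F) \<inter> R1 = semigroup_gen A \<inter> R1"
      using memF[OF A] R12 R2F by blast
    have 2: "R2 - semigroup_gen (A \<inter> F) = R2 - semigroup_gen A"
      using memF[OF A] R2F by blast
    have LU: "1 / p \<le> U"
    proof -
      have "1 \<le> L ^ (2 * d)" using L by (rule one_le_power)
      then have "(1 / p) * 1 \<le> U" unfolding U_def using p by (intro mult_left_mono) auto
      then show ?thesis by simp
    qed
    have sparse: "real (card (semigroup_gen A \<inter> R1)) \<le> \<delta> * real (card R1)"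
    proof -
      have "real (card (semigroup_gen A \<inter> R1)) \<le> T" using B unfolding 1 by (simp only: not_less de_Morgan_disj)
      also have "\<dots> \<le> \<delta> * (2 * c * (1 / p))" by (rule \<delta>(1))
      also have "\<dots> \<le> \<delta> * (2 * c * U)" using LU c \<delta>(2) by (intro mult_left_mono) auto
      also have "\<dots> \<le> \<delta> * real (card R1)" using low \<delta>(2) by (intro mult_left_mono)
      finally show ?thesis .
    qed
    have covered: "x \<in> semigroup_gen A" if x: "x \<in> ?X - R2" for x
    proof (rule generated_beyond_shell[OF L])
      show "(1 + L) ^ d \<le> ?Z2"
      proof -
        have "(1 + L) ^ d \<le> (2 * L) ^ d" using L by (intro power_mono) auto
        also have "\<dots> = 2 ^ d * 1 * L ^ d" by (simp add: power_mult_distrib)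
        also have "\<dots> \<le> ?Z2"
          unfolding pL using C1 C2 L power_increasing[of d "d + 1" L] by (intro mult_mono) auto
        finally show ?thesis .
      qed
      show "x \<in> ?X" "?Z2 < (\<Prod>i<d. real (x i) + L)" using x unfolding R2 by auto
      fix y assume y: "y \<in> ?X" "?Z2 < (\<Prod>i<d. real (y i) + L)" "(\<Prod>i<d. real (y i) + L) \<le> 2 ^ d * ?Z2"
      then have yF: "y \<in> F" using N by (intro inF) (auto intro: order_trans)
      then have "y \<in> semigroup_gen (A \<inter> F)" using B y(2) less_imp_le by blast
      then show "y \<in> semigroup_gen A" using memF[OF A yF] by blast
    qed
    have lower: "c * U \<le> real (card (R2 - semigroup_gen A))"
    proof -
      have "real (card (semigroup_gen A \<inter> R1)) \<le> 1 / 2 * real (card R1)"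
        using sparse mult_right_mono[OF \<delta>(3), of "real (card R1)"] by simp
      moreover have "card R1 = card (R1 - semigroup_gen A) + card (semigroup_gen A \<inter> R1)"
        using card_Diff_subset_Int[of R1 "semigroup_gen A"] fR1 card_mono[of R1 "R1 \<inter> semigroup_gen A"]
        by (simp add: Int_commute)
      moreover have "card (R1 - semigroup_gen A) \<le> card (R2 - semigroup_gen A)"
        using R12 fR2 by (intro card_mono) auto
      ultimately show ?thesis using low by linarith
    qed
    have upper: "real (card (R2 - semigroup_gen A)) \<le> c' * U"
    proof -
      have "card (R2 - semigroup_gen A) \<le> card R2" using fR2 by (intro card_mono) auto
      then show ?thesis using up by linarith
    qed
    show ?thesis unfolding PQ[OF A] 1 2 using sparse lower upper covered by blast
  qed
  note main = prob_random_subset_ge[of p F d ?N "?X - R2" ?P ?Q ?B, OF p1 F_def Diff_subset PQ BP]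
  have "subset_prob p F ?B \<le> subset_prob p F ?B1 + subset_prob p F ?B2"
    by (rule subset_prob_disj[OF fF p1])
  also have "\<dots> \<le> (8 * L + 1) ^ d * exp (- L / 16) + 2 ^ d * (real d + 3) * p ^ 2"
  proof (rule add_mono)
    show "subset_prob p F ?B1 \<le> (8 * L + 1) ^ d * exp (- L / 16)"
      unfolding F_def T_def R1_def L_def
    proof (rule subset_prob_region_dense[OF d p(1) p1(2)])
      show "1 \<le> ln (1 / p)" using L by (simp add: L_def)
      show "2 ^ d * (1 / C * (1 / p) * ln (1 / p) ^ (d + 1)) \<le> 1 / p ^ 2"
        using order_trans[OF mult_left_mono[OF Z12, of "2 ^ d"] N] by (simp only: L_def) simp
      show "2 * (1 / C * (1 / p) * ln (1 / p) ^ (d + 1)) \<le> exp (4 * ln (1 / p))"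
      proof -
        have "2 * ?Z1 \<le> exp (2 * L)" using Z2N(2) Z12 unfolding NL by linarith
        also have "\<dots> \<le> exp (4 * L)" using L by simp
        finally show ?thesis by (simp only: L_def)
      qed
    qed (rule C3)
    show "subset_prob p F ?B2 \<le> 2 ^ d * (real d + 3) * p ^ 2"
      unfolding F_def L_def using C4 L
      by (intro subset_prob_shell_not_generated[OF d p]) (simp_all add: B_def L_def)
  qed
  finally show "1 - ((8 * L + 1) ^ d * exp (- L / 16) + 2 ^ d * (real d + 3) * p ^ 2) \<le> prb"
    using main(1) unfolding prb_def by linarith
  show "prb \<le> 1" unfolding prb_def by (rule main(2))
qed

theorem theorem1p2:
  fixes d :: nat
  assumes "d \<ge> 1"
  shows "\<exists>C::real. C > 0 \<and>
    (\<exists>(\<delta> :: real \<Rightarrow> real) (c::real) (c'::real).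
       (\<delta> \<longlongrightarrow> 0) (at_right 0) \<and> c > 0 \<and> c' > 0 \<and>
       whp_random_subset (nat_vecs d) (\<lambda>p A.
         let S = semigroup_gen A;
             L = ln (1 / p);
             R\<^sub>1 = hyp_region d p (1 / C * (1 / p) * L ^ (d + 1));
             R\<^sub>2 = hyp_region d p (C * (1 / p) * L ^ (d + 1));
             G = nat_vecs d - S
         in real (card (S \<inter> R\<^sub>1)) \<le> \<delta> p * real (card R\<^sub>1) \<and>
            nat_vecs d - R\<^sub>2 \<subseteq> S \<and>
            finite G \<and>
            c * ((1 / p) * L ^ (2 * d)) \<le> real (card G) \<and>
            real (card G) \<le> c' * ((1 / p) * L ^ (2 * d))))"
proof -
  have d1: "1 \<le> real d" using assms by simp
  define B where "B = 7 * (3 * d * d + 6 * d + 2)"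
  define C where "C = 1 + 2 ^ d + 16 * (1 + 2 * real d) * (16 * real d) ^ d + real B * (360 * real d * real B) ^ d"
  have terms: "0 \<le> (2::real) ^ d" "0 \<le> 16 * (1 + 2 * real d) * (16 * real d) ^ d"
    "0 \<le> real B * (360 * real d * real B) ^ d" by simp_all
  then have C: "1 \<le> C" "2 ^ d \<le> C" "16 * (1 + 2 * real d) * (16 * real d) ^ d \<le> C"
    "real B * (360 * real d * real B) ^ d \<le> C"
    unfolding C_def by linarith+
  define c where "c = 1 / (2 * C * (4 * real d) ^ (d - 1)) / 2"
  define c' where "c' = 3 ^ (d - 1) * C"
  have c0: "0 < c" unfolding c_def using C(1) d1 by simp
  have c'0: "0 < c'" unfolding c'_def using C(1) by simp
  \<comment> \<open>the bound \<open>(8 * L + 1) ^ d * exp (L / 2)\<close> on the number of generated points, divided by the lower bound \<open>2 * c * exp L\<close>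
    on the number of points\<close>
  define \<rho> where "\<rho> L = (8 * L + 1) ^ d * exp (- (1 / 2) * L) / (2 * c)" for L
  define \<delta> where "\<delta> p = \<rho> (ln (1 / p))" for p
  have limL: "filterlim (\<lambda>p::real. ln (1 / p)) at_top (at_right 0)" by real_asymp
  have \<rho>_lim: "(\<rho> \<longlongrightarrow> 0) at_top"
    unfolding \<rho>_def using tendsto_divide_zero[OF tendsto_power_mult_exp_neg[of "1 / 2" d]] by simp
  have \<delta>_lim: "(\<delta> \<longlongrightarrow> 0) (at_right 0)"
    unfolding \<delta>_def by (rule filterlim_compose[OF \<rho>_lim limL])
  define bad where "bad p = (8 * ln (1 / p) + 1) ^ d * exp (- (1 / 16) * ln (1 / p)) + 2 ^ d * (real d + 3) * p ^ 2" for p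
  have bad_lim: "((\<lambda>p. 1 - bad p) \<longlongrightarrow> 1) (at_right 0)"
  proof -
    have "((\<lambda>p::real. (8 * ln (1 / p) + 1) ^ d * exp (- (1 / 16) * ln (1 / p))) \<longlongrightarrow> 0) (at_right 0)"
      by (rule filterlim_compose[OF tendsto_power_mult_exp_neg limL]) simp
    moreover have "((\<lambda>p. 2 ^ d * (real d + 3) * p ^ 2) \<longlongrightarrow> 2 ^ d * (real d + 3) * 0 ^ 2) (at_right 0)"
      by (intro tendsto_intros)
    ultimately have "(bad \<longlongrightarrow> 0 + 2 ^ d * (real d + 3) * 0 ^ 2) (at_right 0)"
      unfolding bad_def by (rule tendsto_add)
    then have "((\<lambda>p. 1 - bad p) \<longlongrightarrow> 1 - (0 + 2 ^ d * (real d + 3) * 0 ^ 2)) (at_right 0)"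
      by (intro tendsto_intros)
    then show ?thesis by simp
  qed
  have evL: "\<forall>\<^sub>F L in at_top. 1 \<le> L \<and> 2 * C * (1 + 2 * real d) ^ d \<le> exp (L / 2) \<and> ln L \<le> L / (4 * real d) \<and>
     2 ^ d * (C * exp L * L ^ (d + 1)) \<le> exp (2 * L) \<and> \<rho> L \<le> 1 / 2"
  proof (intro eventually_conj)
    show "\<forall>\<^sub>F L in at_top. (1::real) \<le> L" by (rule eventually_ge_at_top)
    have "filterlim (\<lambda>L::real. exp (L / 2)) at_top at_top" by real_asymp
    then show "\<forall>\<^sub>F L in at_top. 2 * C * (1 + 2 * real d) ^ d \<le> exp (L / 2)"
      by (simp add: filterlim_at_top)
    have "\<forall>\<^sub>F L in at_top. ln L / L < 1 / (4 * real d)"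
      using d1 by (intro order_tendstoD(2)[OF ln_x_over_x_tendsto_0]) simp
    then show "\<forall>\<^sub>F L in at_top. ln L \<le> L / (4 * real d)"
      using eventually_gt_at_top[of 0]
    proof eventually_elim
      case (elim L)
      then show ?case by (simp add: field_simps)
    qed
    have "\<forall>\<^sub>F L in at_top. L ^ (d + 1) / exp L < 1 / (2 ^ d * C)"
      using C(1) by (intro order_tendstoD(2)[OF tendsto_power_div_exp_0]) simp
    then show "\<forall>\<^sub>F L in at_top. 2 ^ d * (C * exp L * L ^ (d + 1)) \<le> exp (2 * L)"
    proof eventually_elim
      case (elim L)
      then have "L ^ (d + 1) * (2 ^ d * C) \<le> exp L" using C(1) by (simp add: field_simps)
      then have "exp L * (L ^ (d + 1) * (2 ^ d * C)) \<le> exp L * exp L" by (intro mult_left_mono) auto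
      then show ?case by (simp add: exp_add[symmetric] mult_ac)
    qed
    show "\<forall>\<^sub>F L in at_top. \<rho> L \<le> 1 / 2"
      using order_tendstoD(2)[OF \<rho>_lim, of "1 / 2"] by (auto elim: eventually_mono)
  qed
  have evp: "\<forall>\<^sub>F p in at_right (0::real). 0 < p \<and> p \<le> 1 / 8"
    by (rule eventually_at_rightI[of 0 "1 / 8"]) auto
  let ?P = "\<lambda>p A.
         let S = semigroup_gen A;
             L = ln (1 / p);
             R\<^sub>1 = hyp_region d p (1 / C * (1 / p) * L ^ (d + 1));
             R\<^sub>2 = hyp_region d p (C * (1 / p) * L ^ (d + 1));
             G = nat_vecs d - S
         in real (card (S \<inter> R\<^sub>1)) \<le> \<delta> p * real (card R\<^sub>1) \<and>
            nat_vecs d - R\<^sub>2 \<subseteq> S \<and>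
            finite G \<and>
            c * ((1 / p) * L ^ (2 * d)) \<le> real (card G) \<and>
            real (card G) \<le> c' * ((1 / p) * L ^ (2 * d))"
  have "\<forall>\<^sub>F p in at_right 0. 1 - bad p \<le> prob_random_subset (nat_vecs d) p (?P p) \<and>
      prob_random_subset (nat_vecs d) p (?P p) \<le> 1"
    using evp eventually_compose_filterlim[OF evL limL]
  proof eventually_elim
    case (elim p)
    define L where "L = ln (1 / p)"
    have p: "0 < p" "p \<le> 1 / 8" and L: "1 \<le> L" and e1: "2 * C * (1 + 2 * real d) ^ d \<le> exp (L / 2)"
      and e2: "ln L \<le> L / (4 * real d)" and e3: "2 ^ d * (C * exp L * L ^ (d + 1)) \<le> exp (2 * L)"
      and e4: "\<rho> L \<le> 1 / 2"
      using elim by (simp_all add: L_def)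
    have pL: "1 / p = exp L" using p by (simp add: L_def)
    have "1 / p ^ 2 = (1 / p) * (1 / p)" by (simp add: power2_eq_square)
    then have p2: "1 / p ^ 2 = exp (2 * L)" unfolding pL by (simp add: exp_add[symmetric])
    have e5: "2 * (C * (1 / p) * L ^ (d + 1)) \<le> exp (2 * L)"
    proof -
      have "(2::real) \<le> 2 ^ d" using assms self_le_power[of "2::real" d] by simp
      then have "2 * (C * exp L * L ^ (d + 1)) \<le> 2 ^ d * (C * exp L * L ^ (d + 1))"
        using C(1) L by (intro mult_right_mono) auto
      then show ?thesis using e3 unfolding pL by linarith
    qed
    note gaps = prob_gap_event[of d p C "\<delta> p" c c', folded L_def B_def, OF assms p L C(1,2,3,4)]
    have 1: "2 ^ d * (C * (1 / p) * L ^ (d + 1)) \<le> 1 / p ^ 2" unfolding p2 unfolding pL by (rule e3)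
    have 2: "(8 * L + 1) ^ d * exp (L / 2) \<le> \<delta> p * (2 * c * (1 / p))"
    proof -
      have "\<delta> p * (2 * c * (1 / p)) = (8 * L + 1) ^ d * (exp (- (1 / 2) * L) * exp L)"
        unfolding \<delta>_def L_def[symmetric] \<rho>_def pL using c0 by simp
      then show ?thesis by (simp add: exp_add[symmetric])
    qed
    have 3: "0 \<le> \<delta> p" unfolding \<delta>_def L_def[symmetric] \<rho>_def using L c0 by simp
    have 4: "\<delta> p \<le> 1 / 2" unfolding \<delta>_def L_def[symmetric] by (rule e4)
    have 5: "2 * c * ((1 / p) * L ^ (2 * d)) \<le> real (card (hyp_region d p (1 / C * (1 / p) * L ^ (d + 1))))"
    proof -
      have "2 * c = 1 / (2 * C * (4 * real d) ^ (d - 1))" by (simp add: c_def)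
      then show ?thesis
        using card_region_lower[OF assms p(1) _ C(1), folded L_def, OF L e1 e2] by (simp only:)
    qed
    have 6: "real (card (hyp_region d p (C * (1 / p) * L ^ (d + 1)))) \<le> c' * ((1 / p) * L ^ (2 * d))"
      using card_region_upper[OF assms p(1) _ C(1), folded L_def, OF L e5] by (simp add: c'_def)
    have "- (1 / 16) * L = - L / 16" by simp
    then have "bad p = (8 * L + 1) ^ d * exp (- L / 16) + 2 ^ d * (real d + 3) * p ^ 2"
      by (simp only: bad_def L_def[symmetric])
    then show ?case
      using gaps[OF 1 2 3 4 c0 5 6] by (simp only: Let_def L_def)
  qed
  then have "\<forall>\<^sub>F p in at_right 0. 1 - bad p \<le> prob_random_subset (nat_vecs d) p (?P p)"
    "\<forall>\<^sub>F p in at_right 0. prob_random_subset (nat_vecs d) p (?P p) \<le> 1"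
    by (auto elim: eventually_mono)
  then have "whp_random_subset (nat_vecs d) ?P"
    unfolding whp_random_subset_def by (rule tendsto_sandwich[OF _ _ bad_lim tendsto_const])
  moreover have "0 < C" using C(1) by simp
  ultimately show ?thesis using \<delta>_lim c0 c'0 by blast
qed

end
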